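(* Let $n\ge2$, let $G=\mathcal B_{n+1}$ be the braid group with standard generators $s_1,\dots,s_n$, let $M$ be the submonoid of $G$ generated by $s_1,\dots,s_n$, and let $\Delta=(s_1\cdots s_n)^{n+1}$. Let $G_1$ (resp. $M_1$) be the subgroup (resp. submonoid) generated by $s_2,\dots,s_n$, and let $H$ (resp. $N$) be the subgroup (resp. submonoid) generated by $s_1,\dots,s_{n-1}$. Then the set $P=P_{H,G_1}$ of $(H,G_1)$-positive elements, with respect to the Garside structure $(G,M,\Delta)$, is equal to the set of $s_1$-positive elements of $G$.
   Context: The braid group $\mathcal B_{n+1}$ (Artin group of type $A_n$) is $G=\langle s_1,\dots,s_n\mid s_is_js_i=s_js_is_j\text{ for }|i-j|=1,\ s_is_j=s_js_i\text{ for }|i-j|\ge2\rangle$. An element $\alpha\in G$ is $s_1$-positive if it can be written $\alpha=\alpha_0s_1\alpha_1\cdots s_1\alpha_m$ with $m\ge1$ and $\alpha_0,\alpha_1,\dots,\alpha_m\in\langle s_2,\dots,s_n\rangle$. For $\alpha,\beta\in G$: $\alpha\le_R\beta$ iff $\beta\alpha^{-1}\in M$. It is known that $(G,M,\Delta)$ is a Garside structure with $\Delta$ central, and that $(G_1,M_1,(s_2\cdots s_n)^n)$ and $(H,N,(s_1\cdots s_{n-1})^n)$ are parabolic substructures. An element $a\in M$ is unmovable if $\Delta\not\le_R a$. Every $\alpha\in G$ is uniquely $\alpha=a\Delta^k$ with $a\in M$ unmovable and $k\in\mathbb Z$ (the $\Delta$-form of $\alpha$). For $K\in\{M_1,N\}$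 and $a\in M$, $\tau_K(a)$ denotes the unique $b\in K$ with $\{c\in K\mid c\le_R a\}=\{c\in K\mid c\le_R b\}$. Every $a\in M\setminus\{1\}$ is uniquely $a=a_p\cdots a_2a_1$ with $a_p\ne1$, $a_i=\tau_{M_1}(a_p\cdots a_i)$ for $i$ odd and $a_i=\tau_N(a_p\cdots a_i)$ for $i$ even; set $\mathrm{bh}(a)=p$ and $\mathrm{bh}(1)=1$. The depth is $\mathrm{dpt}(a)=(\mathrm{bh}(a)-1)/2$ if $\mathrm{bh}(a)$ is odd and $\mathrm{bh}(a)/2$ if $\mathrm{bh}(a)$ is even. An element $\alpha\in G$ with $\Delta$-form $\alpha=a\Delta^{-k}$ is $(H,G_1)$-negative if $k\ge1$ and $\mathrm{dpt}(a)<\mathrm{dpt}(\Delta^k)$; $\alpha$ is $(H,G_1)$-positive if $\alpha^{-1}$ is $(H,G_1)$-negative. *)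

theory Defs
  imports "HOL-Algebra.Generated_Groups" "HOL.Hull"
begin

section \<open>Group presentations\<close>

text \<open>
  A word over \<open>S\<close> is a list of letters \<open>(x, b)\<close> with \<open>x \<in> S\<close>; the letter \<open>(x, True)\<close> stands for
  the generator \<open>x\<close> and \<open>(x, False)\<close> for its formal inverse. A relation \<open>l = r\<close> is a pair of words.
\<close>

type_synonym 'a word = "('a \<times> bool) list"

definition words :: "'a set \<Rightarrow> 'a word set" where
  "words S = lists (S \<times> UNIV)"

inductive_set pres_rel :: "'a set \<Rightarrow> ('a word \<times> 'a word) set \<Rightarrow> ('a word \<times> 'a word) set"
  for S :: "'a set" and R :: "('a word \<times> 'a word) set" where
  refl: "w \<in> words S \<Longrightarrow> (w, w) \<in> pres_rel S R"
| sym: "(v, w) \<in> pres_rel S R \<Longrightarrow> (w, v) \<in> pres_rel S R"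
| trans: "(u, v) \<in> pres_rel S R \<Longrightarrow> (v, w) \<in> pres_rel S R \<Longrightarrow> (u, w) \<in> pres_rel S R"
| cancel: "u \<in> words S \<Longrightarrow> v \<in> words S \<Longrightarrow> x \<in> S \<Longrightarrow>
    (u @ [(x, b), (x, \<not> b)] @ v, u @ v) \<in> pres_rel S R"
| rel: "u \<in> words S \<Longrightarrow> v \<in> words S \<Longrightarrow> (l, r) \<in> R \<Longrightarrow> l \<in> words S \<Longrightarrow> r \<in> words S \<Longrightarrow>
    (u @ l @ v, u @ r @ v) \<in> pres_rel S R"

definition presented_group :: "'a set \<Rightarrow> ('a word \<times> 'a word) set \<Rightarrow> 'a word set monoid" where
  "presented_group S R =
    \<lparr>carrier = words S // pres_rel S R,
     mult = (\<lambda>A B. \<Union>u\<in>A. \<Union>v\<in>B. pres_rel S R `` {u @ v}),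
     one = pres_rel S R `` {[]}\<rparr>"

lemma words_append [simp]: "u @ v \<in> words S \<longleftrightarrow> u \<in> words S \<and> v \<in> words S"
  by (auto simp: words_def)

lemma words_Nil [simp]: "[] \<in> words S"
  by (simp add: words_def)

lemma words_Cons [simp]: "(x, b) # w \<in> words S \<longleftrightarrow> x \<in> S \<and> w \<in> words S"
  by (auto simp: words_def)

lemma pres_rel_words: "(v, w) \<in> pres_rel S R \<Longrightarrow> v \<in> words S \<and> w \<in> words S"
  by (induction rule: pres_rel.induct) auto

lemma equiv_pres_rel: "equiv (words S) (pres_rel S R)"
  by (rule equivI)
     (auto simp: refl_on_def sym_def trans_def
           dest: pres_rel_words intro: pres_rel.intros(1-3))

lemma pres_rel_context:
  assumes "(v, w) \<in> pres_rel S R" and "p \<in> words S" and "q \<in> words S"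
  shows "(p @ v @ q, p @ w @ q) \<in> pres_rel S R"
  using assms
proof (induction rule: pres_rel.induct)
  case (cancel u v x b)
  then show ?case using pres_rel.cancel[of "p @ u" S "v @ q" x b R] by simp
next
  case (rel u v l r)
  then show ?case using pres_rel.rel[of "p @ u" S "v @ q" l r R] by simp
qed (auto intro: pres_rel.intros(1-3))

lemma pres_rel_append:
  assumes "(u, u') \<in> pres_rel S R" and "(v, v') \<in> pres_rel S R"
  shows "(u @ v, u' @ v') \<in> pres_rel S R"
proof (rule pres_rel.trans)
  show "(u @ v, u' @ v) \<in> pres_rel S R"
    using pres_rel_context[OF assms(1), of "[]" v] pres_rel_words[OF assms(2)] by simp
  show "(u' @ v, u' @ v') \<in> pres_rel S R"
    using pres_rel_context[OF assms(2), of u' "[]"] pres_rel_words[OF assms(1)] by simp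
qed

lemma presented_group_mult:
  assumes "u \<in> words S" and "v \<in> words S"
  shows "(pres_rel S R `` {u}) \<otimes>\<^bsub>presented_group S R\<^esub> (pres_rel S R `` {v}) =
    pres_rel S R `` {u @ v}"
  unfolding presented_group_def monoid.simps
  by (rule UN_equiv_class2[OF equiv_pres_rel equiv_pres_rel _ assms])
     (auto simp: congruent2_def intro!: equiv_class_eq[OF equiv_pres_rel] pres_rel_append)

lemma pres_rel_inverse:
  assumes "w \<in> words S"
  shows "(rev (map (\<lambda>(x, b). (x, \<not> b)) w) @ w, []) \<in> pres_rel S R"
  using assms
proof (induction w)
  case Nil
  show ?case by (simp add: pres_rel.refl)
next
  case (Cons y w)
  obtain x b where y: "y = (x, b)" by (cases y)
  let ?i = "rev (map (\<lambda>(x, b). (x, \<not> b)) w)"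
  have w: "w \<in> words S" and x: "x \<in> S" using Cons.prems y by auto
  have i: "?i \<in> words S" using w by (induction w) auto
  show ?case
    using pres_rel.trans[OF pres_rel.cancel[OF i w x, of "\<not> b" R] Cons.IH[OF w]] by (simp add: y)
qed

lemma group_presented_group: "group (presented_group S R)"
proof (rule groupI)
  let ?G = "presented_group S R"
  have car: "carrier ?G = words S // pres_rel S R"
    and one: "\<one>\<^bsub>?G\<^esub> = pres_rel S R `` {[]}" by (simp_all add: presented_group_def)
  show "\<one>\<^bsub>?G\<^esub> \<in> carrier ?G"
    by (simp add: car one quotientI)
  show "x \<otimes>\<^bsub>?G\<^esub> y \<in> carrier ?G" if "x \<in> carrier ?G" "y \<in> carrier ?G" for x y
    using that by (auto simp: car presented_group_mult elim!: quotientE intro!: quotientI)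
  show "x \<otimes>\<^bsub>?G\<^esub> y \<otimes>\<^bsub>?G\<^esub> z = x \<otimes>\<^bsub>?G\<^esub> (y \<otimes>\<^bsub>?G\<^esub> z)"
    if "x \<in> carrier ?G" "y \<in> carrier ?G" "z \<in> carrier ?G" for x y z
    using that by (auto simp: car presented_group_mult elim!: quotientE)
  show "\<one>\<^bsub>?G\<^esub> \<otimes>\<^bsub>?G\<^esub> x = x" if "x \<in> carrier ?G" for x
    using that by (auto simp: car one presented_group_mult elim!: quotientE)
  show "\<exists>y\<in>carrier ?G. y \<otimes>\<^bsub>?G\<^esub> x = \<one>\<^bsub>?G\<^esub>" if x: "x \<in> carrier ?G" for x
  proof -
    obtain w where w: "w \<in> words S" "x = pres_rel S R `` {w}"
      using x by (auto simp: car elim!: quotientE)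
    let ?i = "rev (map (\<lambda>(x, b). (x, \<not> b)) w)"
    have i: "?i \<in> words S" using w(1) by (induction w) auto
    have "(pres_rel S R `` {?i}) \<otimes>\<^bsub>?G\<^esub> x = \<one>\<^bsub>?G\<^esub>"
      by (simp only: w(2) one presented_group_mult[OF i w(1)])
         (rule equiv_class_eq[OF equiv_pres_rel pres_rel_inverse[OF w(1)]])
    then show ?thesis using i by (auto simp: car intro: quotientI)
  qed
qed


section \<open>Braid groups\<close>

definition braid_relations :: "nat \<Rightarrow> (nat word \<times> nat word) set" where
  "braid_relations n =
    {([(i, True), (j, True), (i, True)], [(j, True), (i, True), (j, True)]) | i j.
       i \<in> {1..n} \<and> j \<in> {1..n} \<and> \<bar>int i - int j\<bar> = 1} \<union>
    {([(i, True), (j, True)], [(j, True), (i, True)]) | i j.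
       i \<in> {1..n} \<and> j \<in> {1..n} \<and> \<bar>int i - int j\<bar> \<ge> 2}"

text \<open>The parameter is the number of generators: \<open>braid_group n\<close> is the group on \<open>n + 1\<close> strands.\<close>

definition braid_group :: "nat \<Rightarrow> nat word set monoid" where
  "braid_group n = presented_group {1..n} (braid_relations n)"

definition braid_gen :: "nat \<Rightarrow> nat \<Rightarrow> nat word set" where
  "braid_gen n i = pres_rel {1..n} (braid_relations n) `` {[(i, True)]}"

lemma group_braid_group: "group (braid_group n)"
  by (simp add: braid_group_def group_presented_group)

lemma braid_gen_closed: "i \<in> {1..n} \<Longrightarrow> braid_gen n i \<in> carrier (braid_group n)"
  by (auto simp: braid_gen_def braid_group_def presented_group_def intro: quotientI)


section \<open>Products and submonoids\<close>

definition list_prod :: "('g, 'm) monoid_scheme \<Rightarrow> 'g list \<Rightarrow> 'g" where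
  "list_prod G xs = foldr (\<otimes>\<^bsub>G\<^esub>) xs \<one>\<^bsub>G\<^esub>"

definition generate_submonoid :: "('g, 'm) monoid_scheme \<Rightarrow> 'g set \<Rightarrow> 'g set" where
  "generate_submonoid G A = (\<lambda>K. submonoid K G) hull A"

text \<open>
  \<open>\<alpha> = \<alpha>\<^sub>0 s \<alpha>\<^sub>1 s \<cdots> s \<alpha>\<^sub>m\<close> with \<open>m \<ge> 1\<close> and all \<open>\<alpha>\<^sub>i \<in> K\<close>; the list \<open>as\<close> is \<open>[\<alpha>\<^sub>1, \<dots>, \<alpha>\<^sub>m]\<close>.
\<close>

definition gen_positive :: "('g, 'm) monoid_scheme \<Rightarrow> 'g \<Rightarrow> 'g set \<Rightarrow> 'g \<Rightarrow> bool" where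
  "gen_positive G s K \<alpha> \<longleftrightarrow>
    (\<exists>a0 as. a0 \<in> K \<and> set as \<subseteq> K \<and> as \<noteq> [] \<and>
       \<alpha> = a0 \<otimes>\<^bsub>G\<^esub> list_prod G (map (\<lambda>a. s \<otimes>\<^bsub>G\<^esub> a) as))"


section \<open>Depth and positivity in a Garside structure\<close>

text \<open>
  Below, \<open>G\<close> is the group, \<open>M\<close> its Garside monoid and \<open>D\<close> the Garside element; \<open>N\<close> and \<open>M1\<close> are the
  monoids of the parabolic substructures with groups \<open>H\<close> and \<open>G\<^sub>1\<close>. Depth and
  \<open>(H, G\<^sub>1)\<close>-positivity refer to \<open>H\<close> and \<open>G\<^sub>1\<close> only through these monoids.
\<close>

definition le_R :: "('g, 'm) monoid_scheme \<Rightarrow> 'g set \<Rightarrow> 'g \<Rightarrow> 'g \<Rightarrow> bool" where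
  "le_R G M \<alpha> \<beta> \<longleftrightarrow> \<beta> \<otimes>\<^bsub>G\<^esub> inv\<^bsub>G\<^esub> \<alpha> \<in> M"

definition unmovable :: "('g, 'm) monoid_scheme \<Rightarrow> 'g set \<Rightarrow> 'g \<Rightarrow> 'g \<Rightarrow> bool" where
  "unmovable G M D a \<longleftrightarrow> a \<in> M \<and> \<not> le_R G M D a"

definition is_Delta_form ::
  "('g, 'm) monoid_scheme \<Rightarrow> 'g set \<Rightarrow> 'g \<Rightarrow> 'g \<Rightarrow> 'g \<Rightarrow> int \<Rightarrow> bool" where
  "is_Delta_form G M D \<alpha> a k \<longleftrightarrow> unmovable G M D a \<and> \<alpha> = a \<otimes>\<^bsub>G\<^esub> (D [^]\<^bsub>G\<^esub> k)"

definition tail :: "('g, 'm) monoid_scheme \<Rightarrow> 'g set \<Rightarrow> 'g set \<Rightarrow> 'g \<Rightarrow> 'g" where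
  "tail G M K a = (THE b. b \<in> K \<and> {c \<in> K. le_R G M c a} = {c \<in> K. le_R G M c b})"

text \<open>
  The list \<open>as\<close> is \<open>[a\<^sub>1, \<dots>, a\<^sub>p]\<close>, whereas the factorization reads \<open>a = a\<^sub>p \<cdots> a\<^sub>2 a\<^sub>1\<close>; hence the
  reversals. List positions start at 0, so \<open>a\<^sub>i\<close> with \<open>i\<close> odd sits at an even position.
\<close>

definition is_alternating_form ::
  "('g, 'm) monoid_scheme \<Rightarrow> 'g set \<Rightarrow> 'g set \<Rightarrow> 'g set \<Rightarrow> 'g \<Rightarrow> 'g list \<Rightarrow> bool" where
  "is_alternating_form G M N M1 a as \<longleftrightarrow>
    as \<noteq> [] \<and> set as \<subseteq> M \<and> last as \<noteq> \<one>\<^bsub>G\<^esub> \<and> a = list_prod G (rev as) \<and>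
    (\<forall>i < length as.
       as ! i = tail G M (if even i then M1 else N) (list_prod G (rev (drop i as))))"

definition breadth ::
  "('g, 'm) monoid_scheme \<Rightarrow> 'g set \<Rightarrow> 'g set \<Rightarrow> 'g set \<Rightarrow> 'g \<Rightarrow> nat" where
  "breadth G M N M1 a =
    (if a = \<one>\<^bsub>G\<^esub> then 1 else length (THE as. is_alternating_form G M N M1 a as))"

definition depth ::
  "('g, 'm) monoid_scheme \<Rightarrow> 'g set \<Rightarrow> 'g set \<Rightarrow> 'g set \<Rightarrow> 'g \<Rightarrow> nat" where
  "depth G M N M1 a =
    (let p = breadth G M N M1 a in if odd p then (p - 1) div 2 else p div 2)"

definition HG1_negative ::
  "('g, 'm) monoid_scheme \<Rightarrow> 'g set \<Rightarrow> 'g \<Rightarrow> 'g set \<Rightarrow> 'g set \<Rightarrow> 'g \<Rightarrow> bool" where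
  "HG1_negative G M D N M1 \<alpha> \<longleftrightarrow>
    (\<exists>a k. is_Delta_form G M D \<alpha> a (- k) \<and> k \<ge> 1 \<and>
       depth G M N M1 a < depth G M N M1 (D [^]\<^bsub>G\<^esub> k))"

definition HG1_positive ::
  "('g, 'm) monoid_scheme \<Rightarrow> 'g set \<Rightarrow> 'g \<Rightarrow> 'g set \<Rightarrow> 'g set \<Rightarrow> 'g \<Rightarrow> bool" where
  "HG1_positive G M D N M1 \<alpha> \<longleftrightarrow> HG1_negative G M D N M1 (inv\<^bsub>G\<^esub> \<alpha>)"

end

theory Submission
  imports Defs Complex_Main "HOL-Library.Sublist"
begin

text \<open>
  Write \<open>x \<le> y\<close> if \<open>x\<^sup>-\<^sup>1 y\<close> is \<open>s\<^sub>1\<close>-positive or lies in \<open>G\<^sub>1\<close>; this is a left-invariant preorder on \<open>G\<close>, to be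
  thought of as the order of the points \<open>x p\<^sub>0\<close> of an ordered \<open>G\<close>-set with \<open>G\<^sub>1\<close> the stabilizer of \<open>p\<^sub>0\<close>.
  With \<open>c = s\<^sub>n \<cdots> s\<^sub>1\<close>, the points \<open>p\<^sub>2\<^sub>k = \<Delta>\<^sup>k p\<^sub>0\<close> and \<open>p\<^sub>2\<^sub>k\<^sub>+\<^sub>1 = c \<Delta>\<^sup>k p\<^sub>0\<close> increase, \<open>G\<^sub>1\<close> fixes those with even
  index and \<open>H\<close> those with odd index. Three facts give the theorem. (1) Since \<open>b \<Delta>\<^sup>-\<^sup>1\<close> is \<open>s\<^sub>1\<close>-negative for
  \<open>b \<in> N\<close>, so is \<open>a \<Delta>\<^sup>-\<^sup>k\<close> whenever \<open>dpt(a) \<le> k\<close> and \<open>k \<ge> 1\<close>. (2) If \<open>a = a\<^sub>p \<cdots> a\<^sub>1\<close> is the alternating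
  form and \<open>p \<ge> 2\<close>, then \<open>p\<^sub>p\<^sub>-\<^sub>2 \<le> a p\<^sub>0\<close>; hence \<open>\<Delta>\<^sup>k \<le> a\<close> whenever \<open>dpt(a) > k\<close>. (3) The unit is not
  \<open>s\<^sub>1\<close>-positive, because \<open>G\<close> acts on tuples of positive reals by rational Dynnikov formulas for which \<open>s\<^sub>1\<close>
  strictly increases a coordinate that \<open>G\<^sub>1\<close> leaves unchanged. In particular \<open>dpt(\<Delta>\<^sup>k) = k + 1\<close> for \<open>k \<ge> 1\<close>.

  The main point is (2). A positive braid that is right divisible by a single generator is constrained
  enough, by induction on the number of strands, to bound from below the image of the base point; feeding
  this bound into the next block moves it from one \<open>p\<^sub>i\<close> to the next. The divisibility statements take place
  in the positive monoid, which embeds into \<open>G\<close> by Garside's theorem.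
\<close>

section \<open>The positive braid monoid\<close>

text \<open>In (1) each block taken from N uses up one factor \<Delta>, and there are exactly dpt(a)
  = p div 2 such blocks. In (2) the point with index p - 2 lies above the power dpt(a) - 1 of
  \<Delta>. So the two alternatives dpt(a) \<le> k and dpt(a) > k are complementary: for an
  s_1-positive \<alpha> with inverse a \<Delta>^-k, the second one would make that inverse
  nonnegative, which (3) forbids.

  The obstacle in (2) is that alternating forms speak of right divisors, while points are moved by
  left factors. The bridge is a property of words: if a single generator divides a braid on the
  right, all its words contain certain runs of consecutive increasing letters as scattered
  subsequences, and reading such a run from the left lifts a point step by step.

  Divisibility is developed for positive words over all integer indices. Translations and
  reflections of the indices are then automorphisms defined everywhere, and the number of strands
  enters only through conditions on the support.\<close>

inductive bstep :: "int list \<Rightarrow> int list \<Rightarrow> bool" where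
  far: "\<bar>i - j\<bar> \<ge> 2 \<Longrightarrow> bstep (u @ [i, j] @ v) (u @ [j, i] @ v)"
| near: "\<bar>i - j\<bar> = 1 \<Longrightarrow> bstep (u @ [i, j, i] @ v) (u @ [j, i, j] @ v)"

definition peq :: "int list \<Rightarrow> int list \<Rightarrow> bool" where
  "peq = bstep\<^sup>*\<^sup>*"

lemma bstep_sym: "bstep u v \<Longrightarrow> bstep v u"
  by (auto elim!: bstep.cases intro: bstep.intros simp: abs_minus_commute)

lemma bstep_context: "bstep u v \<Longrightarrow> bstep (a @ u @ b) (a @ v @ b)"
proof (induction rule: bstep.induct)
  case (far i j u v)
  then show ?case using bstep.far[of i j "a @ u" "v @ b"] by simp
next
  case (near i j u v)
  then show ?case using bstep.near[of i j "a @ u" "v @ b"] by simp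
qed

lemma peq_bstep: "bstep u v \<Longrightarrow> peq u v"
  by (simp add: peq_def)

lemma equivp_peq: "equivp peq"
proof (rule equivpI)
  have "symp bstep\<^sup>*\<^sup>*" by (rule symp_rtranclp) (auto simp: symp_def bstep_sym)
  then show "symp peq" by (simp add: peq_def)
qed (auto simp: peq_def reflp_def transp_def)

lemma peq_context: "peq u v \<Longrightarrow> peq (a @ u @ b) (a @ v @ b)"
  unfolding peq_def by (induction rule: rtranclp_induct) (auto dest: bstep_context intro: rtranclp.rtrancl_into_rtrancl)

lemma peq_append: "peq u u' \<Longrightarrow> peq v v' \<Longrightarrow> peq (u @ v) (u' @ v')"
  using peq_context[of u u' "[]" v] peq_context[of v v' u' "[]"] equivp_transp[OF equivp_peq] by fastforce

lemma peq_invariant: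
  assumes "peq u v" "\<And>u v. bstep u v \<Longrightarrow> f u = f v"
  shows "f u = f v"
  using assms(1) unfolding peq_def by (induction rule: rtranclp_induct) (auto simp: assms(2))

lemma peq_set: "peq u v \<Longrightarrow> set u = set v"
  by (erule peq_invariant) (auto elim!: bstep.cases)

lemma peq_length: "peq u v \<Longrightarrow> length u = length v"
  by (erule peq_invariant) (auto elim!: bstep.cases)

lemma bstep_rev: "bstep u v \<Longrightarrow> bstep (rev u) (rev v)"
proof (induction rule: bstep.induct)
  case (far i j u v)
  then show ?case using bstep.far[of j i "rev v" "rev u"] by (simp add: abs_minus_commute)
next
  case (near i j u v)
  then show ?case using bstep.near[of i j "rev v" "rev u"] by simp
qed

text \<open>The relations depend only on distances between indices, so every isometry of the
  integers acts on words. Translations and reflections are the two that get lifted.\<close>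

lemma bstep_map:
  assumes "\<And>i j. \<bar>f i - f j\<bar> = \<bar>i - j\<bar>"
  shows "bstep u v \<Longrightarrow> bstep (map f u) (map f v)"
proof (induction rule: bstep.induct)
  case (far i j u v)
  then show ?case using bstep.far[of "f i" "f j" "map f u" "map f v"] by (simp add: assms)
next
  case (near i j u v)
  then show ?case using bstep.near[of "f i" "f j" "map f u" "map f v"] by (simp add: assms)
qed

lemma peq_image: "(\<And>u v. bstep u v \<Longrightarrow> bstep (F u) (F v)) \<Longrightarrow> peq u v \<Longrightarrow> peq (F u) (F v)"
  unfolding peq_def by (rotate_tac 1, induction rule: rtranclp_induct) (auto intro: rtranclp.rtrancl_into_rtrancl)

quotient_type pbraid = "int list" / peq
  by (rule equivp_peq)

instantiation pbraid :: monoid_mult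
begin

lift_definition one_pbraid :: pbraid is "[]" .

lift_definition times_pbraid :: "pbraid \<Rightarrow> pbraid \<Rightarrow> pbraid" is "(@)"
  by (rule peq_append)

instance
  by standard (transfer; simp add: equivp_reflp[OF equivp_peq])+

end

lift_definition pb :: "int list \<Rightarrow> pbraid" is "\<lambda>w. w" .
lift_definition gen :: "int \<Rightarrow> pbraid" is "\<lambda>i. [i]" .
text \<open>Both sides of each relation use the same letters. Parabolic submonoids are therefore
  described by bounding this set.\<close>

lift_definition supp :: "pbraid \<Rightarrow> int set" is set by (rule peq_set)
lift_definition len :: "pbraid \<Rightarrow> nat" is length by (rule peq_length)
lift_definition rv :: "pbraid \<Rightarrow> pbraid" is rev by (rule peq_image[OF bstep_rev])
lift_definition shift :: "int \<Rightarrow> pbraid \<Rightarrow> pbraid" is "\<lambda>d. map (\<lambda>i. i + d)"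
  by (rule peq_image[OF bstep_map]) auto
lift_definition flip :: "int \<Rightarrow> pbraid \<Rightarrow> pbraid" is "\<lambda>d. map (\<lambda>i. d - i)"
  by (rule peq_image[OF bstep_map]) auto

lemma pb_eq_iff: "pb u = pb v \<longleftrightarrow> peq u v"
  by transfer simp

lemma pb_Nil [simp]: "pb [] = 1"
  by transfer (simp add: equivp_reflp[OF equivp_peq])

lemma pb_Cons: "pb (i # w) = gen i * pb w"
  by transfer (simp add: equivp_reflp[OF equivp_peq])

lemma pb_append [simp]: "pb (u @ v) = pb u * pb v"
  by transfer (simp add: equivp_reflp[OF equivp_peq])

lemma pb_single: "pb [i] = gen i"
  by (simp add: pb_Cons)

lemma pb_cases: obtains w where "x = pb w"
  by transfer (use equivp_reflp[OF equivp_peq] in blast)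

lemma gen_far: "\<bar>i - j\<bar> \<ge> 2 \<Longrightarrow> gen i * gen j = gen j * gen i"
  by transfer (use peq_bstep[OF far[of _ _ "[]" "[]"]] in simp)

lemma gen_near: "\<bar>i - j\<bar> = 1 \<Longrightarrow> gen i * gen j * gen i = gen j * gen i * gen j"
  by transfer (use peq_bstep[OF near[of _ _ "[]" "[]"]] in simp)

lemma supp_simps [simp]: "supp 1 = {}" "supp (x * y) = supp x \<union> supp y" "supp (gen i) = {i}" "supp (pb w) = set w"
  by (transfer; simp)+

lemma len_simps [simp]: "len 1 = 0" "len (x * y) = len x + len y" "len (gen i) = 1" "len (pb w) = length w"
  by (transfer; simp)+

lemma rv_simps [simp]: "rv 1 = 1" "rv (x * y) = rv y * rv x" "rv (gen i) = gen i" "rv (rv x) = x" "rv (pb w) = pb (rev w)"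
  by (transfer; simp add: equivp_reflp[OF equivp_peq])+

lemma shift_simps [simp]: "shift d 1 = 1" "shift d (x * y) = shift d x * shift d y" "shift d (gen i) = gen (i + d)"
   "supp (shift d x) = (\<lambda>i. i + d) ` supp x" "len (shift d x) = len x" "shift d (pb w) = pb (map (\<lambda>i. i + d) w)" "shift (- d) (shift d x) = x" "shift d (shift (- d) x) = x"
  by (transfer; simp add: equivp_reflp[OF equivp_peq] o_def)+

lemma flip_simps [simp]: "flip d 1 = 1" "flip d (x * y) = flip d x * flip d y" "flip d (gen i) = gen (d - i)"
   "supp (flip d x) = (\<lambda>i. d - i) ` supp x" "len (flip d x) = len x" "flip d (pb w) = pb (map (\<lambda>i. d - i) w)"
   "flip d (flip d x) = x"
  by (transfer; simp add: equivp_reflp[OF equivp_peq] o_def)+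

lemma len_eq_0_iff [simp]: "len x = 0 \<longleftrightarrow> x = 1"
  by transfer (metis equivp_reflp[OF equivp_peq] length_0_conv peq_length)

lemma supp_empty_iff [simp]: "supp x = {} \<longleftrightarrow> x = 1"
  by transfer (metis equivp_reflp[OF equivp_peq] length_0_conv peq_length set_empty)

lemma pbraid_mult_eq_1: "x * y = 1 \<longleftrightarrow> x = 1 \<and> y = (1 :: pbraid)"
  by (metis add_is_0 len_eq_0_iff len_simps(2) mult.right_neutral)

section \<open>Common multiples of two generators, and cancellation\<close>

definition left_common :: "int \<Rightarrow> int \<Rightarrow> pbraid \<Rightarrow> pbraid \<Rightarrow> bool" where
  "left_common i j u v \<longleftrightarrow>
     (if i = j then u = v
      else if \<bar>i - j\<bar> = 1 then \<exists>z. u = gen j * gen i * z \<and> v = gen i * gen j * z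
      else \<exists>z. u = gen j * z \<and> v = gen i * z)"

lemma left_common_sym: "left_common i j u v \<Longrightarrow> left_common j i v u"
  by (auto simp: left_common_def abs_minus_commute split: if_splits)

lemma gen_far': "\<bar>i - j\<bar> \<ge> 2 \<Longrightarrow> gen i * (gen j * z) = gen j * (gen i * z)"
  using gen_far[of i j] by (metis mult.assoc)

lemma gen_near': "\<bar>i - j\<bar> = 1 \<Longrightarrow> gen i * (gen j * (gen i * z)) = gen j * (gen i * (gen j * z))"
  using gen_near[of i j] by (metis mult.assoc)

lemma int_abs_cases:
  fixes i j :: int
  obtains "i = j" | "\<bar>i - j\<bar> = 1" "i \<noteq> j" | "\<bar>i - j\<bar> \<ge> 2" "i \<noteq> j"
  by (cases "i = j"; cases "\<bar>i - j\<bar> = 1") auto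

lemma left_commonD:
  assumes "left_common i j u v"
  shows "i = j \<Longrightarrow> u = v"
    and "\<bar>i - j\<bar> = 1 \<Longrightarrow> \<exists>z. u = gen j * (gen i * z) \<and> v = gen i * (gen j * z)"
    and "\<bar>i - j\<bar> \<ge> 2 \<Longrightarrow> \<exists>z. u = gen j * z \<and> v = gen i * z"
  using assms by (auto simp: left_common_def mult.assoc split: if_splits)

lemma left_commonI:
  "i = j \<Longrightarrow> u = v \<Longrightarrow> left_common i j u v"
  "\<bar>i - j\<bar> = 1 \<Longrightarrow> u = gen j * (gen i * z) \<Longrightarrow> v = gen i * (gen j * z) \<Longrightarrow> left_common i j u v"
  "\<bar>i - j\<bar> \<ge> 2 \<Longrightarrow> u = gen j * z \<Longrightarrow> v = gen i * z \<Longrightarrow> left_common i j u v"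
  by (auto simp: left_common_def mult.assoc)

text \<open>This lemma and the next two settle the triples i, k, j that arise when the first letter
  of a word changes from k to j. Here k is far from i and next to j. Cofactors are split by the
  induction hypothesis until a common remainder appears, and braid moves rebuild both sides around
  it.\<close>

lemma left_common_far_near:
  assumes IH: "\<And>i j u v. gen i * u = gen j * v \<Longrightarrow> len u < N \<Longrightarrow> left_common i j u v"
    and ik: "\<bar>i - k\<bar> \<ge> 2" and jk: "\<bar>j - k\<bar> = 1" and ij: "i \<noteq> j"
    and eq: "gen i * z = gen j * (gen k * x)" and len: "len z < N"
  shows "left_common i j (gen k * z) (gen k * (gen j * x))"
proof -
  have lc: "left_common i j z (gen k * x)" using IH[OF eq len] .
  have kj: "\<bar>k - j\<bar> = 1" "\<bar>k - i\<bar> \<ge> 2" using jk ik by auto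
  show ?thesis
  proof (cases i j rule: int_abs_cases)
    case 1 then show ?thesis using ij by simp
  next
    case 2
    then obtain y where y: "z = gen j * (gen i * y)" "gen k * x = gen i * (gen j * y)"
      using left_commonD(2)[OF lc] by blast
    have "len (gen j * y) < N" "len x < N" using y(1) len arg_cong[OF y(2), of len] by simp_all
    then obtain y' where y': "x = gen i * y'" "gen j * y = gen k * y'"
      using left_commonD(3)[OF IH[OF y(2)] kj(2)] by auto
    have "len y < N" using y len by simp
    then obtain y'' where y'': "y = gen k * (gen j * y'')" "y' = gen j * (gen k * y'')"
      using left_commonD(2)[OF IH[OF y'(2)] jk] by auto
    show ?thesis
    proof (rule left_commonI(2)[OF 2(1)])
      have "gen k * z = gen k * (gen j * (gen i * (gen k * (gen j * y''))))" using y y'' by simp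
      also have "\<dots> = gen k * (gen j * (gen k * (gen i * (gen j * y''))))" by (simp add: gen_far'[OF ik])
      also have "\<dots> = gen j * (gen k * (gen j * (gen i * (gen j * y''))))" by (rule gen_near'[OF kj(1)])
      also have "\<dots> = gen j * (gen k * (gen i * (gen j * (gen i * y''))))" by (simp add: gen_near'[OF 2(1)])
      also have "\<dots> = gen j * (gen i * (gen k * (gen j * (gen i * y''))))" by (simp add: gen_far'[OF ik])
      finally show "gen k * z = gen j * (gen i * (gen k * (gen j * (gen i * y''))))" .
      have "gen k * (gen j * x) = gen k * (gen j * (gen i * (gen j * (gen k * y''))))" using y' y'' by simp
      also have "\<dots> = gen k * (gen i * (gen j * (gen i * (gen k * y''))))" by (simp add: gen_near'[OF 2(1)])
      also have "\<dots> = gen i * (gen k * (gen j * (gen k * (gen i * y''))))" by (simp add: gen_far'[OF ik])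
      also have "\<dots> = gen i * (gen j * (gen k * (gen j * (gen i * y''))))" by (simp add: gen_near'[OF kj(1)])
      finally show "gen k * (gen j * x) = gen i * (gen j * (gen k * (gen j * (gen i * y''))))" .
    qed
  next
    case 3
    then obtain y where y: "z = gen j * y" "gen k * x = gen i * y"
      using left_commonD(3)[OF lc] by blast
    have "len x < N" using y(1) len arg_cong[OF y(2), of len] by simp
    then obtain y' where y': "x = gen i * y'" "y = gen k * y'"
      using left_commonD(3)[OF IH[OF y(2)] kj(2)] by auto
    show ?thesis
    proof (rule left_commonI(3)[OF 3(1)])
      show "gen k * z = gen j * (gen k * (gen j * y'))"
        using y y' gen_near'[OF kj(1)] by simp
      show "gen k * (gen j * x) = gen i * (gen k * (gen j * y'))"
        using y' gen_far'[OF 3(1)] gen_far'[OF ik] by simp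
    qed
  qed
qed

text \<open>As i and j are distinct neighbours of k, they lie on either side of it and commute. The
  cofactor y gets two expansions; comparing them, with cancellation of gen k as the equal-index case
  of the hypothesis, yields the common remainder.\<close>

lemma left_common_near_near:
  assumes IH: "\<And>i j u v. gen i * u = gen j * v \<Longrightarrow> len u < N \<Longrightarrow> left_common i j u v"
    and ik: "\<bar>i - k\<bar> = 1" and jk: "\<bar>j - k\<bar> = 1" and ij: "i \<noteq> j"
    and eq: "gen i * (gen k * z) = gen j * (gen k * x)" and len: "len (gen k * z) < N"
  shows "left_common i j (gen k * (gen i * z)) (gen k * (gen j * x))"
proof -
  have d: "\<bar>i - j\<bar> \<ge> 2" "\<bar>k - j\<bar> = 1" "\<bar>k - i\<bar> = 1" using ik jk ij by auto
  obtain y where y: "gen k * z = gen j * y" "gen k * x = gen i * y"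
    using left_commonD(3)[OF IH[OF eq len] d(1)] by blast
  have l: "len x < N" "len z < N" "len z = len x" "len y = len x"
    using len arg_cong[OF y(1), of len] arg_cong[OF y(2), of len] by simp_all
  obtain y1 where y1: "z = gen j * (gen k * y1)" "y = gen k * (gen j * y1)"
    using left_commonD(2)[OF IH[OF y(1) l(2)] d(2)] by blast
  obtain y2 where y2: "x = gen i * (gen k * y2)" "y = gen k * (gen i * y2)"
    using left_commonD(2)[OF IH[OF y(2) l(1)] d(3)] by blast
  have e: "gen k * (gen j * y1) = gen k * (gen i * y2)" using y1 y2 by simp
  have l1: "len (gen j * y1) < N" using y1 l by simp
  have e2: "gen j * y1 = gen i * y2" using left_commonD(1)[OF IH[OF e l1]] by simp
  have "len y1 < N" using l1 by simp
  then obtain y3 where y3: "y1 = gen i * y3" "y2 = gen j * y3"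
    using left_commonD(3)[OF IH[OF e2]] d(1) by (metis abs_minus_commute)
  show ?thesis
  proof (rule left_commonI(3)[OF d(1)])
    have "gen k * (gen i * z) = gen k * (gen i * (gen j * (gen k * (gen i * y3))))" using y1 y3 by simp
    also have "\<dots> = gen k * (gen j * (gen i * (gen k * (gen i * y3))))" by (simp add: gen_far'[OF d(1)])
    also have "\<dots> = gen k * (gen j * (gen k * (gen i * (gen k * y3))))" by (simp add: gen_near'[OF ik])
    also have "\<dots> = gen j * (gen k * (gen j * (gen i * (gen k * y3))))" by (simp add: gen_near'[OF d(2)])
    finally show "gen k * (gen i * z) = gen j * (gen k * (gen j * (gen i * (gen k * y3))))" .
    have "gen k * (gen j * x) = gen k * (gen j * (gen i * (gen k * (gen j * y3))))" using y2 y3 by simp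
    also have "\<dots> = gen k * (gen i * (gen j * (gen k * (gen j * y3))))" by (simp add: gen_far'[OF d(1)])
    also have "\<dots> = gen k * (gen i * (gen k * (gen j * (gen k * y3))))" by (simp add: gen_near'[OF jk])
    also have "\<dots> = gen i * (gen k * (gen i * (gen j * (gen k * y3))))" by (simp add: gen_near'[OF d(3)])
    finally show "gen k * (gen j * x) = gen i * (gen k * (gen j * (gen i * (gen k * y3))))"
      by (simp add: gen_far'[OF d(1)])
  qed
qed

lemma left_common_far_far:
  assumes IH: "\<And>i j u v. gen i * u = gen j * v \<Longrightarrow> len u < N \<Longrightarrow> left_common i j u v"
    and ik: "\<bar>i - k\<bar> \<ge> 2" and jk: "\<bar>j - k\<bar> \<ge> 2" and ij: "i \<noteq> j"
    and eq: "gen i * z = gen j * x" and len: "len z < N"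
  shows "left_common i j (gen k * z) (gen k * x)"
proof -
  have lc: "left_common i j z x" using IH[OF eq len] .
  show ?thesis
  proof (cases i j rule: int_abs_cases)
    case 1 then show ?thesis using ij by simp
  next
    case 2
    then obtain y where y: "z = gen j * (gen i * y)" "x = gen i * (gen j * y)"
      using left_commonD(2)[OF lc] by blast
    show ?thesis
      by (rule left_commonI(2)[OF 2(1), of _ "gen k * y"]) (simp_all add: y gen_far'[OF ik] gen_far'[OF jk])
  next
    case 3
    then obtain y where y: "z = gen j * y" "x = gen i * y"
      using left_commonD(3)[OF lc] by blast
    show ?thesis
      by (rule left_commonI(3)[OF 3(1), of _ "gen k * y"]) (simp_all add: y gen_far'[OF ik] gen_far'[OF jk])
  qed
qed

lemma bstep_ConsE:
  assumes "bstep (k # c) w"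
  obtains (tail) b where "w = k # b" "bstep c b"
  | (far) j x where "c = j # x" "w = j # k # x" "\<bar>j - k\<bar> \<ge> 2"
  | (near) j x where "c = j # k # x" "w = j # k # j # x" "\<bar>j - k\<bar> = 1"
  using assms
proof (cases rule: bstep.cases)
  case (far i j u v)
  then show ?thesis
    using that(1,2) bstep.far[of i j "tl u" v] by (cases u) (auto simp: abs_minus_commute)
next
  case (near i j u v)
  then show ?thesis
    using that(1,3) bstep.near[of i j "tl u" v] by (cases u) (auto simp: abs_minus_commute)
qed

text \<open>A rewriting step either keeps the first letter or changes it from k to j at the very
  front, where the three lemmas on triples apply. The hypothesis is used only for cofactors shorter
  than u, so the bound \<open>len u \<le> N\<close> is enough.\<close>

lemma left_common_step:
  assumes IH: "\<And>i j u v. gen i * u = gen j * v \<Longrightarrow> len u < N \<Longrightarrow> left_common i j u v"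
    and lc: "left_common i k u (pb c)" and step: "bstep (k # c) (j # b)" and len: "len u \<le> N"
  shows "left_common i j u (pb b)"
  using step
proof (cases rule: bstep_ConsE)
  case (tail b')
  then have "pb c = pb b" "k = j" by (auto simp: pb_eq_iff peq_bstep)
  then show ?thesis using lc by simp
next
  case (far j' x)
  then have w: "pb c = gen j * pb x" "pb b = gen k * pb x" "\<bar>j - k\<bar> \<ge> 2" by (auto simp: pb_Cons)
  then have d: "\<bar>k - j\<bar> \<ge> 2" by auto
  consider "i = k" | "\<bar>i - k\<bar> \<ge> 2" "i = j" | "\<bar>i - k\<bar> = 1" | "\<bar>i - k\<bar> \<ge> 2" "i \<noteq> j"
    by (cases i k rule: int_abs_cases) blast+
  then show ?thesis
  proof cases
    case 1
    then show ?thesis using left_commonD(1)[OF lc 1] w d 1 by (auto intro!: left_commonI(3))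
  next
    case 2
    then obtain z where z: "u = gen k * z" "gen i * z = gen i * pb x" using left_commonD(3)[OF lc] w by auto
    have "z = pb x" using left_commonD(1)[OF IH[OF z(2)]] z(1) len by simp
    then show ?thesis using 2 z w by (auto intro: left_commonI(1))
  next
    case 3
    then have ij: "j \<noteq> i" using w(3) by auto
    obtain z where z: "u = gen k * (gen i * z)" "gen j * pb x = gen i * (gen k * z)"
      using left_commonD(2)[OF lc 3] w by auto
    have "len (pb x) < N" using arg_cong[OF z(2), of len] z(1) len by simp
    from left_common_far_near[OF IH w(3) 3 ij z(2) this] show ?thesis
      using z w left_common_sym by simp
  next
    case 4
    then obtain z where z: "u = gen k * z" "gen i * z = gen j * pb x" using left_commonD(3)[OF lc] w by auto
    then show ?thesis using left_common_far_far[OF IH 4(1) w(3) 4(2) z(2)] w len by simp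
  qed
next
  case (near j' x)
  then have w: "pb c = gen j * (gen k * pb x)" "pb b = gen k * (gen j * pb x)" "\<bar>j - k\<bar> = 1"
    by (auto simp: pb_Cons)
  then have d: "\<bar>k - j\<bar> = 1" by auto
  consider "i = k" | "\<bar>i - k\<bar> = 1" "i = j" | "\<bar>i - k\<bar> = 1" "i \<noteq> j" | "\<bar>i - k\<bar> \<ge> 2" "i \<noteq> j"
    using w(3) by (cases i k rule: int_abs_cases) force+
  then show ?thesis
  proof cases
    case 1
    then show ?thesis using left_commonD(1)[OF lc 1] w d 1 by (auto intro!: left_commonI(2))
  next
    case 2
    then obtain z where z: "u = gen k * (gen i * z)" "gen i * (gen k * z) = gen i * (gen k * pb x)"
      using left_commonD(2)[OF lc] w by auto
    have z2: "gen k * z = gen k * pb x" using left_commonD(1)[OF IH[OF z(2)]] z(1) len by simp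
    have "z = pb x" using left_commonD(1)[OF IH[OF z2]] z(1) len by simp
    then show ?thesis using 2 z w by (auto intro: left_commonI(1))
  next
    case 3
    then obtain z where z: "u = gen k * (gen i * z)" "gen i * (gen k * z) = gen j * (gen k * pb x)"
      using left_commonD(2)[OF lc] w by auto
    then show ?thesis using left_common_near_near[OF IH 3(1) w(3) 3(2) z(2)] w len by simp
  next
    case 4
    then obtain z where z: "u = gen k * z" "gen i * z = gen j * (gen k * pb x)"
      using left_commonD(3)[OF lc] w by auto
    then show ?thesis using left_common_far_near[OF IH 4(1) w(3) 4(2) z(2)] w len by simp
  qed
qed

text \<open>Garside's theorem. The outer induction is on the length; the inner one follows a chain
  of rewriting steps from \<open>i # a\<close> to \<open>j # b\<close> and records how the current
  first letter and remainder are related to i and u. The case i = j is left cancellation.\<close>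

lemma gen_left_common:
  "gen i * u = gen j * v \<Longrightarrow> left_common i j u v"
proof (induction "len u" arbitrary: i j u v rule: less_induct)
  case less
  obtain a where a: "u = pb a" by (rule pb_cases)
  obtain b where b: "v = pb b" by (rule pb_cases)
  have *: "bstep\<^sup>*\<^sup>* (i # a) w \<Longrightarrow> \<exists>k c. w = k # c \<and> left_common i k u (pb c)" for w
  proof (induction rule: rtranclp_induct)
    case base
    show ?case by (auto simp: a intro: left_commonI(1))
  next
    case (step y z)
    obtain k c where kc: "y = k # c" "left_common i k u (pb c)" using step.IH by blast
    obtain j b where jb: "z = j # b" using step.hyps(2) kc(1) by (auto elim: bstep_ConsE)
    have "left_common i j u (pb b)"
      using left_common_step[of "len u", OF _ kc(2), of j b] less.hyps step.hyps(2) kc jb by blast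
    then show ?case using jb by blast
  qed
  have "bstep\<^sup>*\<^sup>* (i # a) (j # b)"
    using less.prems by (simp add: a b pb_eq_iff flip: pb_Cons peq_def)
  from *[OF this] show ?case by (auto simp: b)
qed

lemma left_cancel_gen: "gen i * u = gen i * v \<Longrightarrow> u = v"
  using left_commonD(1)[OF gen_left_common] by blast

lemma pbraid_left_cancel [simp]: "w * u = w * v \<longleftrightarrow> u = (v :: pbraid)"
proof
  obtain l where l: "w = pb l" by (rule pb_cases)
  show "w * u = w * v \<Longrightarrow> u = v"
    unfolding l by (induction l) (auto simp: pb_Cons mult.assoc dest: left_cancel_gen)
qed simp

lemma pbraid_right_cancel [simp]: "u * w = v * w \<longleftrightarrow> u = (v :: pbraid)"
  by (metis pbraid_left_cancel rv_simps(2,4))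

lemma gen_right_common:
  assumes "u * gen i = v * gen j"
  shows "\<bar>i - j\<bar> = 1 \<Longrightarrow> \<exists>z. u = z * gen i * gen j \<and> v = z * gen j * gen i"
    and "\<bar>i - j\<bar> \<ge> 2 \<Longrightarrow> \<exists>z. u = z * gen j \<and> v = z * gen i"
proof -
  have "gen i * rv u = gen j * rv v" using arg_cong[OF assms, of rv] by simp
  note lc = left_commonD[OF gen_left_common[OF this]]
  { assume "\<bar>i - j\<bar> = 1"
    then obtain z where "rv u = gen j * (gen i * z)" "rv v = gen i * (gen j * z)" using lc by blast
    then have "u = rv z * gen i * gen j" "v = rv z * gen j * gen i" by (metis rv_simps mult.assoc)+
    then show "\<exists>z. u = z * gen i * gen j \<and> v = z * gen j * gen i" by blast }
  { assume "\<bar>i - j\<bar> \<ge> 2"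
    then obtain z where "rv u = gen j * z" "rv v = gen i * z" using lc by blast
    then have "u = rv z * gen j" "v = rv z * gen i" by (metis rv_simps)+
    then show "\<exists>z. u = z * gen j \<and> v = z * gen i" by blast }
qed

section \<open>Ascending and descending products\<close>

lemma pb_induct [case_names one gen_mult]:
  assumes "P 1" "\<And>i x. P x \<Longrightarrow> P (gen i * x)"
  shows "P x"
proof -
  obtain w where "x = pb w" by (rule pb_cases)
  moreover have "P (pb w)" by (induction w) (simp_all add: assms pb_Cons)
  ultimately show ?thesis by simp
qed

definition up :: "int \<Rightarrow> int \<Rightarrow> pbraid" where "up a b = pb [a..b]"
definition dn :: "int \<Rightarrow> int \<Rightarrow> pbraid" where "dn b a = pb (rev [a..b])"

lemma rv_up [simp]: "rv (up a b) = dn b a" and rv_dn [simp]: "rv (dn b a) = up a b"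
  by (simp_all add: up_def dn_def)

lemma supp_up [simp]: "supp (up a b) = {a..b}" and supp_dn [simp]: "supp (dn b a) = {a..b}"
  by (simp_all add: up_def dn_def)

lemma up_empty [simp]: "b < a \<Longrightarrow> up a b = 1" and dn_empty [simp]: "b < a \<Longrightarrow> dn b a = 1"
  by (simp_all add: up_def dn_def)

lemma up_same [simp]: "up a a = gen a" and dn_same [simp]: "dn a a = gen a"
  by (simp_all add: up_def dn_def pb_single)

lemma up_left: "a \<le> b \<Longrightarrow> up a b = gen a * up (a + 1) b"
  by (simp add: up_def upto_rec1 pb_Cons)

lemma up_right: "a \<le> b \<Longrightarrow> up a b = up a (b - 1) * gen b"
  by (simp add: up_def upto_rec2 pb_single)

lemma dn_left: "a \<le> b \<Longrightarrow> dn b a = gen b * dn (b - 1) a"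
  by (simp add: dn_def upto_rec2 pb_Cons)

lemma dn_right: "a \<le> b \<Longrightarrow> dn b a = dn b (a + 1) * gen a"
  by (simp add: dn_def upto_rec1 pb_single)

lemma up_split: "a \<le> c + 1 \<Longrightarrow> c \<le> b \<Longrightarrow> up a b = up a c * up (c + 1) b"
  by (cases "c = b") (simp_all add: up_def upto_split1[of a "c + 1" b] flip: pb_append)

lemma flip_up [simp]: "flip d (up a b) = dn (d - a) (d - b)"
proof (induction "nat (b - a + 1)" arbitrary: a)
  case 0 then show ?case by simp
next
  case (Suc k)
  then show ?case
    using up_left[of a b] dn_left[of "d - b" "d - a"] Suc(1)[of "a + 1"] by (simp add: algebra_simps)
qed

lemma flip_dn [simp]: "flip d (dn b a) = up (d - b) (d - a)"
  using flip_up[of d "d - b" "d - a"] flip_simps(7)[of d "up (d - b) (d - a)"] by simp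

lemma gen_commute_far:
  assumes "\<And>j. j \<in> supp x \<Longrightarrow> \<bar>i - j\<bar> \<ge> 2"
  shows "gen i * x = x * gen i"
  using assms
proof (induction x rule: pb_induct)
  case (gen_mult j x)
  then show ?case by (simp add: mult.assoc gen_far'[of i j])
qed simp

lemma shift_through:
  assumes "\<And>i. i \<in> supp x \<Longrightarrow> w * gen i = gen (i + d) * w"
  shows "w * x = shift d x * w"
  using assms
proof (induction x rule: pb_induct)
  case (gen_mult j x)
  then have "w * gen j = gen (j + d) * w" "w * x = shift d x * w" by simp_all
  then show ?case by (metis mult.assoc shift_simps(2,3))
qed simp

lemma up_gen:
  assumes "a \<le> i" "i < b"
  shows "up a b * gen i = gen (i + 1) * up a b"
proof -
  let ?l = "up a (i - 1)" and ?r = "up (i + 2) b"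
  have u: "up a b = ?l * (gen i * (gen (i + 1) * ?r))"
    using assms up_split[of a "i - 1" b] up_left[of i b] up_left[of "i + 1" b] by (simp add: add.commute)
  have r: "?r * gen i = gen i * ?r" by (rule gen_commute_far[symmetric]) auto
  have l: "?l * gen (i + 1) = gen (i + 1) * ?l" by (rule gen_commute_far[symmetric]) auto
  have "up a b * gen i = ?l * (gen i * (gen (i + 1) * (gen i * ?r)))"
    by (simp add: u mult.assoc r)
  also have "\<dots> = ?l * (gen (i + 1) * (gen i * (gen (i + 1) * ?r)))"
    by (simp add: gen_near'[of i "i + 1"])
  also have "\<dots> = gen (i + 1) * (?l * (gen i * (gen (i + 1) * ?r)))"
    using l by (metis mult.assoc)
  finally show ?thesis by (simp add: u)
qed

lemma up_shift: "supp x \<subseteq> {a..b - 1} \<Longrightarrow> up a b * x = shift 1 x * up a b"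
  by (rule shift_through) (use up_gen in force)

lemma up_shift_down: "supp x \<subseteq> {a + 1..b} \<Longrightarrow> up a b * shift (-1) x = x * up a b"
  using up_shift[of "shift (-1) x" a b] shift_simps(8)[of 1 x] by force

lemma shift_0 [simp]: "shift 0 x = x"
  by (induction x rule: pb_induct) simp_all

lemma rv_shift [simp]: "rv (shift d x) = shift d (rv x)"
  by (induction x rule: pb_induct) simp_all

lemma supp_rv [simp]: "supp (rv x) = supp x"
  by (induction x rule: pb_induct) auto

lemma dn_shift: "supp x \<subseteq> {a..b - 1} \<Longrightarrow> x * dn b a = dn b a * shift 1 x"
  using arg_cong[OF up_shift[of "rv x" a b], of rv] by simp

lemma dn_shift_down: "supp x \<subseteq> {a + 1..b} \<Longrightarrow> shift (-1) x * dn b a = dn b a * x"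
  using arg_cong[OF up_shift_down[of "rv x" a b], of rv] by simp

lemma shift_up [simp]: "shift d (up a b) = up (a + d) (b + d)"
proof (induction "nat (b - a + 1)" arbitrary: a)
  case 0 then show ?case by simp
next
  case (Suc k)
  then show ?case
    using up_left[of a b] up_left[of "a + d" "b + d"] Suc(1)[of "a + 1"] by (simp add: algebra_simps)
qed

lemma shift_dn [simp]: "shift d (dn b a) = dn (b + d) (a + d)"
  by (metis rv_shift rv_up shift_up)

text \<open>Each generator of the ascending product crosses \<open>dn m 1\<close> and leaves it with
  its index raised by one. On the right-hand side the last factor consists of letters from 2 on,
  which will fix the base point.\<close>

lemma up_dn:
  assumes "1 \<le> k" "k \<le> m"
  shows "up k m * dn (m - 1) 1 = dn m 1 * up (k + 1) m"
  using assms
proof (induction "nat (m - k)" arbitrary: k)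
  case 0
  then show ?case using dn_left[of 1 m] by simp
next
  case (Suc i)
  have IH: "up (k + 1) m * dn (m - 1) 1 = dn m 1 * up (k + 2) m"
    using Suc(1)[of "k + 1"] Suc(2-) by (simp add: algebra_simps)
  have k: "gen k * dn m 1 = dn m 1 * gen (k + 1)"
    using dn_shift[of "gen k" 1 m] Suc(2-) by simp
  have "up k m * dn (m - 1) 1 = gen k * (up (k + 1) m * dn (m - 1) 1)"
    using Suc(2-) up_left[of k m] by (simp add: mult.assoc)
  also have "\<dots> = dn m 1 * gen (k + 1) * up (k + 2) m" by (simp add: IH k flip: mult.assoc)
  also have "\<dots> = dn m 1 * up (k + 1) m" using Suc(2-) up_left[of "k + 1" m] by (simp add: mult.assoc add.commute)
  finally show ?case .
qed

text \<open>Write x_r for \<open>up r m * dn m 1\<close>. Both right-hand sides end in a factor on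
  the letters 2, \<dots>, m. In an order where appending positive factors does not lower a point and
  this end factor fixes it, the identities give x_(r+1) \<le> x_r and x_r \<le> gen r * x_r.\<close>

lemma up_mono_identity:
  assumes "1 \<le> r" "r \<le> m"
  shows "up (r + 1) m * dn m 1 * (up (r + 1) m * dn m 1) = up r m * dn m 1 * (up (r + 1) m * dn m 2)"
    and "up r m * dn m 1 * (up (r + 1) m * dn m 1) = gen r * (up r m * dn m 1) * (up (r + 1) m * dn m 2)"
proof -
  have 1: "dn m 1 * up (r + 1) m = up r (m - 1) * dn m 1"
    using dn_shift[of "up r (m - 1)" 1 m] assms by simp
  have 2: "dn m 1 * dn m 2 = dn (m - 1) 1 * dn m 1"
    using dn_shift[of "dn (m - 1) 1" 1 m] by simp
  have 3: "up r m * up r (m - 1) = up (r + 1) m * up r m"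
    using up_shift[of "up r (m - 1)" r m] by simp
  have 4: "up r (m - 1) * dn m 1 = up r m * dn (m - 1) 1"
    using up_right[of r m] dn_left[of 1 m] assms by (simp add: mult.assoc)
  have 5: "up r m = gen r * up (r + 1) m" using up_left assms by simp
  show "up (r + 1) m * dn m 1 * (up (r + 1) m * dn m 1) = up r m * dn m 1 * (up (r + 1) m * dn m 2)"
    by (metis 1 2 3 4 mult.assoc)
  then show "up r m * dn m 1 * (up (r + 1) m * dn m 1) = gen r * (up r m * dn m 1) * (up (r + 1) m * dn m 2)"
    by (metis 1 2 3 4 5 mult.assoc)
qed

section \<open>The full twist: a factorization, centrality, and division by each generator\<close>

definition twist :: "int \<Rightarrow> pbraid" where "twist n = up 1 n ^ nat (n + 1)"

lemma up_power:
  assumes "0 \<le> n"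
  shows "int k \<le> n \<Longrightarrow> up 1 n ^ k = dn k 1 * up 2 n ^ k"
proof (induction k)
  case (Suc k)
  have "up 1 n ^ Suc k = up 1 n * dn k 1 * up 2 n ^ k" using Suc by (simp add: mult.assoc)
  also have "up 1 n * dn k 1 = dn (k + 1) 2 * up 1 n"
    using up_shift[of "dn k 1" 1 n] Suc.prems by (simp add: add.commute)
  also have "\<dots> = dn (k + 1) 1 * up 2 n"
    using up_left[of 1 n] dn_right[of 1 "k + 1"] Suc.prems by (simp add: mult.assoc add.commute)
  finally show ?case by (simp add: mult.assoc algebra_simps)
qed simp

text \<open>The exponent n + 1 exceeds the range of \<open>up_power\<close> by one, so one factor
  \<open>up 1 n\<close> stays in front. The last factor avoids the letter 1: at the base point the
  twist acts like \<open>up 1 n * dn n 1\<close>.\<close>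

lemma twist_eq: "0 \<le> n \<Longrightarrow> twist n = up 1 n * dn n 1 * up 2 n ^ nat n"
  using up_power[of n "nat n"] by (simp add: twist_def nat_add_distrib mult.assoc)

text \<open>Conjugation by \<open>up 1 n\<close> raises an index by one; this is the wrap-around,
  where two factors carry n back to 1.\<close>

lemma up_up_gen:
  assumes "1 \<le> n"
  shows "up 1 n * up 1 n * gen n = gen 1 * up 1 n * up 1 n"
proof -
  have "up 1 n * up 1 n = up 1 n * up 1 (n - 1) * gen n"
    using assms up_right[of 1 n] by (simp add: mult.assoc)
  also have "up 1 n * up 1 (n - 1) = up 2 n * up 1 n"
    using up_shift[of "up 1 (n - 1)" 1 n] by simp
  finally have "up 1 n * up 1 n = up 2 n * up 1 n * gen n" .
  then have "gen 1 * (up 1 n * up 1 n) = gen 1 * up 2 n * up 1 n * gen n" by (simp add: mult.assoc)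
  also have "gen 1 * up 2 n = up 1 n" using assms up_left[of 1 n] by simp
  finally show ?thesis by (simp add: mult.assoc)
qed

lemma up_power_gen:
  "1 \<le> i \<Longrightarrow> i + int k \<le> n \<Longrightarrow> up 1 n ^ k * gen i = gen (i + k) * up 1 n ^ k"
proof (induction k)
  case (Suc k)
  then have "up 1 n ^ Suc k * gen i = up 1 n * gen (i + k) * up 1 n ^ k" by (simp add: mult.assoc)
  also have "up 1 n * gen (i + k) = gen (i + k + 1) * up 1 n"
    using Suc.prems by (intro up_gen) auto
  finally show ?case by (simp add: mult.assoc algebra_simps)
qed simp

lemma twist_central_gen:
  assumes "1 \<le> i" "i \<le> n"
  shows "twist n * gen i = gen i * twist n"
proof -
  let ?c = "up 1 n"
  \<comment> \<open>Read from the right: the last n - i factors raise gen i to gen n, two more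
    return it to gen 1, and the remaining i - 1 bring it back to gen i.\<close>
  have e: "twist n = ?c ^ nat (i - 1) * (?c * ?c) * ?c ^ nat (n - i)"
  proof -
    have "nat (n + 1) = nat (i - 1) + (2 + nat (n - i))" using assms by simp
    then show ?thesis by (simp only: twist_def power_add power2_eq_square mult.assoc)
  qed
  have 1: "?c ^ nat (n - i) * gen i = gen n * ?c ^ nat (n - i)"
    using up_power_gen[of i "nat (n - i)" n] assms by simp
  have 2: "?c * ?c * gen n = gen 1 * (?c * ?c)" using up_up_gen assms by (simp add: mult.assoc)
  have 3: "?c ^ nat (i - 1) * gen 1 = gen i * ?c ^ nat (i - 1)"
    using up_power_gen[of 1 "nat (i - 1)" n] assms by simp
  show ?thesis unfolding e using 1 2 3 by (metis mult.assoc)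
qed

lemma twist_central: "supp x \<subseteq> {1..n} \<Longrightarrow> twist n * x = x * twist n"
proof -
  assume "supp x \<subseteq> {1..n}"
  then have "twist n * x = shift 0 x * twist n"
    by (intro shift_through) (simp add: subset_iff twist_central_gen)
  then show ?thesis by simp
qed

lemma supp_power: "supp (x ^ k) = (if k = 0 then {} else supp x)"
  by (induction k) auto

lemma supp_twist: "supp (twist n) \<subseteq> {1..n}"
  by (simp add: twist_def supp_power)

lemma twist_factor:
  assumes "1 \<le> i" "i \<le> n"
  obtains y where "supp y \<subseteq> {1..n}" "twist n = gen i * y" "twist n = y * gen i"
proof -
  let ?c = "up 1 n"
  let ?y = "?c ^ nat (i - 1) * up 2 n * ?c ^ nat (n + 1 - i)"
  have "nat (n + 1) = nat (i - 1) + (1 + nat (n + 1 - i))" using assms by simp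
  then have "twist n = ?c ^ nat (i - 1) * (?c * ?c ^ nat (n + 1 - i))"
    by (simp only: twist_def power_add power_one_right mult.assoc)
  also have "\<dots> = ?c ^ nat (i - 1) * gen 1 * up 2 n * ?c ^ nat (n + 1 - i)"
    using up_left[of 1 n] assms by (simp add: mult.assoc)
  also have "?c ^ nat (i - 1) * gen 1 = gen i * ?c ^ nat (i - 1)"
    using up_power_gen[of 1 "nat (i - 1)" n] assms by simp
  finally have y: "twist n = gen i * ?y" by (simp add: mult.assoc)
  have "gen i * (?y * gen i) = gen i * twist n" using y twist_central_gen[OF assms] by (simp add: mult.assoc)
  then have "twist n = ?y * gen i" by simp
  moreover have "supp ?y \<subseteq> {1..n}" by (auto simp: supp_power)
  ultimately show ?thesis using that y by blast
qed

section \<open>Right divisors and tails\<close>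

definition rdvd :: "pbraid \<Rightarrow> pbraid \<Rightarrow> bool" where
  "rdvd y x \<longleftrightarrow> (\<exists>w. x = w * y)"

lemma rdvdI [intro]: "x = w * y \<Longrightarrow> rdvd y x" by (auto simp: rdvd_def)

lemma rdvd_refl: "rdvd x x"
  unfolding rdvd_def by (rule exI[of _ 1]) simp

lemma rdvd_mult: "rdvd y x \<Longrightarrow> rdvd y (w * x)"
  by (auto simp: rdvd_def) (metis mult.assoc)

lemma rdvd_trans: "rdvd z y \<Longrightarrow> rdvd y x \<Longrightarrow> rdvd z x"
  by (auto simp: rdvd_def) (metis mult.assoc)

lemma rdvd_supp: "rdvd y x \<Longrightarrow> supp y \<subseteq> supp x"
  by (auto simp: rdvd_def)

lemma rdvd_antisym: "rdvd y x \<Longrightarrow> rdvd x y \<Longrightarrow> x = y"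
proof -
  assume "rdvd y x" "rdvd x y"
  then obtain w z where w: "x = w * y" "y = z * x" by (auto simp: rdvd_def)
  then have "len x = len w + (len z + len x)" by (metis len_simps(2))
  then have "w = 1" by simp
  then show ?thesis using w(1) by simp
qed

lemma rdvd_gen_supp: "rdvd (gen i) x \<Longrightarrow> i \<in> supp x"
  using rdvd_supp by fastforce

lemma rdvd_gen_exists:
  assumes "x \<noteq> 1" obtains i where "rdvd (gen i) x"
proof -
  obtain w where w: "x = pb w" by (rule pb_cases)
  with assms obtain u i where "w = u @ [i]" by (cases w rule: rev_cases) auto
  then show ?thesis using w that by (auto simp: pb_single)
qed

text \<open>Let gen j be the last letter of b. If gen i divides x * b as well, so does the least
  common multiple of the two generators, hence gen i divides x * b' and, by induction, b'. For
  neighbouring indices a second round also extracts gen j, and a braid move shows that b ends in gen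
  i.\<close>

lemma rdvd_gen_tail:
  assumes "supp b \<subseteq> A" "\<And>i. i \<in> A \<Longrightarrow> \<not> rdvd (gen i) x" "i \<in> A" "rdvd (gen i) (x * b)"
  shows "rdvd (gen i) b"
  using assms(1,3,4)
proof (induction "len b" arbitrary: b i rule: less_induct)
  case less
  show ?case
  proof (cases "b = 1")
    case True
    then show ?thesis using less.prems assms(2) by simp
  next
    case False
    then obtain j b' where b: "b = b' * gen j" using rdvd_gen_exists unfolding rdvd_def by blast
    obtain y where y: "x * b' * gen j = y * gen i" using less.prems(3) b by (auto simp: rdvd_def mult.assoc)
    have j: "j \<in> A" "supp b' \<subseteq> A" "len b' < len b" using less.prems(1) b by auto
    show ?thesis
    proof (cases i j rule: int_abs_cases)
      case 1
      then show ?thesis using b by auto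
    next
      case 2
      then obtain z where z: "x * b' = z * gen j * gen i"
        using gen_right_common(1)[OF y] by (auto simp: abs_minus_commute)
      then have "rdvd (gen i) b'" using less.hyps[OF j(3,2) less.prems(2)] by auto
      then obtain b2 where b2: "b' = b2 * gen i" by (auto simp: rdvd_def)
      have "x * b2 = z * gen j" using z by (simp add: b2 flip: mult.assoc)
      then have "rdvd (gen j) b2" using less.hyps[of b2 j] j b2 by auto
      then obtain b3 where "b2 = b3 * gen j" by (auto simp: rdvd_def)
      then have "b = b3 * (gen i * gen j * gen i)" using b b2 gen_near[OF 2(1)] by (simp add: mult.assoc)
      then show ?thesis by (auto simp: mult.assoc[symmetric])
    next
      case 3
      then obtain z where z: "x * b' = z * gen i"
        using gen_right_common(2)[OF y] by (auto simp: abs_minus_commute)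
      then have "rdvd (gen i) b'" using less.hyps[OF j(3,2) less.prems(2)] by auto
      then obtain b2 where b2: "b' = b2 * gen i" by (auto simp: rdvd_def)
      have "b = b2 * gen j * gen i" using b b2 gen_far[OF 3(1)] by (simp add: mult.assoc)
      then show ?thesis by blast
    qed
  qed
qed

text \<open>Generators of c are split off one at a time. The result makes b the greatest right
  divisor of x * b supported in A, which is how tails are recognized.\<close>

lemma rdvd_tail:
  assumes "\<And>i. i \<in> A \<Longrightarrow> \<not> rdvd (gen i) x"
  shows "supp b \<subseteq> A \<Longrightarrow> supp c \<subseteq> A \<Longrightarrow> rdvd c (x * b) \<Longrightarrow> rdvd c b"
proof (induction "len c" arbitrary: b c)
  case 0
  then show ?case by (auto intro: rdvdI[of _ b])
next
  case (Suc k)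
  then have "c \<noteq> 1" by auto
  then obtain c' i where c: "c = c' * gen i" using rdvd_gen_exists unfolding rdvd_def by blast
  have i: "i \<in> A" "supp c' \<subseteq> A" "k = len c'" using Suc c by auto
  have "rdvd (gen i) (x * b)" using Suc.prems(3) c by (auto simp: rdvd_def mult.assoc[symmetric])
  then obtain b' where b: "b = b' * gen i"
    using rdvd_gen_tail[OF Suc.prems(1) assms i(1)] by (auto simp: rdvd_def)
  have "rdvd c' (x * b')"
    using Suc.prems(3) by (auto simp: b c rdvd_def simp flip: mult.assoc)
  then have "rdvd c' b'" using Suc(1)[OF i(3) _ i(2)] Suc.prems(1) b by auto
  then show ?case by (auto simp: b c rdvd_def simp flip: mult.assoc)
qed

lemma tail_exists:
  obtains x' t where "x = x' * t" "supp t \<subseteq> A" "\<And>i. i \<in> A \<Longrightarrow> \<not> rdvd (gen i) x'"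
proof (induction "len x" arbitrary: x thesis rule: less_induct)
  case less
  show ?case
  proof (cases "\<exists>i\<in>A. rdvd (gen i) x")
    case True
    then obtain i w where i: "i \<in> A" "x = w * gen i" by (auto simp: rdvd_def)
    obtain x' t where "w = x' * t" "supp t \<subseteq> A" "\<And>i. i \<in> A \<Longrightarrow> \<not> rdvd (gen i) x'"
      using less.hyps[of w] i by auto
    then show ?thesis using less.prems[of x' "t * gen i"] i by (simp add: mult.assoc)
  next
    case False
    then show ?thesis using less.prems[of x 1] by simp
  qed
qed

section \<open>Braids with at most one right generator, and the increasing runs in their
  words\<close>

definition only :: "int \<Rightarrow> pbraid \<Rightarrow> bool" where
  "only k x \<longleftrightarrow> (\<forall>i. rdvd (gen i) x \<longrightarrow> i = k)"

lemma only_rdvd: "only k x \<Longrightarrow> rdvd y x \<Longrightarrow> only k y"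
  using rdvd_trans by (auto simp: only_def)

lemma only_factor:
  assumes "only k x" "x \<noteq> 1" obtains y where "x = y * gen k"
proof -
  obtain i where i: "rdvd (gen i) x" using rdvd_gen_exists[OF assms(2)] by blast
  then have "i = k" using assms(1) by (simp add: only_def)
  then show ?thesis using i that by (auto simp: rdvd_def)
qed

text \<open>The part of J, \<dots>, m matched inside the rewritten factor is a string of consecutive
  integers. A single letter occurs on both sides of every relation. A pair p, p + 1 occurs only in a
  relation of length three, whose two sides contain its letters in either order. Three distinct
  letters never fit.\<close>

lift_definition run :: "int \<Rightarrow> int \<Rightarrow> pbraid \<Rightarrow> bool" is
  "\<lambda>J m w. subseq [J..m] w"
proof -
  fix J m and u v :: "int list"
  assume "peq u v"
  then show "subseq [J..m] u = subseq [J..m] v"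
  proof (rule peq_invariant)
    have *: "subseq [J..m] v" if "bstep u v" "subseq [J..m] u" for u v
    proof -
      obtain a l r b where uv: "u = a @ l @ b" "v = a @ r @ b" and lr:
        "(\<exists>i j. \<bar>i - j\<bar> \<ge> 2 \<and> l = [i, j] \<and> r = [j, i]) \<or> (\<exists>i j. \<bar>i - j\<bar> = 1 \<and> l = [i, j, i] \<and> r = [j, i, j])"
        using \<open>bstep u v\<close> by cases blast+
      obtain x y z where xyz: "[J..m] = x @ y @ z" "subseq x a" "subseq y l" "subseq z b"
        using \<open>subseq [J..m] u\<close> unfolding uv by (auto simp: subseq_append_iff)
      have "subseq y r"
      proof (cases y)
        case (Cons p y')
        have y: "y ! k = p + int k" if "k < length y" for k
        proof -
          have "y ! k = [J..m] ! (length x + k)" using that xyz(1) by (simp add: nth_append)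
          moreover have "length x + k < length [J..m]" using that xyz(1) by simp
          moreover have "p = [J..m] ! length x" "length x < length [J..m]" using xyz(1) Cons by (simp_all add: nth_append)
          ultimately show ?thesis by (simp add: nth_upto)
        qed
        have rl: "set r = set l" using lr by auto
        consider "y' = []" | q where "y' = [q]" | q q' s where "y' = q # q' # s" by (metis list.exhaust)
        then show ?thesis
        proof cases
          case 1
          then show ?thesis using Cons xyz(3) rl by (simp add: subseq_singleton_left)
        next
          case (2 q)
          then have e: "y = [p, p + 1]" using Cons y[of 1] by simp
          have "subseq [p, p + 1] l" using xyz(3) e by simp
          then show ?thesis using lr unfolding e by (elim disjE exE) (auto split: if_splits)
        next
          case (3 q q' s)
          then have e: "y = p # (p + 1) # (p + 2) # s" using Cons y[of 1] y[of 2] by simp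
          have "subseq (p # (p + 1) # (p + 2) # s) l" using xyz(3) e by simp
          then show ?thesis using lr by (elim disjE exE) (auto split: if_splits)
        qed
      qed simp
      then show ?thesis using xyz unfolding uv by (simp add: list_emb_append_mono)
    qed
    fix u v assume "bstep u v"
    then show "subseq [J..m] u = subseq [J..m] v" using * bstep_sym by blast
  qed
qed

lemma run_pb: "run J m (pb w) \<longleftrightarrow> subseq [J..m] w"
  by transfer simp

lemma run_supp: "run J m x \<Longrightarrow> {J..m} \<subseteq> supp x"
  by transfer (auto dest: list_emb_set)

lemma run_mult: "run J m x \<Longrightarrow> run J m (y * x)"
  by transfer (rule list_emb_append2)

text \<open>The final m of the run has to be matched in x, and all earlier letters are matched to
  the left of it.\<close>

lemma run_tail:
  assumes "run J m (x * y)" "m \<notin> supp y" "J \<le> m"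
  shows "run J m x"
  using assms
proof (transfer)
  fix J m and x y :: "int list"
  assume a: "subseq [J..m] (x @ y)" "m \<notin> set y" "J \<le> m"
  then obtain p q where pq: "[J..m] = p @ q" "subseq p x" "subseq q y" by (auto simp: subseq_append_iff)
  have "q = []"
  proof (rule ccontr)
    assume "q \<noteq> []"
    moreover have "last [J..m] = m" using upto_rec2[OF a(3)] by simp
    ultimately have "last q = m" using pq(1) by simp
    moreover have "last q \<in> set y"
      using \<open>q \<noteq> []\<close> list_emb_set[OF pq(3), of "last q"] by force
    ultimately show False using a(2) by simp
  qed
  then show "subseq [J..m] x" using pq(1,2) by simp
qed

lemma last_occurrence_unique:
  "u @ i # v = u' @ i # v' \<Longrightarrow> i \<notin> set v \<Longrightarrow> i \<notin> set v' \<Longrightarrow> v = v'"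
proof (induction u arbitrary: u')
  case Nil
  then show ?case by (cases u') auto
next
  case (Cons a u)
  then show ?case by (cases u') auto
qed

text \<open>In the absence of r + 1, letters above r are at distance at least 2 from the others, so
  they can all be moved to the front.\<close>

lemma pb_partition:
  "r + 1 \<notin> set w \<Longrightarrow> pb w = pb (filter (\<lambda>i. i > r) w) * pb (filter (\<lambda>i. i \<le> r) w)"
proof (induction w)
  case (Cons i w)
  show ?case
  proof (cases "i > r")
    case True
    then show ?thesis using Cons by (simp add: pb_Cons mult.assoc)
  next
    case False
    have "gen i * pb (filter (\<lambda>i. i > r) w) = pb (filter (\<lambda>i. i > r) w) * gen i"
    proof (rule gen_commute_far)
      fix j assume "j \<in> supp (pb (filter (\<lambda>i. i > r) w))"
      then have "j \<in> set w" "j > r" by auto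
      moreover have "j \<noteq> r + 1" using \<open>j \<in> set w\<close> Cons.prems by auto
      ultimately show "\<bar>i - j\<bar> \<ge> 2" using False by auto
    qed
    then show ?thesis using Cons False by (simp add: pb_Cons) (metis mult.assoc)
  qed
qed simp

text \<open>For r < k the last r must be followed by an r + 1: otherwise the letters up to r from
  there on could be moved to the end, and a generator below k would divide x. Following last
  occurrences from r up to k produces the run.\<close>

lemma only_run:
  assumes "only k x" "r \<in> supp x" "r \<le> k"
  shows "run r k x"
proof -
  obtain w where w: "x = pb w" by (rule pb_cases)
  have *: "r \<in> set w \<Longrightarrow> r \<le> k \<Longrightarrow> \<exists>a b. w = a @ r # b \<and> r \<notin> set b \<and> subseq [r + 1..k] b" for r
  proof (induction "nat (k - r)" arbitrary: r)
    case 0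
    then show ?case using split_list_last[OF 0(2)] by simp
  next
    case (Suc n)
    then have rk: "r < k" by simp
    obtain a b where ab: "w = a @ r # b" "r \<notin> set b" using split_list_last[OF Suc(3)] by blast
    have b: "r + 1 \<in> set b"
    proof (rule ccontr)
      assume "r + 1 \<notin> set b"
      then have e: "pb (r # b) = pb (filter (\<lambda>i. i > r) (r # b)) * pb (filter (\<lambda>i. i \<le> r) (r # b))"
        by (intro pb_partition) auto
      have "pb (filter (\<lambda>i. i \<le> r) (r # b)) \<noteq> 1"
        using supp_empty_iff[of "pb (filter (\<lambda>i. i \<le> r) (r # b))"] by (auto simp del: supp_empty_iff)
      then obtain i where i: "rdvd (gen i) (pb (filter (\<lambda>i. i \<le> r) (r # b)))" by (rule rdvd_gen_exists)
      then have "rdvd (gen i) (pb (r # b))" unfolding e by (rule rdvd_mult)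
      then have "rdvd (gen i) x" unfolding w ab(1) by (simp add: rdvd_mult)
      then have "i = k" using assms(1) by (auto simp: only_def)
      then show False using rdvd_gen_supp[OF i] rk by auto
    qed
    then have "r + 1 \<in> set w" using ab by simp
    moreover have "n = nat (k - (r + 1))" "r + 1 \<le> k" using Suc(2) rk by auto
    ultimately obtain a' b' where ab': "w = a' @ (r + 1) # b'" "r + 1 \<notin> set b'" "subseq [r + 1 + 1..k] b'"
      using Suc(1) by blast
    obtain b1 b2 where b12: "b = b1 @ (r + 1) # b2" "r + 1 \<notin> set b2" using split_list_last[OF b] by blast
    have "(a @ r # b1) @ (r + 1) # b2 = a' @ (r + 1) # b'" using ab(1) ab'(1) b12(1) by simp
    then have "b2 = b'" using last_occurrence_unique ab'(2) b12(2) by metis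
    then have "subseq ([r + 1] @ [r + 1 + 1..k]) b" using ab'(3) unfolding b12(1) by (simp add: list_emb_append2)
    then have "subseq [r + 1..k] b" using upto_rec1[of "r + 1" k] rk by simp
    then show ?case using ab by blast
  qed
  have "r \<in> set w" using assms(2) w by simp
  then obtain a b where ab: "w = a @ r # b" "subseq [r + 1..k] b" using * assms(3) by blast
  then have "subseq [r..k] w" using upto_rec1[OF assms(3)] by (simp add: list_emb_append2)
  then show ?thesis by (simp add: w run_pb)
qed

text \<open>The complement of \<open>gen n\<close> along \<open>t\<close> is \<open>up j n\<close>, with \<open>j\<close> minimal such that \<open>run j (n - 1) t\<close>.\<close>
lemma complement_run:
  assumes "1 \<le> n" "supp t \<subseteq> {1..n - 1}"
  obtains j y where "1 \<le> j" "j \<le> n" "run j (n - 1) t" "up j n * t = y * gen n"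
proof -
  have "\<exists>j y. 1 \<le> j \<and> j \<le> n \<and> run j (n - 1) t \<and> up j n * t = y * gen n"
    using assms(2)
  proof (induction t rule: pb_induct)
    case one
    have "run n (n - 1) 1" by transfer simp
    moreover have "up n n * 1 = 1 * gen n" by simp
    ultimately show ?case using assms(1) by blast
  next
    case (gen_mult a t)
    then obtain j y where j: "1 \<le> j" "j \<le> n" "run j (n - 1) t" "up j n * t = y * gen n" by auto
    have a: "1 \<le> a" "a \<le> n - 1" using gen_mult.prems by auto
    consider "a < j - 1" | "a = j - 1" | "a \<ge> j" by linarith
    then show ?case
    proof cases
      case 1
      have "up j n * gen a = gen a * up j n" by (rule gen_commute_far[symmetric]) (use 1 in auto)
      then have "up j n * (gen a * t) = (gen a * y) * gen n" using j(4) by (metis mult.assoc)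
      then show ?thesis using j run_mult by blast
    next
      case 2
      have r: "run a (n - 1) (gen a * t)"
        using j(3) 2 a upto_rec1[of a "n - 1"] by transfer simp
      have "up a n * gen a = gen (a + 1) * gen a * up j n"
      proof -
        have u: "up a n = gen a * (gen (a + 1) * up (a + 2) n)" "up j n = gen (a + 1) * up (a + 2) n"
          using 2 a up_left[of a n] up_left[of "a + 1" n] by (simp_all add: add.commute)
        have c: "up (a + 2) n * gen a = gen a * up (a + 2) n" by (rule gen_commute_far[symmetric]) auto
        show ?thesis by (simp add: u c mult.assoc gen_near'[of a "a + 1"])
      qed
      then have "up a n * (gen a * t) = gen (a + 1) * gen a * y * gen n" using j(4) by (metis mult.assoc)
      then show ?thesis using a r by (intro exI[of _ a]) auto
    next
      case 3
      have "up j n * gen a = gen (a + 1) * up j n" using 3 a by (intro up_gen) auto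
      then have "up j n * (gen a * t) = (gen (a + 1) * y) * gen n" using j(4) by (metis mult.assoc)
      then show ?thesis using j run_mult by blast
    qed
  qed
  then show ?thesis using that by blast
qed

section \<open>Lower bounds in an ordered set with braid action\<close>

lemma rdvd_flip: "rdvd (flip d y) (flip d x) \<longleftrightarrow> rdvd y x"
  unfolding rdvd_def by (metis flip_simps(2,7))

lemma only_flip: "only k x \<Longrightarrow> only (d - k) (flip d x)"
  unfolding only_def by (metis rdvd_flip flip_simps(3,7) diff_diff_eq2 add_diff_cancel_left')

text \<open>Take k minimal such that \<open>up k m\<close> divides v. A last letter of u other than
  k or k - 1 can be carried through \<open>up k m\<close> and becomes a right divisor of v different
  from gen m; the letter k - 1 would lengthen the ascending factor, against minimality.\<close>

lemma only_up_factor: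
  assumes "only m v" "v \<noteq> 1" "supp v \<subseteq> {a..m}"
  obtains k u where "a \<le> k" "k \<le> m" "v = u * up k m" "only k u"
    "\<And>k'. a \<le> k' \<Longrightarrow> rdvd (up k' m) v \<Longrightarrow> k \<le> k'"
proof -
  obtain y where y: "v = y * gen m" using only_factor[OF assms(1,2)] .
  define A where "A = {k \<in> {a..m}. rdvd (up k m) v}"
  have "finite A" by (rule finite_subset[of _ "{a..m}"]) (auto simp: A_def)
  moreover have "m \<in> A" using assms(3) y by (auto simp: A_def)
  ultimately have A: "finite A" "A \<noteq> {}" by auto
  define k where "k = Min A"
  have k: "k \<in> A" "\<And>k'. k' \<in> A \<Longrightarrow> k \<le> k'" using A Min_in[of A] by (auto simp: k_def)
  then obtain u where u: "v = u * up k m" by (auto simp: A_def rdvd_def)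
  have km: "a \<le> k" "k \<le> m" using k(1) by (auto simp: A_def)
  have min: "k \<le> k'" if "a \<le> k'" "rdvd (up k' m) v" for k'
    using that km(2) k(2)[of k'] by (cases "k' \<le> m") (auto simp: A_def)
  have "only k u"
    unfolding only_def
  proof (intro allI impI)
    fix i assume "rdvd (gen i) u"
    then obtain w where w: "u = w * gen i" by (auto simp: rdvd_def)
    have i: "a \<le> i" "i \<le> m" using w u assms(3) by auto
    consider "i < k - 1" | "i = k - 1" | "i = k" | "i > k" by linarith
    then show "i = k"
    proof cases
      case 1
      have "gen i * up k m = up k m * gen i" by (rule gen_commute_far) (use 1 in auto)
      then have "v = w * up k m * gen i" using u w by (simp add: mult.assoc)
      then show ?thesis using assms(1) 1 km by (auto simp: only_def rdvd_def)
    next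
      case 2
      have "v = w * up i m" using u w 2 km up_left[of i m] by (simp add: mult.assoc)
      then show ?thesis using min[of i] i 2 by auto
    next
      case 4
      have "up k m * gen (i - 1) = gen i * up k m" using up_gen[of k "i - 1" m] 4 i by simp
      then have "v = w * up k m * gen (i - 1)" using u w by (simp add: mult.assoc)
      then have "i - 1 = m" using assms(1) by (auto simp: only_def rdvd_def)
      then show ?thesis using i by simp
    qed
  qed
  then show ?thesis using that[OF km u] min by blast
qed

lemma rdvd_up_mono: "k \<le> j \<Longrightarrow> j \<le> m \<Longrightarrow> rdvd (up k m) v \<Longrightarrow> rdvd (up j m) v"
  using up_split[of k "j - 1" m] rdvd_trans[of "up j m" "up k m" v] by auto

text \<open>
  \<open>le x y\<close> stands for an inequality \<open>x p \<le> y p\<close> at a point \<open>p\<close> of an ordered set on which the braid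
  group acts, where \<open>p\<close> is fixed by the generators \<open>2, \<dots>, n\<close> and not decreased by the first one.
\<close>
locale star_order =
  fixes n :: int and le :: "pbraid \<Rightarrow> pbraid \<Rightarrow> bool"
  assumes le_refl: "supp x \<subseteq> {1..n} \<Longrightarrow> le x x"
    and le_trans [trans]: "le x y \<Longrightarrow> le y z \<Longrightarrow> le x z"
    and le_left: "supp w \<subseteq> {1..n} \<Longrightarrow> le x y \<Longrightarrow> le (w * x) (w * y)"
    and le_fix: "supp g \<subseteq> {2..n} \<Longrightarrow> le 1 g \<and> le g 1"
    and le_gen: "le 1 (gen 1)"
begin

lemma le_fix_right: "supp x \<subseteq> {1..n} \<Longrightarrow> supp g \<subseteq> {2..n} \<Longrightarrow> le x (x * g)"
  and le_fix_right': "supp x \<subseteq> {1..n} \<Longrightarrow> supp g \<subseteq> {2..n} \<Longrightarrow> le (x * g) x"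
  using le_left[of x 1 g] le_left[of x g 1] le_fix[of g] by auto

lemma le_extend: "supp x \<subseteq> {1..n} \<Longrightarrow> supp w \<subseteq> {1..n} \<Longrightarrow> le x (x * w)"
proof (induction w arbitrary: x rule: pb_induct)
  case (gen_mult i w)
  have "le 1 (gen i)"
    using gen_mult.prems le_fix[of "gen i"] le_gen by (cases "i = 1") auto
  then have "le x (x * gen i)" using le_left[of x 1 "gen i"] gen_mult.prems by simp
  also have "le (x * gen i) (x * gen i * w)" using gen_mult.prems by (intro gen_mult.IH) auto
  finally show ?case by (simp add: mult.assoc)
qed (simp add: le_refl)

text \<open>The points \<open>up r m * dn m 1\<close> are ones at which prefixed generators can be
  controlled. Letters other than r - 1 and r cross to the right end and arrive as letters at least
  2, which fix the base point; for r - 1 and r the identities \<open>up_mono_identity\<close> are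
  inserted.\<close>

lemma le_mono_gen:
  assumes "1 \<le> r" "r \<le> m + 1" "m \<le> n" "1 \<le> i" "i \<le> m"
  shows "le (up r m * dn m 1) (gen i * (up r m * dn m 1))"
proof -
  let ?x = "up r m * dn m 1"
  consider "i < r - 1" | "i = r - 1" | "i = r" | "i > r" by linarith
  then show ?thesis
  proof cases
    case 1
    have "gen i * up r m = up r m * gen i" by (rule gen_commute_far) (use 1 in auto)
    moreover have "gen i * dn m 1 = dn m 1 * gen (i + 1)"
      using dn_shift[of "gen i" 1 m] assms 1 by simp
    ultimately have "gen i * ?x = ?x * gen (i + 1)" by (metis mult.assoc)
    then show ?thesis using le_fix_right[of ?x "gen (i + 1)"] assms 1 by auto
  next
    case 2
    let ?y = "up i m * dn m 1"
    have x: "?x = up (i + 1) m * dn m 1" using 2 by simp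
    have "le ?x (?x * ?x)" using assms by (intro le_extend) auto
    also have "?x * ?x = ?y * (up (i + 1) m * dn m 2)"
      unfolding x using assms by (intro up_mono_identity(1)) auto
    also have "le \<dots> ?y" using assms by (intro le_fix_right') auto
    also have "?y = gen i * ?x" using up_left[of i m] assms by (simp add: x mult.assoc)
    finally show ?thesis .
  next
    case 3
    have "le ?x (?x * (up (r + 1) m * dn m 1))" using assms by (intro le_extend) auto
    also have "?x * (up (r + 1) m * dn m 1) = gen i * ?x * (up (r + 1) m * dn m 2)"
      using up_mono_identity(2)[of r m] assms 3 by simp
    also have "le \<dots> (gen i * ?x)" using assms by (intro le_fix_right') auto
    finally show ?thesis .
  next
    case 4
    have "gen i * up r m = up r m * gen (i - 1)" using up_gen[of r "i - 1" m] 4 assms by simp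
    moreover have "gen (i - 1) * dn m 1 = dn m 1 * gen i"
      using dn_shift[of "gen (i - 1)" 1 m] assms 4 by simp
    ultimately have "gen i * ?x = ?x * gen i" by (metis mult.assoc)
    then show ?thesis using le_fix_right[of ?x "gen i"] assms 4 by auto
  qed
qed

lemma le_mono:
  assumes "1 \<le> r" "r \<le> m + 1" "m \<le> n"
  shows "supp w \<subseteq> {1..m} \<Longrightarrow> le (up r m * dn m 1) (w * (up r m * dn m 1))"
proof (induction w rule: pb_induct)
  case one
  then show ?case using le_refl[of "up r m * dn m 1"] assms by auto
next
  case (gen_mult i w)
  let ?x = "up r m * dn m 1"
  have "le ?x (gen i * ?x)" using le_mono_gen assms gen_mult.prems by simp
  also have "le (gen i * ?x) (gen i * (w * ?x))" using gen_mult assms by (intro le_left) auto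
  finally show ?case by (simp add: mult.assoc)
qed

text \<open>Induction from the left end of the word: a letter that opens the run turns
  \<open>up (r + 1) m\<close> into \<open>up r m\<close>, and by \<open>le_mono_gen\<close> every
  other letter leaves the point at least as high.\<close>

lemma le_run_word:
  assumes "k \<le> m" "m \<le> n"
  shows "set w \<subseteq> {1..m} \<Longrightarrow> subseq [r..k] w \<Longrightarrow> 1 \<le> r \<Longrightarrow> r \<le> k + 1 \<Longrightarrow>
    le (up r m * dn m 1) (pb w * (up (k + 1) m * dn m 1))"
proof (induction w arbitrary: r)
  case Nil
  then have "r = k + 1" by (cases "r \<le> k") (auto simp: upto_rec1)
  then show ?case using le_refl[of "up r m * dn m 1"] assms Nil by auto
next
  case (Cons a w)
  let ?x = "up (k + 1) m * dn m 1"
  show ?case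
  proof (cases "r \<le> k \<and> a = r")
    case True
    then have "subseq [r + 1..k] w" using Cons.prems(2) upto_rec1[of r k] by simp
    then have "le (up (r + 1) m * dn m 1) (pb w * ?x)" using Cons True by simp
    then have "le (gen r * (up (r + 1) m * dn m 1)) (gen r * (pb w * ?x))"
      using Cons.prems assms True by (intro le_left) auto
    then show ?thesis using True assms up_left[of r m] by (simp add: pb_Cons mult.assoc)
  next
    case False
    then have "subseq [r..k] w"
      using Cons.prems(2) upto_rec1[of r k] by (cases "r \<le> k") auto
    then have IH: "le (up r m * dn m 1) (pb w * ?x)" using Cons by simp
    have "le (up r m * dn m 1) (gen a * (up r m * dn m 1))"
      using Cons.prems assms by (intro le_mono_gen) auto
    also have "le \<dots> (gen a * (pb w * ?x))" using Cons.prems assms IH by (intro le_left) auto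
    finally show ?thesis by (simp add: pb_Cons mult.assoc)
  qed
qed

lemma le_run:
  assumes "run r k x" "supp x \<subseteq> {1..m}" "1 \<le> r" "r \<le> k + 1" "k \<le> m" "m \<le> n"
  shows "le (up r m * dn m 1) (x * (up (k + 1) m * dn m 1))"
proof -
  obtain w where "x = pb w" by (rule pb_cases)
  then show ?thesis using le_run_word[of k m w r] assms by (simp add: run_pb)
qed

text \<open>The core estimate, by induction on m. Let v2 be the tail of v on the letters below m and
  write the rest as \<open>v0 * up k m\<close>. Crossing \<open>up k m\<close> trades the bound for
  m - 1 against the bound for m and shifts indices by one, which is why X has to be part of the
  statement. When m = l is reached the tail is trivial, and the free factor x is taken to be the
  whole bound.\<close>

lemma le_only:
  assumes "m \<le> n" "supp v \<subseteq> {1..m}" "only l v" "1 \<le> l" "l \<le> m"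
    "run J m v" "1 \<le> J" "J \<le> m" "supp X \<subseteq> {J + 1..m}"
  shows "\<exists>x. supp x \<subseteq> {1..l - 1} \<and> le (X * dn m 1) (v * x)"
  using assms
proof (induction "nat m" arbitrary: m v l J X rule: less_induct)
  case less
  note supp_v = less.prems(2) and only_v = less.prems(3) and l = less.prems(4,5)
    and run_v = less.prems(6) and J = less.prems(7,8) and supp_X = less.prems(9) and mn = less.prems(1)
  have m: "1 \<le> m" using l by simp
  obtain v3 v2 where v: "v = v3 * v2" "supp v2 \<subseteq> {1..m - 1}"
      "\<And>i. i \<in> {1..m - 1} \<Longrightarrow> \<not> rdvd (gen i) v3"
    and Q: "\<And>k X'. 1 \<le> k \<Longrightarrow> k \<le> m \<Longrightarrow> rdvd (up k m) v3 \<Longrightarrow> supp X' \<subseteq> {k..m - 1} \<Longrightarrow>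
      \<exists>x. supp x \<subseteq> {1..l - 1} \<and> le (X' * dn (m - 1) 1) (v2 * x)"
  proof (cases "l = m")
    case True
    have "\<exists>x. supp x \<subseteq> {1..l - 1} \<and> le (X' * dn (m - 1) 1) (1 * x)"
      if "1 \<le> k" "supp X' \<subseteq> {k..m - 1}" for k X'
    proof (rule exI[of _ "X' * dn (m - 1) 1"])
      have s: "supp (X' * dn (m - 1) 1) \<subseteq> {1..m - 1}" using that by force
      then have "supp (X' * dn (m - 1) 1) \<subseteq> {1..n}" using mn by force
      then show "supp (X' * dn (m - 1) 1) \<subseteq> {1..l - 1} \<and>
          le (X' * dn (m - 1) 1) (1 * (X' * dn (m - 1) 1))"
        using le_refl s True by simp
    qed
    then show ?thesis using that[of v 1] True only_v by (auto simp: only_def)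
  next
    case False
    obtain v3 v2 where v: "v = v3 * v2" "supp v2 \<subseteq> {1..m - 1}"
      "\<And>i. i \<in> {1..m - 1} \<Longrightarrow> \<not> rdvd (gen i) v3"
      using tail_exists[of v "{1..m - 1}"] by blast
    obtain j y where j: "1 \<le> j" "j \<le> m" "run j (m - 1) v2" "up j m * v2 = y * gen m"
      using complement_run[OF m v(2)] .
    have only2: "only l v2" using only_rdvd[OF only_v] v(1) by blast
    \<comment> \<open>Otherwise \<open>up j m\<close> divides v3 and, followed by v2, ends in gen m,
      although l < m. The strict inequality is what admits letters from k on in X' when the
      induction hypothesis is applied to the run found in v2.\<close>
    have jk: "j < k" if "k \<le> m" "rdvd (up k m) v3" for k
    proof (rule ccontr)
      assume "\<not> j < k"
      then have "rdvd (up j m) v3" using rdvd_up_mono[of k j m v3] that j by simp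
      then obtain w where "v3 = w * up j m" by (auto simp: rdvd_def)
      then have "v = w * y * gen m" using v(1) j(4) by (simp add: mult.assoc)
      then show False using only_v False by (auto simp: only_def rdvd_def)
    qed
    have "\<exists>x. supp x \<subseteq> {1..l - 1} \<and> le (X' * dn (m - 1) 1) (v2 * x)"
      if k: "1 \<le> k" "k \<le> m" "rdvd (up k m) v3" "supp X' \<subseteq> {k..m - 1}" for k X'
    proof (rule less.hyps[of "m - 1" v2 l j X'])
      show "supp X' \<subseteq> {j + 1..m - 1}" using jk[OF k(2,3)] k(4) by auto
    qed (use m mn v(2) only2 l False j jk[OF k(2,3)] k(2) in auto)
    then show ?thesis using that v by blast
  qed
  have "m \<notin> supp v2" using v(2) by auto
  then have run3: "run J m v3" using run_tail[of J m v3 v2] run_v J v(1) by simp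
  have J3: "J \<in> supp v3" "m \<in> supp v3" using run_supp[OF run3] J by auto
  have supp3: "supp v3 \<subseteq> {1..m}" using supp_v v(1) by auto
  have "only m v3"
    using v(3) rdvd_gen_supp[of _ v3] supp3 by (force simp: only_def)
  moreover have "v3 \<noteq> 1" using J3 by auto
  ultimately obtain k v0 where k: "1 \<le> k" "k \<le> m" "v3 = v0 * up k m" "only k v0"
    using only_up_factor[OF _ _ supp3] by blast
  \<comment> \<open>Up to a factor that fixes the base point, \<open>up k m\<close> times the bound
    for m - 1 is the bound for m, by \<open>up_dn\<close>.\<close>
  have R: "\<exists>x. supp x \<subseteq> {1..l - 1} \<and> le (Y * dn m 1) (up k m * (v2 * x))"
    if Y: "supp Y \<subseteq> {k + 1..m}" for Y
  proof -
    have "supp (shift (- 1) Y) \<subseteq> {k..m - 1}" using Y by auto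
    then obtain x where x: "supp x \<subseteq> {1..l - 1}" "le (shift (-1) Y * dn (m - 1) 1) (v2 * x)"
      using Q[OF k(1,2)] k(3) by blast
    have "le (Y * dn m 1) (Y * dn m 1 * up (k + 1) m)"
      using Y k mn by (intro le_fix_right) auto
    also have "Y * dn m 1 * up (k + 1) m = Y * up k m * dn (m - 1) 1"
      using up_dn[of k m] k by (simp add: mult.assoc)
    also have "\<dots> = up k m * (shift (-1) Y * dn (m - 1) 1)"
      using up_shift_down[OF Y] by (metis mult.assoc)
    also have "le \<dots> (up k m * (v2 * x))" using k mn by (intro le_left x) auto
    finally show ?thesis using x by blast
  qed
  show ?case
  proof (cases "v0 = 1")
    case True
    \<comment> \<open>Now v3 is \<open>up k m\<close> and contains the letter J, so k \<le>
      J.\<close>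
    then have "supp X \<subseteq> {k + 1..m}" using supp_X J3 k(3) by auto
    then show ?thesis using R v(1) k(3) True by (auto simp: mult.assoc)
  next
    case False
    \<comment> \<open>The run in v0 has to end in k. It starts at J if J < k, since J then cannot
      come from \<open>up k m\<close>, and at k otherwise, since v0 ends in gen k.\<close>
    define J' where "J' = min J k"
    have supp0: "supp v0 \<subseteq> {1..m}" using supp3 k(3) by auto
    obtain y0 where "v0 = y0 * gen k" using only_factor[OF k(4) False] .
    then have "k \<in> supp v0" by simp
    moreover have "J \<in> supp v0" if "J < k" using J3(1) k(3) that by auto
    ultimately have "J' \<in> supp v0" by (cases "J < k") (auto simp: J'_def)
    then have "run J' k v0" using only_run[OF k(4)] by (simp add: J'_def)
    then have le1: "le (up J' m * dn m 1) (v0 * (up (k + 1) m * dn m 1))"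
      using J k mn supp0 by (intro le_run) (auto simp: J'_def)
    obtain x where x: "supp x \<subseteq> {1..l - 1}" "le (up (k + 1) m * dn m 1) (up k m * (v2 * x))"
      using R[of "up (k + 1) m"] by auto
    have "{J + 1..m} \<subseteq> {J' + 1..m}" by (auto simp: J'_def)
    then have X: "supp X \<subseteq> {J' + 1..m}" "1 \<le> J'" "J' \<le> m"
      using supp_X J k by (blast, auto simp: J'_def)
    have "{J' + 1..m} \<subseteq> {2..n}" "{2..n} \<subseteq> {1..n}" using X mn by auto
    then have X2: "supp X \<subseteq> {2..n}" "supp X \<subseteq> {1..n}" using X(1) by blast+
    \<comment> \<open>X is eliminated: crossing \<open>up J' m\<close> lowers its indices by one,
      crossing \<open>dn m 1\<close> raises them again, and at the base point it has no
      effect.\<close>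
    have "le (dn m 1) (up J' m * dn m 1)"
      using le_mono[of "m + 1" m "up J' m"] X mn m by auto
    then have "le (X * dn m 1) (X * (up J' m * dn m 1))" using X2 by (intro le_left) auto
    also have "X * (up J' m * dn m 1) = up J' m * (shift (-1) X * dn m 1)"
      using up_shift_down[OF X(1)] by (metis mult.assoc)
    also have "shift (-1) X * dn m 1 = dn m 1 * X"
      using X(1,2) by (intro dn_shift_down) force
    also have "le (up J' m * (dn m 1 * X)) (up J' m * dn m 1)"
      using le_fix_right'[of "up J' m * dn m 1" X] X(2,3) X2 mn by (auto simp: mult.assoc)
    also note le1
    also have "le (v0 * (up (k + 1) m * dn m 1)) (v0 * (up k m * (v2 * x)))"
      using supp0 mn by (intro le_left x) auto
    finally show ?thesis using x(1) v(1) k(3) by (auto simp: mult.assoc)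
  qed
qed

end

lemma run_gen_gen: "J \<le> m \<Longrightarrow> run J m (x * gen m * gen m) \<Longrightarrow> run J m (x * gen m)"
proof transfer
  fix J m and x :: "int list"
  assume a: "J \<le> m" "subseq [J..m] ((x @ [m]) @ [m])"
  have e: "[J..m] = [J..m - 1] @ [m]" using a(1) by (rule upto_rec2)
  have "subseq [J..m - 1] (x @ [m])" using a(2) unfolding e by (simp only: subseq_append)
  then obtain p q where pq: "[J..m - 1] = p @ q" "subseq p x" "subseq q [m]" by (auto simp: subseq_append_iff)
  have "m \<notin> set q" using arg_cong[OF pq(1), of set] by auto
  then have "q = []" using pq(3) by (cases q) (auto split: if_splits)
  then show "subseq [J..m] (x @ [m])" using pq unfolding e by (simp only: subseq_append) simp
qed

text \<open>Passage from a block t to the next block t', with w the braid still to their left. The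
  reflection \<phi> exchanges the two parabolic submonoids, so F and the conclusion have the same
  shape and the step can be iterated. With t' = u * up l n, the estimate \<open>le_only\<close>
  handles the reflected u at P', and \<open>up l n\<close> leads from P' down to a bound of the form
  required by F.\<close>

lemma block_step:
  fixes n :: int and le :: "pbraid \<Rightarrow> pbraid \<Rightarrow> bool"
  defines "\<phi> \<equiv> flip (n + 1)"
  assumes n: "2 \<le> n"
    and trans: "\<And>x y z. le x y \<Longrightarrow> le y z \<Longrightarrow> le x z"
    and left: "\<And>w x y. supp w \<subseteq> {1..n} \<Longrightarrow> le x y \<Longrightarrow> le (w * x) (w * y)"
    and star: "star_order n (\<lambda>x y. le (\<phi> x * P') (\<phi> y * P'))"
    and P': "le P' (dn n 1 * P)"
    and t: "supp t \<subseteq> {1..n - 1}" and t': "supp t' \<subseteq> {2..n}" "t' \<noteq> 1"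
    and w: "only 1 w" "w \<noteq> 1" "only n (w * t')" "only 1 (w * t' * t)"
    and F: "\<And>J X. 1 \<le> J \<Longrightarrow> J \<le> n - 1 \<Longrightarrow> run J (n - 1) t \<Longrightarrow> supp X \<subseteq> {J + 1..n - 1} \<Longrightarrow>
      le (X * dn (n - 1) 1 * P) (t * z)"
    and J: "1 \<le> J" "J \<le> n - 1" "run J (n - 1) (\<phi> t')" and X: "supp X \<subseteq> {J + 1..n - 1}"
  shows "le (\<phi> (X * dn (n - 1) 1) * P') (t' * (t * z))"
proof -
  interpret star_order n "\<lambda>x y. le (\<phi> x * P') (\<phi> y * P')" by (rule star)
  obtain j y where j: "1 \<le> j" "j \<le> n" "run j (n - 1) t" "up j n * t = y * gen n"
    using complement_run[OF _ t] n by auto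
  \<comment> \<open>The product \<open>up j n * t\<close> ends in gen n, whereas gen 1 is the only
    generator dividing w * t' * t.\<close>
  have nj: "\<not> rdvd (up j n) (w * t')"
  proof
    assume "rdvd (up j n) (w * t')"
    then obtain a where "w * t' = a * up j n" by (auto simp: rdvd_def)
    then have "w * t' * t = a * y * gen n" using j(4) by (simp add: mult.assoc)
    then show False using w(4) n by (auto simp: only_def rdvd_def)
  qed
  have only': "only n t'" using only_rdvd[OF w(3)] by blast
  obtain l u where l: "2 \<le> l" "l \<le> n" "t' = u * up l n" "only l u"
    using only_up_factor[OF only' t'(2,1)] by blast
  have jl: "j < l"
  proof (rule ccontr)
    assume "\<not> j < l"
    then have "rdvd (up j n) t'" using l j by (intro rdvd_up_mono[of l j]) auto
    then show False using nj rdvd_mult by blast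
  qed
  have jn: "j \<le> n - 1" using jl l by simp
  obtain w' where w': "w = w' * gen 1" using only_factor[OF w(1,2)] .
  \<comment> \<open>If t' were just \<open>up l n\<close>, the final gen 1 of w would either
    complete it to \<open>up 1 n\<close>, against \<open>nj\<close>, or commute past it and divide w
    * t' on the right.\<close>
  have u: "u \<noteq> 1"
  proof
    assume "u = 1"
    then have tl: "t' = up l n" using l by simp
    show False
    proof (cases "l = 2")
      case True
      then have "w * t' = w' * up 1 n" using w' tl up_left[of 1 n] n by (simp add: mult.assoc)
      moreover have "j = 1" using jl True j by simp
      ultimately show False using nj by auto
    next
      case False
      have "gen 1 * up l n = up l n * gen 1" by (rule gen_commute_far) (use l False in auto)
      then have "w * t' = w' * up l n * gen 1" using w' tl by (simp add: mult.assoc)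
      then show False using w(3) n by (auto simp: only_def rdvd_def)
    qed
  qed
  have ft': "\<phi> t' = \<phi> u * dn (n + 1 - l) 1" using l(3) by (simp add: \<phi>_def)
  \<comment> \<open>For l > 2 the letter n - 1 does not occur in the factor removed from the
    reflected block. For l = 2 it does, but u ends in gen 2, whose reflection is gen (n - 1), so
    this letter is doubled.\<close>
  have run_u: "run J (n - 1) (\<phi> u)"
  proof (cases "l = 2")
    case True
    obtain u1 where u1: "u = u1 * gen 2" using only_factor[OF l(4) u] True by auto
    have "\<phi> t' = \<phi> u1 * gen (n - 1) * gen (n - 1) * dn (n - 2) 1"
      using ft' u1 True n dn_left[of 1 "n - 1"] by (simp add: \<phi>_def mult.assoc)
    then have "run J (n - 1) (\<phi> u1 * gen (n - 1) * gen (n - 1))"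
      using run_tail[of J "n - 1" _ "dn (n - 2) 1"] J by simp
    from run_gen_gen[OF J(2) this] show ?thesis using u1 by (simp add: \<phi>_def)
  next
    case False
    then show ?thesis using run_tail[of J "n - 1" "\<phi> u" "dn (n + 1 - l) 1"] J ft' l by simp
  qed
  have "only (n + 1 - l) (\<phi> u)" unfolding \<phi>_def by (rule only_flip[OF l(4)])
  moreover have "supp (\<phi> u) \<subseteq> {1..n - 1}" using t'(1) l(3) by (auto simp: \<phi>_def)
  ultimately obtain x where x: "supp x \<subseteq> {1..n + 1 - l - 1}"
      "le (\<phi> (X * dn (n - 1) 1) * P') (\<phi> (\<phi> u * x) * P')"
    using le_only[of "n - 1" "\<phi> u" "n + 1 - l" J X] run_u J X l by auto
  have sx: "supp (\<phi> x) \<subseteq> {l + 1..n}" using x(1) by (auto simp: \<phi>_def)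
  have "supp (dn (n + 1 - l) 2) \<subseteq> {2..n}" using l by auto
  \<comment> \<open>The inserted factor reflects to letters from 2 on, so it fixes P'. Together with
    the gen n that heads \<open>dn n 1\<close> it forms the \<open>up l n\<close> at the end of
    t'.\<close>
  from le_fix[OF this] have "le P' (up l (n - 1) * P')" by (simp add: \<phi>_def)
  then have "le (\<phi> x * P') (\<phi> x * (up l (n - 1) * P'))" using sx l by (intro left) auto
  moreover have "le (\<phi> x * (up l (n - 1) * P')) (\<phi> x * (up l (n - 1) * (dn n 1 * P)))"
    using sx l by (intro left P') auto
  moreover have "\<phi> x * (up l (n - 1) * (dn n 1 * P)) = \<phi> x * (up l n * (dn (n - 1) 1 * P))"
    using l n up_right[of l n] dn_left[of 1 n] by (simp add: mult.assoc)
  moreover have "\<dots> = up l n * (shift (-1) (\<phi> x) * dn (n - 1) 1 * P)"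
    using up_shift_down[OF sx] by (metis mult.assoc)
  moreover have "le \<dots> (up l n * (t * z))"
  proof (rule left)
    show "le (shift (-1) (\<phi> x) * dn (n - 1) 1 * P) (t * z)"
      by (rule F[OF j(1) jn j(3)]) (use sx jl in force)
  qed (use l in auto)
  ultimately have "le (\<phi> x * P') (up l n * (t * z))" using trans by metis
  then have "le (u * (\<phi> x * P')) (u * (up l n * (t * z)))" using l(3) t' by (intro left) auto
  moreover have "\<phi> (\<phi> u * x) * P' = u * (\<phi> x * P')" by (simp add: \<phi>_def mult.assoc)
  ultimately show ?thesis using x(2) trans l(3) by (metis mult.assoc)
qed

section \<open>Rational Dynnikov coordinates\<close>

text \<open>These four are Dynnikov's formulas for the action of a braid generator on lamination
  coordinates, with maximum and sum turned into sum and product. They contain no subtraction, so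
  positive reals stay positive.\<close>

definition dyn_a :: "real \<Rightarrow> real \<Rightarrow> real \<Rightarrow> real \<Rightarrow> real" where
  "dyn_a a p b q = a * (1 + p) + b * p"
definition dyn_p :: "real \<Rightarrow> real \<Rightarrow> real \<Rightarrow> real \<Rightarrow> real" where
  "dyn_p a p b q = p * q * b / (p * b + a * (1 + p) * (1 + q))"
definition dyn_b :: "real \<Rightarrow> real \<Rightarrow> real \<Rightarrow> real \<Rightarrow> real" where
  "dyn_b a p b q = a * b * q / (b + a * (1 + q))"
definition dyn_q :: "real \<Rightarrow> real \<Rightarrow> real \<Rightarrow> real \<Rightarrow> real" where
  "dyn_q a p b q = (p * b + a * (1 + p) * (1 + q)) / b"

text \<open>The polynomials \<open>d\<close> to \<open>H\<close> arise as denominators or numerators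
  after one or two generators. Factorizations such as D + q r c = (1 + r) B1 turn 1 + Q1 and its
  analogues into single fractions; \<open>i1\<close> to \<open>i4\<close> are the polynomial
  identities to which the harder comparisons reduce.\<close>

lemma dyn_braid:
  fixes a p b q c r :: real
  assumes pos: "a > 0" "p > 0" "b > 0" "q > 0" "c > 0" "r > 0"
  defines "a1 \<equiv> dyn_a a p b q" and "p1 \<equiv> dyn_p a p b q" and "b1 \<equiv> dyn_b a p b q" and "q1 \<equiv> dyn_q a p b q"
  defines "b2 \<equiv> dyn_a b1 q1 c r" and "q2 \<equiv> dyn_p b1 q1 c r" and "c2 \<equiv> dyn_b b1 q1 c r" and "r2 \<equiv> dyn_q b1 q1 c r"
  defines "B1 \<equiv> dyn_a b q c r" and "Q1 \<equiv> dyn_p b q c r" and "C1 \<equiv> dyn_b b q c r" and "R1 \<equiv> dyn_q b q c r"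
  defines "A2 \<equiv> dyn_a a p B1 Q1" and "P2 \<equiv> dyn_p a p B1 Q1" and "B2 \<equiv> dyn_b a p B1 Q1" and "Q2 \<equiv> dyn_q a p B1 Q1"
  shows "dyn_a a1 p1 b2 q2 = A2" (is ?A)
   and "dyn_p a1 p1 b2 q2 = P2" (is ?P)
   and "dyn_b a1 p1 b2 q2 = dyn_a B2 Q2 C1 R1" (is ?B)
   and "dyn_q a1 p1 b2 q2 = dyn_p B2 Q2 C1 R1" (is ?Q)
   and "c2 = dyn_b B2 Q2 C1 R1" (is ?C)
   and "r2 = dyn_q B2 Q2 C1 R1" (is ?R)
proof -
  define d where "d = p * b + a * (1 + p) * (1 + q)"
  define e where "e = b + a * (1 + q)"
  define D where "D = q * c + b * (1 + q) * (1 + r)"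
  define E where "E = c + b * (1 + r)"
  define F where "F = D + a * (1 + r)"
  define G where "G = p * D + a * (1 + p) * (1 + r)"
  define H where "H = d * c + a * b * q * (1 + p) * (1 + r)"
  have pos': "d > 0" "e > 0" "D > 0" "E > 0" "F > 0" "G > 0" "H > 0"
    unfolding d_def e_def D_def E_def F_def G_def H_def using pos
    by (intro add_pos_pos mult_pos_pos; simp)+
  have a1: "a1 = a * (1 + p) + b * p" and p1: "p1 = p * q * b / d"
    and b1: "b1 = a * b * q / e" and q1: "q1 = d / b"
    by (simp_all add: a1_def p1_def b1_def q1_def dyn_a_def dyn_p_def dyn_b_def dyn_q_def d_def e_def)
  have B1: "B1 = b * (1 + q) + c * q" and Q1: "Q1 = q * r * c / D"
    and C1: "C1 = b * c * r / E" and R1: "R1 = D / c"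
    by (simp_all add: B1_def Q1_def C1_def R1_def dyn_a_def dyn_p_def dyn_b_def dyn_q_def D_def E_def)
  have posB1: "B1 > 0" and posa1: "a1 > 0" unfolding B1 a1 using pos by (intro add_pos_pos mult_pos_pos; simp)+
  have "D + q * r * c = (1 + r) * B1" unfolding D_def B1 by algebra
  then have Q1': "1 + Q1 = (1 + r) * B1 / D" unfolding Q1 using pos' by (simp add: field_simps)
  have "D + c = (1 + q) * E" unfolding D_def E_def by algebra
  then have R1': "1 + R1 = (1 + q) * E / c" unfolding R1 using pos by (simp add: field_simps)
  have B2: "B2 = a * q * r * c / F"
  proof -
    have "B1 + a * (1 + Q1) = B1 * F / D" unfolding Q1' F_def using pos' by (simp add: field_simps)
    then have "B2 = a * B1 * Q1 / (B1 * F / D)" by (simp add: B2_def dyn_b_def)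
    then show ?thesis unfolding Q1 using posB1 pos' by (simp add: field_simps)
  qed
  have e1: "p * B1 + a * (1 + p) * (1 + Q1) = B1 * G / D"
    unfolding Q1' G_def using pos' by (simp add: field_simps)
  have P2: "P2 = p * q * r * c / G"
  proof -
    have "P2 = p * Q1 * B1 / (B1 * G / D)" by (simp add: P2_def dyn_p_def e1)
    then show ?thesis unfolding Q1 using posB1 pos' by (simp add: field_simps)
  qed
  have Q2: "Q2 = G / D" using posB1 by (simp add: Q2_def dyn_q_def e1)
  have "D + G = (1 + p) * F" unfolding G_def F_def by algebra
  then have Q2': "1 + Q2 = (1 + p) * F / D" unfolding Q2 using pos' by (simp add: field_simps)
  have "b + d = (1 + p) * e" unfolding d_def e_def by algebra
  then have q1': "1 + q1 = (1 + p) * e / b" unfolding q1 using pos by (simp add: field_simps)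
  have b2: "b2 = a * q * (1 + p) + c * d / b"
    unfolding b2_def dyn_a_def q1' b1 unfolding q1 using pos pos' by simp
  have e2: "q1 * c + b1 * (1 + q1) * (1 + r) = H / b"
    unfolding q1' b1 unfolding q1 H_def using pos pos' by (simp add: field_simps)
  have q2: "q2 = d * r * c / H"
    unfolding q2_def dyn_p_def e2 unfolding q1 using pos pos' by (simp add: field_simps)
  have r2: "r2 = H / (b * c)"
    unfolding r2_def dyn_q_def e2 using pos by simp
  have "H + d * r * c = (1 + r) * (b * b2)" unfolding H_def b2 using pos by (simp add: field_simps)
  then have q2': "1 + q2 = (1 + r) * b * b2 / H" unfolding q2 using pos' by (simp add: field_simps)
  have posb2: "b2 > 0" unfolding b2 using pos pos' by (intro add_pos_pos mult_pos_pos divide_pos_pos; simp)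
  have "d + p * q * b = (1 + q) * a1" unfolding d_def a1 by algebra
  then have p1': "1 + p1 = (1 + q) * a1 / d" unfolding p1 using pos' by (simp add: field_simps)
  have i1: "d * G = p * q * H + (1 + q) * (1 + r) * a1\<^sup>2"
    unfolding d_def G_def H_def D_def a1 by algebra
  have i2: "H * D = G * b * c + a * q * (1 + p) * (1 + q) * E\<^sup>2"
    unfolding H_def D_def G_def E_def d_def by algebra
  have i3: "a1 * d * (D * E) = (a * q * (1 + p) * E + b * G) * (H + a1 * b * (1 + r))"
    unfolding H_def D_def G_def E_def d_def a1 by algebra
  have i4: "D * (c * e + a * b * q * (1 + r)) = b * c * F + a * q * (1 + q) * E\<^sup>2"
    unfolding D_def F_def E_def e_def by algebra
  have e3: "p1 * b2 + a1 * (1 + p1) * (1 + q2) = b2 * b * G / H"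
  proof -
    have "p1 * b2 + a1 * (1 + p1) * (1 + q2) = b2 * b * (p * q * H + (1 + q) * (1 + r) * a1\<^sup>2) / (d * H)"
      unfolding p1' q2' unfolding p1 using pos pos' by (simp add: field_simps power2_eq_square)
    also have "\<dots> = b2 * b * G / H" unfolding i1[symmetric] using pos' by simp
    finally show ?thesis .
  qed
  show ?A
    unfolding A2_def dyn_a_def p1' b2 a1[symmetric] unfolding p1 B1 using pos pos'
    by (simp add: field_simps) (simp add: a1 d_def algebra_simps power2_eq_square)
  show ?P
  proof -
    have "dyn_p a1 p1 b2 q2 = p1 * q2 * b2 / (b2 * b * G / H)" by (simp add: dyn_p_def e3)
    also have "\<dots> = P2" unfolding P2 p1 q2 using pos pos' posb2 by (simp add: field_simps)
    finally show ?thesis .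
  qed
  have e4: "Q2 * C1 + B2 * (1 + Q2) * (1 + R1) = r * H / E"
  proof -
    have "Q2 * C1 + B2 * (1 + Q2) * (1 + R1) = r * (G * b * c + a * q * (1 + p) * (1 + q) * E\<^sup>2) / (D * E)"
      unfolding Q2' R1' unfolding B2 Q2 C1 using pos pos' by (simp add: field_simps power2_eq_square)
    also have "\<dots> = r * H / E" unfolding i2[symmetric] using pos' by simp
    finally show ?thesis .
  qed
  show ?Q
  proof -
    have "dyn_q a1 p1 b2 q2 = b * G / H" using posb2 by (simp add: dyn_q_def e3)
    moreover have "dyn_p B2 Q2 C1 R1 = Q2 * R1 * C1 / (r * H / E)" by (simp add: dyn_p_def e4)
    moreover have "Q2 * R1 * C1 / (r * H / E) = b * G / H"
      unfolding Q2 R1 C1 using pos pos' by (simp add: field_simps)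
    ultimately show ?thesis by simp
  qed
  show ?R
  proof -
    have "dyn_q B2 Q2 C1 R1 = (r * H / E) / C1" by (simp add: dyn_q_def e4)
    also have "\<dots> = r2" unfolding r2 C1 using pos pos' by (simp add: field_simps)
    finally show ?thesis ..
  qed
  show ?B
  proof -
    define W where "W = H + a1 * b * (1 + r)"
    have W: "W > 0" unfolding W_def using pos pos' posa1 by (intro add_pos_pos mult_pos_pos; simp)
    have "b2 + a1 * (1 + q2) = b2 * W / H"
      unfolding q2' W_def using pos' by (simp add: field_simps)
    then have "dyn_b a1 p1 b2 q2 = a1 * b2 * q2 / (b2 * W / H)" by (simp add: dyn_b_def)
    also have "\<dots> = a1 * d * r * c / W"
      unfolding q2 using pos' posb2 W by (simp add: field_simps)
    also have "\<dots> = r * c * (a * q * (1 + p) * E + b * G) / (D * E)"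
    proof -
      have "a1 * d * r * c * (D * E) = r * c * (a * q * (1 + p) * E + b * G) * W"
        using i3 unfolding W_def by algebra
      then show ?thesis using W pos' by (simp add: frac_eq_eq)
    qed
    also have "\<dots> = dyn_a B2 Q2 C1 R1"
      unfolding dyn_a_def Q2' unfolding B2 Q2 C1 using pos pos' by (simp add: field_simps)
    finally show ?thesis .
  qed
  show ?C
  proof -
    let ?g = "c * e + a * b * q * (1 + r)"
    have g: "?g > 0" using pos pos' by (intro add_pos_pos mult_pos_pos; simp)
    have "c + b1 * (1 + r) = ?g / e" unfolding b1 using pos' by (simp add: field_simps)
    then have "c2 = b1 * c * r / (?g / e)" by (simp add: c2_def dyn_b_def)
    then have l: "c2 = a * b * q * c * r / ?g" unfolding b1 using pos' by simp
    have "C1 + B2 * (1 + R1) = r * (b * c * F + a * q * (1 + q) * E\<^sup>2) / (E * F)"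
      unfolding R1' C1 B2 using pos pos' by (simp add: field_simps power2_eq_square)
    also have "\<dots> = r * (D * ?g) / (E * F)" by (simp only: i4)
    finally have "dyn_b B2 Q2 C1 R1 = B2 * C1 * R1 / (r * (D * ?g) / (E * F))" by (simp add: dyn_b_def)
    also have "\<dots> = a * b * q * c * r / ?g"
      unfolding B2 C1 R1 using pos pos' g by (simp add: divide_simps)
    finally show ?thesis unfolding l ..
  qed
qed

section \<open>Inverse formulas and the action on states\<close>

definition dyn_a' :: "real \<Rightarrow> real \<Rightarrow> real \<Rightarrow> real \<Rightarrow> real" where
  "dyn_a' a p b q = a * b / (b * (1 + p) + a * p)"
definition dyn_p' :: "real \<Rightarrow> real \<Rightarrow> real \<Rightarrow> real \<Rightarrow> real" where
  "dyn_p' a p b q = p * q * a / (p * a + b * (1 + p) * (1 + q))"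
definition dyn_b' :: "real \<Rightarrow> real \<Rightarrow> real \<Rightarrow> real \<Rightarrow> real" where
  "dyn_b' a p b q = (a + b * (1 + q)) / q"
definition dyn_q' :: "real \<Rightarrow> real \<Rightarrow> real \<Rightarrow> real \<Rightarrow> real" where
  "dyn_q' a p b q = (p * a + b * (1 + p) * (1 + q)) / a"

lemma dyn_pos:
  assumes "a > 0" "p > 0" "b > 0" "q > 0"
  shows "dyn_a a p b q > 0" "dyn_p a p b q > 0" "dyn_b a p b q > 0" "dyn_q a p b q > 0"
    "dyn_a' a p b q > 0" "dyn_p' a p b q > 0" "dyn_b' a p b q > 0" "dyn_q' a p b q > 0"
  unfolding dyn_a_def dyn_p_def dyn_b_def dyn_q_def dyn_a'_def dyn_p'_def dyn_b'_def dyn_q'_def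
  using assms by (intro add_pos_pos mult_pos_pos divide_pos_pos; simp)+

lemma dyn_inverse:
  assumes pos: "a > 0" "p > 0" "b > 0" "q > 0"
  defines "a1 \<equiv> dyn_a a p b q" and "p1 \<equiv> dyn_p a p b q" and "b1 \<equiv> dyn_b a p b q" and "q1 \<equiv> dyn_q a p b q"
  shows "dyn_a' a1 p1 b1 q1 = a" "dyn_p' a1 p1 b1 q1 = p" "dyn_b' a1 p1 b1 q1 = b" "dyn_q' a1 p1 b1 q1 = q"
proof -
  define d where "d = p * b + a * (1 + p) * (1 + q)"
  define e where "e = b + a * (1 + q)"
  have pos': "d > 0" "e > 0" unfolding d_def e_def using pos by (intro add_pos_pos mult_pos_pos; simp)+
  have a1: "a1 = a * (1 + p) + b * p" and p1: "p1 = p * q * b / d"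
    and b1: "b1 = a * b * q / e" and q1: "q1 = d / b"
    by (simp_all add: a1_def p1_def b1_def q1_def dyn_a_def dyn_p_def dyn_b_def dyn_q_def d_def e_def)
  have posa1: "a1 > 0" unfolding a1 using pos by (intro add_pos_pos mult_pos_pos; simp)
  have "d + p * q * b = (1 + q) * a1" unfolding d_def a1 by algebra
  then have p1': "1 + p1 = (1 + q) * a1 / d" unfolding p1 using pos' by (simp add: field_simps)
  have "b + d = (1 + p) * e" unfolding d_def e_def by algebra
  then have q1': "1 + q1 = (1 + p) * e / b" unfolding q1 using pos by (simp add: field_simps)
  have "b1 * (1 + p1) + a1 * p1 = a1 * b * q * (a * (1 + q) + p * e) / (e * d)"
    unfolding p1' unfolding p1 b1 using pos pos' by (simp add: field_simps)
  also have "a * (1 + q) + p * e = d" unfolding d_def e_def by algebra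
  finally have "b1 * (1 + p1) + a1 * p1 = a1 * b * q / e" using pos' by simp
  then show "dyn_a' a1 p1 b1 q1 = a"
    unfolding dyn_a'_def b1 using pos pos' posa1 by simp
  have "p1 * a1 + b1 * (1 + p1) * (1 + q1) = a1 * q * (p * b + a * (1 + q) * (1 + p)) / d"
    unfolding p1' q1' unfolding p1 b1 using pos pos' by (simp add: field_simps)
  also have "p * b + a * (1 + q) * (1 + p) = d" unfolding d_def by algebra
  finally have e1: "p1 * a1 + b1 * (1 + p1) * (1 + q1) = a1 * q" using pos' by simp
  show "dyn_p' a1 p1 b1 q1 = p"
    unfolding dyn_p'_def e1 unfolding p1 q1 using pos pos' posa1 by simp
  show "dyn_q' a1 p1 b1 q1 = q"
    unfolding dyn_q'_def e1 using posa1 by simp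
  have "a1 + b1 * (1 + q1) = d"
    unfolding q1' b1 a1 d_def using pos pos' by (simp add: field_simps)
  then show "dyn_b' a1 p1 b1 q1 = b"
    unfolding dyn_b'_def q1 using pos pos' by simp
qed

lemma dyn_inverse':
  assumes pos: "a > 0" "p > 0" "b > 0" "q > 0"
  defines "a1 \<equiv> dyn_a' a p b q" and "p1 \<equiv> dyn_p' a p b q" and "b1 \<equiv> dyn_b' a p b q" and "q1 \<equiv> dyn_q' a p b q"
  shows "dyn_a a1 p1 b1 q1 = a" "dyn_p a1 p1 b1 q1 = p" "dyn_b a1 p1 b1 q1 = b" "dyn_q a1 p1 b1 q1 = q"
proof -
  define d where "d = p * a + b * (1 + p) * (1 + q)"
  define e where "e = a + b * (1 + q)"
  define f where "f = b * (1 + p) + a * p"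
  have pos': "d > 0" "e > 0" "f > 0"
    unfolding d_def e_def f_def using pos by (intro add_pos_pos mult_pos_pos; simp)+
  have a1: "a1 = a * b / f" and p1: "p1 = p * q * a / d"
    and b1: "b1 = e / q" and q1: "q1 = d / a"
    by (simp_all add: a1_def p1_def b1_def q1_def dyn_a'_def dyn_p'_def dyn_b'_def dyn_q'_def d_def e_def f_def)
  have "d + p * q * a = (1 + q) * f" unfolding d_def f_def by algebra
  then have p1': "1 + p1 = (1 + q) * f / d" unfolding p1 using pos' by (simp add: field_simps)
  have "a + d = (1 + p) * e" unfolding d_def e_def by algebra
  then have q1': "1 + q1 = (1 + p) * e / a" unfolding q1 using pos by (simp add: field_simps)
  have "a1 * (1 + p1) + b1 * p1 = a * (b * (1 + q) + p * e) / d"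
    unfolding p1' unfolding p1 b1 a1 using pos pos' by (simp add: field_simps)
  also have "b * (1 + q) + p * e = d" unfolding d_def e_def by algebra
  finally show "dyn_a a1 p1 b1 q1 = a" unfolding dyn_a_def using pos' by simp
  have "p1 * b1 + a1 * (1 + p1) * (1 + q1) = e * (p * a + b * (1 + p) * (1 + q)) / d"
    unfolding p1' q1' unfolding p1 b1 a1 using pos pos' by (simp add: field_simps)
  then have e1: "p1 * b1 + a1 * (1 + p1) * (1 + q1) = e" using pos' by (simp add: d_def)
  show "dyn_p a1 p1 b1 q1 = p"
    unfolding dyn_p_def e1 unfolding p1 q1 b1 using pos pos' by simp
  show "dyn_q a1 p1 b1 q1 = q"
    unfolding dyn_q_def e1 unfolding b1 using pos' pos by simp
  have "b1 + a1 * (1 + q1) = e * (f + b * (1 + p) * q) / (q * f)"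
    unfolding q1' b1 a1 using pos pos' by (simp add: field_simps)
  also have "f + b * (1 + p) * q = d" unfolding d_def f_def by algebra
  finally have "b1 + a1 * (1 + q1) = e * d / (q * f)" .
  then show "dyn_b a1 p1 b1 q1 = b"
    unfolding dyn_b_def unfolding b1 q1 a1 using pos pos' by (simp add: divide_simps)
qed

type_synonym dyn_state = "nat \<Rightarrow> real \<times> real"

definition dyn_gen :: "nat \<Rightarrow> dyn_state \<Rightarrow> dyn_state" where
  "dyn_gen i f = (let (a, p) = f i; (b, q) = f (Suc i) in
     f(i := (dyn_a a p b q, dyn_p a p b q), Suc i := (dyn_b a p b q, dyn_q a p b q)))"

definition dyn_inv :: "nat \<Rightarrow> dyn_state \<Rightarrow> dyn_state" where
  "dyn_inv i f = (let (a, p) = f i; (b, q) = f (Suc i) in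
     f(i := (dyn_a' a p b q, dyn_p' a p b q), Suc i := (dyn_b' a p b q, dyn_q' a p b q)))"

definition dyn_positive :: "dyn_state \<Rightarrow> bool" where
  "dyn_positive f \<longleftrightarrow> (\<forall>i. fst (f i) > 0 \<and> snd (f i) > 0)"

lemma dyn_positiveD: "dyn_positive f \<Longrightarrow> f i = (a, p) \<Longrightarrow> a > 0 \<and> p > 0"
  unfolding dyn_positive_def by (metis fst_conv snd_conv)

lemma dyn_positive_gen: "dyn_positive f \<Longrightarrow> dyn_positive (dyn_gen i f)"
  and dyn_positive_inv: "dyn_positive f \<Longrightarrow> dyn_positive (dyn_inv i f)"
  by (auto simp: dyn_positive_def dyn_gen_def dyn_inv_def dyn_pos split: prod.splits)
     (metis dyn_pos fst_conv snd_conv)+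

lemma dyn_inv_gen: "dyn_positive f \<Longrightarrow> dyn_inv i (dyn_gen i f) = f"
proof -
  assume f: "dyn_positive f"
  obtain a p where i: "f i = (a, p)" by fastforce
  obtain b q where j: "f (Suc i) = (b, q)" by fastforce
  have pos: "a > 0" "p > 0" "b > 0" "q > 0" using dyn_positiveD[OF f i] dyn_positiveD[OF f j] by auto
  show ?thesis using i j dyn_inverse[OF pos] by (auto simp: dyn_gen_def dyn_inv_def fun_eq_iff)
qed

lemma dyn_gen_inv: "dyn_positive f \<Longrightarrow> dyn_gen i (dyn_inv i f) = f"
proof -
  assume f: "dyn_positive f"
  obtain a p where i: "f i = (a, p)" by fastforce
  obtain b q where j: "f (Suc i) = (b, q)" by fastforce
  have pos: "a > 0" "p > 0" "b > 0" "q > 0" using dyn_positiveD[OF f i] dyn_positiveD[OF f j] by auto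
  show ?thesis using i j dyn_inverse'[OF pos] by (auto simp: dyn_gen_def dyn_inv_def fun_eq_iff)
qed

lemma dyn_gen_commute: "Suc i < j \<Longrightarrow> dyn_gen i (dyn_gen j f) = dyn_gen j (dyn_gen i f)"
  by (auto simp: dyn_gen_def fun_eq_iff split: prod.splits)

lemma dyn_gen_braid:
  assumes f: "dyn_positive f"
  shows "dyn_gen i (dyn_gen (Suc i) (dyn_gen i f)) = dyn_gen (Suc i) (dyn_gen i (dyn_gen (Suc i) f))"
proof -
  obtain a p where i: "f i = (a, p)" by fastforce
  obtain b q where j: "f (Suc i) = (b, q)" by fastforce
  obtain c r where k: "f (Suc (Suc i)) = (c, r)" by fastforce
  have pos: "a > 0" "p > 0" "b > 0" "q > 0" "c > 0" "r > 0"
    using dyn_positiveD[OF f i] dyn_positiveD[OF f j] dyn_positiveD[OF f k] by auto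
  show ?thesis using i j k dyn_braid[OF pos] by (auto simp: dyn_gen_def fun_eq_iff)
qed

text \<open>A right action: the first letter of the word is applied first.\<close>

definition dyn_act :: "nat word \<Rightarrow> dyn_state \<Rightarrow> dyn_state" where
  "dyn_act w = fold (\<lambda>(i, b). if b then dyn_gen i else dyn_inv i) w"

lemma dyn_act_simps [simp]:
  "dyn_act [] f = f" "dyn_act ((i, True) # w) f = dyn_act w (dyn_gen i f)"
  "dyn_act ((i, False) # w) f = dyn_act w (dyn_inv i f)"
  "dyn_act (u @ v) f = dyn_act v (dyn_act u f)"
  by (simp_all add: dyn_act_def)

lemma dyn_act_Cons: "dyn_act ((i, b) # w) f = dyn_act w (if b then dyn_gen i f else dyn_inv i f)"
  by (cases b) simp_all

lemma dyn_act_positive: "dyn_positive f \<Longrightarrow> dyn_positive (dyn_act w f)"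
  by (induction w arbitrary: f) (auto simp: dyn_act_Cons dyn_positive_gen dyn_positive_inv)

text \<open>Positivity is carried along the word because the inverse formulas and the braid relation
  are established for positive coordinates.\<close>

lemma dyn_act_pres_rel:
  assumes "(u, v) \<in> pres_rel S (braid_relations n)"
  shows "dyn_positive f \<Longrightarrow> dyn_act u f = dyn_act v f"
  using assms
proof (induction arbitrary: f rule: pres_rel.induct)
  case (cancel u v x b)
  then have "dyn_positive (dyn_act u f)" by (simp add: dyn_act_positive)
  then show ?case by (cases b) (simp_all add: dyn_gen_inv dyn_inv_gen)
next
  case (rel u v l r)
  then have pos: "dyn_positive (dyn_act u f)" by (simp add: dyn_act_positive)
  from \<open>(l, r) \<in> braid_relations n\<close> have "dyn_act l (dyn_act u f) = dyn_act r (dyn_act u f)"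
    unfolding braid_relations_def
  proof (elim UnE CollectE exE conjE)
    fix i j :: nat
    assume lr: "(l, r) = ([(i, True), (j, True), (i, True)], [(j, True), (i, True), (j, True)])"
      and "\<bar>int i - int j\<bar> = 1"
    then have "j = Suc i \<or> i = Suc j" by linarith
    then show ?thesis using lr dyn_gen_braid[OF pos] by auto
  next
    fix i j :: nat
    assume lr: "(l, r) = ([(i, True), (j, True)], [(j, True), (i, True)])"
      and "\<bar>int i - int j\<bar> \<ge> 2"
    then have "Suc i < j \<or> Suc j < i" by linarith
    then show ?thesis using lr dyn_gen_commute[of i j "dyn_act u f"] dyn_gen_commute[of j i "dyn_act u f"] by auto
  qed
  then show ?case by simp
qed auto

lemma dyn_act_fix: "w \<in> words {2..n} \<Longrightarrow> dyn_act w f 1 = f 1"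
proof (induction w arbitrary: f)
  case (Cons x w)
  obtain i b where x: "x = (i, b)" by fastforce
  then have "i \<ge> 2" "w \<in> words {2..n}" using Cons.prems by auto
  then have "dyn_act (x # w) f 1 = (if b then dyn_gen i f else dyn_inv i f) 1"
    using Cons.IH by (simp add: x dyn_act_Cons)
  also have "\<dots> = f 1" using \<open>i \<ge> 2\<close> by (auto simp: dyn_gen_def dyn_inv_def split: prod.splits)
  finally show ?case .
qed simp

lemma dyn_gen_increases: "dyn_positive f \<Longrightarrow> fst (dyn_gen 1 f 1) > fst (f 1)"
proof -
  assume f: "dyn_positive f"
  obtain a p where i: "f 1 = (a, p)" by fastforce
  obtain b q where j: "f (Suc 1) = (b, q)" by fastforce
  have pos: "a > 0" "p > 0" "b > 0" "q > 0" using dyn_positiveD[OF f i] dyn_positiveD[OF f j] by auto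
  have "a * p + b * p > 0" using pos by (intro add_pos_pos mult_pos_pos)
  then show ?thesis using i j by (simp add: dyn_gen_def dyn_a_def algebra_simps)
qed

section \<open>Embedding the positive monoid into the braid group\<close>

declare One_nat_def [simp del]

definition pos_word :: "int list \<Rightarrow> nat word" where
  "pos_word w = map (\<lambda>i. (nat i, True)) w"

lemma pos_word_simps [simp]:
  "pos_word [] = []" "pos_word (i # w) = (nat i, True) # pos_word w"
  "pos_word (u @ v) = pos_word u @ pos_word v"
  by (simp_all add: pos_word_def)

lemma pos_word_words: "set w \<subseteq> {1..int n} \<Longrightarrow> pos_word w \<in> words {1..n}"
  by (induction w) auto

lemma peq_pos_word:
  assumes "peq u v" "set u \<subseteq> {1..int n}"
  shows "(pos_word u, pos_word v) \<in> pres_rel {1..n} (braid_relations n)"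
  using assms(1) unfolding peq_def
proof (induction rule: rtranclp_induct)
  case base
  then show ?case using assms(2) by (intro pres_rel.refl pos_word_words)
next
  case (step v w)
  have "set v = set u" "set w = set u" using step.hyps peq_set[of u v] peq_set[of u w]
    by (auto simp: peq_def dest: rtranclp.rtrancl_into_rtrancl)
  then have vw: "set v \<subseteq> {1..int n}" "set w \<subseteq> {1..int n}" using assms(2) by auto
  have "(pos_word v, pos_word w) \<in> pres_rel {1..n} (braid_relations n)"
    using step.hyps(2)
  proof cases
    case (far i j a b)
    have ij: "i \<in> {1..int n}" "j \<in> {1..int n}" using vw far by auto
    then have "\<bar>int (nat i) - int (nat j)\<bar> \<ge> 2" using far by auto
    then have "([(nat i, True), (nat j, True)], [(nat j, True), (nat i, True)]) \<in> braid_relations n"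
      using ij unfolding braid_relations_def by auto
    from pres_rel.rel[OF _ _ this, of "pos_word a" "{1..n}" "pos_word b"]
    moreover have "1 \<le> nat i" "nat i \<le> n" "1 \<le> nat j" "nat j \<le> n" using ij by auto
    ultimately show ?thesis using far vw pos_word_words[of a n] pos_word_words[of b n] by auto
  next
    case (near i j a b)
    have ij: "i \<in> {1..int n}" "j \<in> {1..int n}" using vw near by auto
    then have "\<bar>int (nat i) - int (nat j)\<bar> = 1" using near by auto
    then have "([(nat i, True), (nat j, True), (nat i, True)], [(nat j, True), (nat i, True), (nat j, True)])
        \<in> braid_relations n"
      using ij unfolding braid_relations_def by auto
    from pres_rel.rel[OF _ _ this, of "pos_word a" "{1..n}" "pos_word b"]
    moreover have "1 \<le> nat i" "nat i \<le> n" "1 \<le> nat j" "nat j \<le> n" using ij by auto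
    ultimately show ?thesis using near vw pos_word_words[of a n] pos_word_words[of b n] by auto
  qed
  with step.IH show ?case by (rule pres_rel.trans)
qed

section \<open>Fractions whose denominators are powers of the twist\<close>

definition twist_quotient :: "nat \<Rightarrow> nat \<Rightarrow> pbraid" where
  "twist_quotient n i = (SOME y. supp y \<subseteq> {1..int n} \<and> twist n = gen i * y \<and> twist n = y * gen i)"

lemma twist_quotient:
  assumes "i \<in> {1..n}"
  shows "supp (twist_quotient n i) \<subseteq> {1..int n}" "gen i * twist_quotient n i = twist n"
    "twist_quotient n i * gen i = twist n"
proof -
  have "\<exists>y. supp y \<subseteq> {1..int n} \<and> twist n = gen i * y \<and> twist n = y * gen i"
    using twist_factor[of "int i" "int n"] assms by (metis atLeastAtMost_iff of_nat_1 of_nat_le_iff)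
  from someI_ex[OF this] show "supp (twist_quotient n i) \<subseteq> {1..int n}"
    "gen i * twist_quotient n i = twist n" "twist_quotient n i * gen i = twist n"
    by (simp_all add: twist_quotient_def)
qed

text \<open>A word equals \<open>numer w * twist n ^ - denom w\<close> in the braid group.\<close>
fun numer :: "nat \<Rightarrow> nat word \<Rightarrow> pbraid" where
  "numer n [] = 1"
| "numer n ((i, True) # w) = gen (int i) * numer n w"
| "numer n ((i, False) # w) = twist_quotient n i * numer n w"

fun denom :: "nat word \<Rightarrow> nat" where
  "denom [] = 0"
| "denom ((i, True) # w) = denom w"
| "denom ((i, False) # w) = Suc (denom w)"

lemma numer_append [simp]: "numer n (u @ v) = numer n u * numer n v"
  by (induction n u rule: numer.induct) (simp_all add: mult.assoc)

lemma denom_append [simp]: "denom (u @ v) = denom u + denom v"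
  by (induction u rule: denom.induct) simp_all

lemma supp_numer: "w \<in> words {1..n} \<Longrightarrow> supp (numer n w) \<subseteq> {1..int n}"
proof (induction n w rule: numer.induct)
  case (3 n i w)
  then show ?case using twist_quotient(1)[of i n] by auto
qed auto

lemma numer_pos_word: "set w \<subseteq> {1..int n} \<Longrightarrow> numer n (pos_word w) = pb w"
  by (induction w) (auto simp: pb_Cons)

lemma denom_pos_word: "denom (pos_word w) = 0"
  by (induction w) auto

lemma twist_power_central: "supp x \<subseteq> {1..n} \<Longrightarrow> twist n ^ k * x = x * twist n ^ k"
proof (induction k)
  case (Suc k)
  then show ?case using twist_central[of x n] by (simp only: power_Suc) (metis mult.assoc)
qed simp

text \<open>Equality of fractions in cross-multiplied form. An inverse letter becomes its complement
  in the central twist at the price of one denominator; transitivity uses cancellation of a power of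
  the twist. For positive words both denominators vanish, and this makes the positive monoid embed
  into the group.\<close>

lemma numer_pres_rel:
  "(u, v) \<in> pres_rel {1..n} (braid_relations n) \<Longrightarrow>
    numer n u * twist n ^ denom v = numer n v * twist n ^ denom u"
proof (induction rule: pres_rel.induct)
  case (trans u v w)
  let ?T = "twist (int n)"
  have "numer n u * ?T ^ denom w * ?T ^ denom v = numer n u * ?T ^ denom v * ?T ^ denom w"
    by (simp only: mult.assoc flip: power_add) (simp only: add.commute)
  also have "\<dots> = numer n v * ?T ^ denom w * ?T ^ denom u"
    unfolding trans.IH(1) by (simp only: mult.assoc flip: power_add) (simp only: add.commute)
  also have "\<dots> = numer n w * ?T ^ denom u * ?T ^ denom v"
    unfolding trans.IH(2) by (simp only: mult.assoc flip: power_add) (simp only: add.commute)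
  finally show ?case by simp
next
  case (cancel u v x b)
  have "numer n [(x, b), (x, \<not> b)] = twist n" "denom [(x, b), (x, \<not> b)] = 1"
    using twist_quotient[OF cancel(3)] by (cases b; simp)+
  then have "numer n (u @ [(x, b), (x, \<not> b)] @ v) = numer n u * (twist n * numer n v)"
    "denom (u @ [(x, b), (x, \<not> b)] @ v) = Suc (denom (u @ v))"
    by (simp_all only: numer_append denom_append)
  moreover have "twist n * numer n v = numer n v * twist n"
    by (rule twist_central[OF supp_numer[OF cancel(2)]])
  ultimately show ?case by (simp add: mult.assoc)
next
  case (rel u v l r)
  have "numer n l = numer n r \<and> denom l = denom r"
    using rel(3) unfolding braid_relations_def
  proof (elim UnE CollectE exE conjE)
    fix i j :: nat
    assume "(l, r) = ([(i, True), (j, True), (i, True)], [(j, True), (i, True), (j, True)])"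
      "\<bar>int i - int j\<bar> = 1"
    then show ?thesis using gen_near[of "int i" "int j"] by (simp add: mult.assoc)
  next
    fix i j :: nat
    assume "(l, r) = ([(i, True), (j, True)], [(j, True), (i, True)])" "\<bar>int i - int j\<bar> \<ge> 2"
    then show ?thesis using gen_far[of "int i" "int j"] by simp
  qed
  then show ?case by simp
qed auto

section \<open>Evaluation of positive braids in the braid group\<close>

locale braid =
  fixes n :: nat
  assumes n: "2 \<le> n"
begin

abbreviation G where "G \<equiv> braid_group n"
abbreviation T where "T \<equiv> twist (int n)"

sublocale group G
  by (rule group_braid_group)

definition cl :: "nat word \<Rightarrow> nat word set" where
  "cl w = pres_rel {1..n} (braid_relations n) `` {w}"

text \<open>A representing word is chosen. The value is meaningful for supports within 1, \<dots>,
  n, where the choice does not matter; hence the restriction to \<open>pos\<close> in what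
  follows.\<close>

definition ev :: "pbraid \<Rightarrow> nat word set" where
  "ev x = cl (pos_word (SOME w. x = pb w))"

abbreviation pos :: "pbraid set" where "pos \<equiv> {x. supp x \<subseteq> {1..int n}}"

lemma cl_closed [simp]: "w \<in> words {1..n} \<Longrightarrow> cl w \<in> carrier G"
  by (auto simp: cl_def braid_group_def presented_group_def intro: quotientI)

lemma cl_exists: "\<alpha> \<in> carrier G \<Longrightarrow> \<exists>w \<in> words {1..n}. \<alpha> = cl w"
  by (auto simp: cl_def braid_group_def presented_group_def elim!: quotientE)

lemma cl_append: "u \<in> words {1..n} \<Longrightarrow> v \<in> words {1..n} \<Longrightarrow> cl (u @ v) = cl u \<otimes>\<^bsub>G\<^esub> cl v"
  by (simp add: cl_def braid_group_def presented_group_mult)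

lemma cl_Nil: "cl [] = \<one>\<^bsub>G\<^esub>"
  by (simp add: cl_def braid_group_def presented_group_def)

lemma cl_eq_iff: "u \<in> words {1..n} \<Longrightarrow> v \<in> words {1..n} \<Longrightarrow>
    cl u = cl v \<longleftrightarrow> (u, v) \<in> pres_rel {1..n} (braid_relations n)"
  unfolding cl_def by (rule eq_equiv_class_iff[OF equiv_pres_rel])

lemma cl_gen: "cl [(i, True)] = braid_gen n i"
  by (simp add: cl_def braid_gen_def)

lemma cl_inverse:
  assumes "i \<in> {1..n}"
  shows "cl [(i, False)] = inv\<^bsub>G\<^esub> (cl [(i, True)])"
proof -
  have "([(i, False)] @ [(i, True)], []) \<in> pres_rel {1..n} (braid_relations n)"
    using pres_rel.cancel[of "[]" "{1..n}" "[]" i False] assms by simp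
  then have "cl [(i, False)] \<otimes>\<^bsub>G\<^esub> cl [(i, True)] = \<one>\<^bsub>G\<^esub>"
    using assms by (simp add: cl_Nil[symmetric] cl_eq_iff flip: cl_append)
  then show ?thesis using assms by (intro inv_equality[symmetric]) auto
qed

lemma ev_pb: "set w \<subseteq> {1..int n} \<Longrightarrow> ev (pb w) = cl (pos_word w)"
proof -
  assume w: "set w \<subseteq> {1..int n}"
  define v where "v = (SOME v. pb w = pb v)"
  have "pb w = pb v" unfolding v_def by (rule someI_ex) auto
  then have *: "peq w v" by (simp add: pb_eq_iff)
  then have "set v \<subseteq> {1..int n}" using w peq_set by blast
  then have "cl (pos_word w) = cl (pos_word v)"
    using peq_pos_word[OF * w] w by (simp add: cl_eq_iff pos_word_words)
  then show ?thesis by (simp add: ev_def v_def)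
qed

lemma pos_pb: "x \<in> pos \<Longrightarrow> \<exists>w. x = pb w \<and> set w \<subseteq> {1..int n}"
  by (metis mem_Collect_eq pb_cases supp_simps(4))

lemma ev_closed [simp]: "x \<in> pos \<Longrightarrow> ev x \<in> carrier G"
  using pos_pb[of x] by (auto simp: ev_pb pos_word_words)

lemma ev_mult: "x \<in> pos \<Longrightarrow> y \<in> pos \<Longrightarrow> ev (x * y) = ev x \<otimes>\<^bsub>G\<^esub> ev y"
proof -
  assume "x \<in> pos" "y \<in> pos"
  then obtain u v where "x = pb u" "set u \<subseteq> {1..int n}" "y = pb v" "set v \<subseteq> {1..int n}"
    using pos_pb by metis
  then show ?thesis using ev_pb[of "u @ v"] by (simp add: ev_pb cl_append pos_word_words)
qed

lemma ev_one [simp]: "ev 1 = \<one>\<^bsub>G\<^esub>"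
  using ev_pb[of "[]"] by (simp add: cl_Nil)

lemma ev_gen: "i \<in> {1..n} \<Longrightarrow> ev (gen (int i)) = braid_gen n i"
  using ev_pb[of "[int i]"] by (simp add: pb_single cl_gen)

lemma ev_inject: "x \<in> pos \<Longrightarrow> y \<in> pos \<Longrightarrow> ev x = ev y \<longleftrightarrow> x = y"
proof
  assume *: "x \<in> pos" "y \<in> pos" "ev x = ev y"
  then obtain u v where uv: "x = pb u" "set u \<subseteq> {1..int n}" "y = pb v" "set v \<subseteq> {1..int n}"
    using pos_pb by metis
  then have "(pos_word u, pos_word v) \<in> pres_rel {1..n} (braid_relations n)"
    using * by (simp add: ev_pb cl_eq_iff pos_word_words)
  from numer_pres_rel[OF this] show "x = y"
    using uv by (simp add: numer_pos_word denom_pos_word)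
qed simp

lemma T_pos: "T \<in> pos" "T ^ k \<in> pos"
  using supp_twist[of n] by (auto simp: supp_power)

lemma ev_power: "x \<in> pos \<Longrightarrow> ev (x ^ k) = ev x [^]\<^bsub>G\<^esub> k"
proof (induction k)
  case (Suc k)
  have "x ^ k \<in> pos" using Suc.prems by (auto simp: supp_power)
  from ev_mult[OF this Suc.prems] show ?case using Suc by (simp add: power_Suc2 del: power_Suc)
qed simp

lemma cl_numer:
  "w \<in> words {1..n} \<Longrightarrow> cl w \<otimes>\<^bsub>G\<^esub> ev (T ^ denom w) = ev (numer n w)"
proof (induction w)
  case Nil
  then show ?case by (simp add: cl_Nil)
next
  case (Cons x w)
  obtain i b where x: "x = (i, b)" by fastforce
  have w: "w \<in> words {1..n}" "i \<in> {1..n}" using Cons.prems x by auto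
  have num: "numer n w \<in> pos" using supp_numer[OF w(1)] by simp
  have c: "cl (x # w) = cl [x] \<otimes>\<^bsub>G\<^esub> cl w" using cl_append[of "[x]" w] Cons.prems w x by simp
  have gi: "gen (int i) \<in> pos" using w by auto
  show ?case
  proof (cases b)
    case True
    have "cl (x # w) \<otimes>\<^bsub>G\<^esub> ev (T ^ denom w) = cl [x] \<otimes>\<^bsub>G\<^esub> ev (numer n w)"
      unfolding c Cons.IH[OF w(1), symmetric] using w x T_pos by (simp add: m_assoc)
    also have "\<dots> = ev (gen (int i) * numer n w)"
      using ev_mult[OF gi num] ev_gen[OF w(2)] x True by (simp add: cl_gen)
    finally show ?thesis using x True by simp
  next
    case False
    have y: "twist_quotient n i \<in> pos" using twist_quotient(1)[OF w(2)] by simp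
    have "ev (gen i) \<otimes>\<^bsub>G\<^esub> ev (twist_quotient n i) = ev T"
      using twist_quotient(2)[OF w(2)] ev_mult[OF gi y] by simp
    moreover have "cl [x] = inv\<^bsub>G\<^esub> ev (gen i)"
      using x False cl_inverse[OF w(2)] ev_gen[OF w(2)] by (simp add: cl_gen)
    ultimately have "ev (twist_quotient n i) = cl [x] \<otimes>\<^bsub>G\<^esub> ev T"
      using inv_solve_left[of "ev (twist_quotient n i)" "ev (gen i)" "ev T"] gi y T_pos(1) by simp
    then have "ev (twist_quotient n i * numer n w) = cl [x] \<otimes>\<^bsub>G\<^esub> ev T \<otimes>\<^bsub>G\<^esub> (cl w \<otimes>\<^bsub>G\<^esub> ev (T ^ denom w))"
      using ev_mult[OF y num] Cons.IH[OF w(1)] by simp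
    also have "\<dots> = cl [x] \<otimes>\<^bsub>G\<^esub> (ev T \<otimes>\<^bsub>G\<^esub> ev (numer n w))"
      using w x T_pos(1) num Cons.IH[OF w(1)] by (simp add: m_assoc)
    finally have e1: "ev (twist_quotient n i * numer n w) = cl [x] \<otimes>\<^bsub>G\<^esub> (ev T \<otimes>\<^bsub>G\<^esub> ev (numer n w))" .
    have "ev T \<otimes>\<^bsub>G\<^esub> ev (numer n w) = ev (numer n w) \<otimes>\<^bsub>G\<^esub> ev T"
      using twist_central[OF supp_numer[OF w(1)]] ev_mult[OF T_pos(1) num] ev_mult[OF num T_pos(1)] by simp
    also have "\<dots> = cl w \<otimes>\<^bsub>G\<^esub> ev (T ^ Suc (denom w))"
      unfolding Cons.IH[OF w(1), symmetric] power_Suc2 using w T_pos by (simp add: ev_mult m_assoc)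
    finally have e2: "ev T \<otimes>\<^bsub>G\<^esub> ev (numer n w) = cl w \<otimes>\<^bsub>G\<^esub> ev (T ^ Suc (denom w))" .
    have e3: "cl [x] \<otimes>\<^bsub>G\<^esub> (cl w \<otimes>\<^bsub>G\<^esub> ev (T ^ Suc (denom w))) = cl (x # w) \<otimes>\<^bsub>G\<^esub> ev (T ^ Suc (denom w))"
      unfolding c using w x T_pos(2)[of "Suc (denom w)"] by (simp add: m_assoc del: power_Suc)
    have "cl (x # w) \<otimes>\<^bsub>G\<^esub> ev (T ^ Suc (denom w)) = ev (twist_quotient n i * numer n w)"
      unfolding e1 e2 by (rule e3[symmetric])
    moreover have "numer n (x # w) = twist_quotient n i * numer n w" "denom (x # w) = Suc (denom w)"
      using x False by simp_all
    ultimately show ?thesis by metis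
  qed
qed

lemma carrier_fraction:
  assumes "\<alpha> \<in> carrier G"
  obtains x k where "x \<in> pos" "\<alpha> \<otimes>\<^bsub>G\<^esub> ev (T ^ k) = ev x"
  using cl_exists[OF assms] cl_numer supp_numer that by blast

definition sub :: "int set \<Rightarrow> pbraid set" where "sub A = {x. supp x \<subseteq> A}"

lemma generate_submonoid_eq:
  assumes "A \<subseteq> {1..n}"
  shows "generate_submonoid G (braid_gen n ` A) = ev ` sub (int ` A)"
proof (rule antisym)
  have A: "int ` A \<subseteq> {1..int n}" using assms by auto
  then have pos: "x \<in> pos" if "x \<in> sub (int ` A)" for x using that by (auto simp: sub_def)
  have "submonoid (ev ` sub (int ` A)) G"
  proof
    show "ev ` sub (int ` A) \<subseteq> carrier G" using pos by auto
    show "\<one>\<^bsub>G\<^esub> \<in> ev ` sub (int ` A)" by (rule image_eqI[of _ _ 1]) (simp_all add: sub_def)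
  next
    fix a b assume "a \<in> ev ` sub (int ` A)" "b \<in> ev ` sub (int ` A)"
    then obtain x y where "a = ev x" "b = ev y" "x \<in> sub (int ` A)" "y \<in> sub (int ` A)" by blast
    then show "a \<otimes>\<^bsub>G\<^esub> b \<in> ev ` sub (int ` A)"
      using ev_mult[of x y] pos by (intro image_eqI[of _ _ "x * y"]) (auto simp: sub_def)
  qed
  moreover have "braid_gen n ` A \<subseteq> ev ` sub (int ` A)"
  proof
    fix g assume "g \<in> braid_gen n ` A"
    then obtain i where "i \<in> A" "g = braid_gen n i" by blast
    then show "g \<in> ev ` sub (int ` A)"
      using ev_gen[of i] assms by (intro image_eqI[of _ _ "gen (int i)"]) (auto simp: sub_def)
  qed
  ultimately show "generate_submonoid G (braid_gen n ` A) \<subseteq> ev ` sub (int ` A)"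
    unfolding generate_submonoid_def hull_def by blast
  have "ev x \<in> K" if K: "submonoid K G" "braid_gen n ` A \<subseteq> K" and x: "supp x \<subseteq> int ` A" for x K
    using x
  proof (induction x rule: pb_induct)
    case one
    then show ?case using submonoid.one_closed[OF K(1)] by simp
  next
    case (gen_mult i x)
    then obtain j where j: "i = int j" "j \<in> A" by auto
    have "ev (gen i * x) = ev (gen i) \<otimes>\<^bsub>G\<^esub> ev x"
      using gen_mult.prems A by (intro ev_mult) auto
    also have "ev (gen i) = braid_gen n j" using j assms ev_gen[of j] by auto
    finally show ?case
      using submonoid.m_closed[OF K(1), of "braid_gen n j" "ev x"] K(2) j gen_mult by auto
  qed
  then show "ev ` sub (int ` A) \<subseteq> generate_submonoid G (braid_gen n ` A)"
    unfolding generate_submonoid_def hull_def sub_def by blast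
qed

abbreviation M where "M \<equiv> ev ` pos"

lemma le_R_iff: "x \<in> pos \<Longrightarrow> y \<in> pos \<Longrightarrow> le_R G M (ev x) (ev y) \<longleftrightarrow> rdvd x y"
proof
  assume xy: "x \<in> pos" "y \<in> pos"
  { assume "le_R G M (ev x) (ev y)"
    then obtain w where w: "w \<in> pos" "ev y \<otimes>\<^bsub>G\<^esub> inv\<^bsub>G\<^esub> ev x = ev w" by (auto simp: le_R_def)
    then have "ev y = ev w \<otimes>\<^bsub>G\<^esub> ev x" using xy by (metis ev_closed inv_solve_right')
    then have "ev y = ev (w * x)" using w xy by (simp add: ev_mult)
    moreover have "w * x \<in> pos" using w(1) xy by simp
    ultimately have "y = w * x" using ev_inject[OF xy(2)] by blast
    then show "rdvd x y" by blast }
  { assume "rdvd x y"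
    then obtain w where w: "y = w * x" by (auto simp: rdvd_def)
    then have "w \<in> pos" using xy by auto
    then have "ev y \<otimes>\<^bsub>G\<^esub> inv\<^bsub>G\<^esub> ev x = ev w" using w xy by (simp add: ev_mult m_assoc)
    then show "le_R G M (ev x) (ev y)" using \<open>w \<in> pos\<close> by (auto simp: le_R_def) }
qed

text \<open>By \<open>rdvd_tail\<close>, x * t and t have the same right divisors in the submonoid.
  The greatest element of this set is t, and antisymmetry of divisibility makes it unique.\<close>

lemma tail_eq:
  assumes "x * t \<in> pos" "supp t \<subseteq> A" "A \<subseteq> {1..int n}" "\<And>i. i \<in> A \<Longrightarrow> \<not> rdvd (gen i) x"
  shows "tail G M (ev ` sub A) (ev (x * t)) = ev t"
proof -
  have pos: "y \<in> pos" if "y \<in> sub A" for y using that assms(3) by (auto simp: sub_def)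
  have t: "t \<in> sub A" using assms(2) by (simp add: sub_def)
  have div: "{c \<in> ev ` sub A. le_R G M c (ev z)} = ev ` {c \<in> sub A. rdvd c z}" if "z \<in> pos" for z
    using le_R_iff pos that by blast
  have xt: "{c \<in> sub A. rdvd c (x * t)} = {c \<in> sub A. rdvd c t}"
    using rdvd_tail[of A x t, OF assms(4) assms(2)] rdvd_mult by (auto simp: sub_def)
  show ?thesis
    unfolding tail_def
  proof (rule the_equality)
    show "ev t \<in> ev ` sub A \<and> {c \<in> ev ` sub A. le_R G M c (ev (x * t))} = {c \<in> ev ` sub A. le_R G M c (ev t)}"
      using div[OF assms(1)] div[OF pos[OF t]] xt t by simp
  next
    fix b assume b: "b \<in> ev ` sub A \<and> {c \<in> ev ` sub A. le_R G M c (ev (x * t))} = {c \<in> ev ` sub A. le_R G M c b}"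
    then obtain z where z: "b = ev z" "z \<in> sub A" by blast
    have "ev ` {c \<in> sub A. rdvd c t} = ev ` {c \<in> sub A. rdvd c z}"
      using b div[OF assms(1)] div[OF pos[OF z(2)]] xt z(1) by simp
    moreover have "inj_on ev pos" by (auto simp: inj_on_def ev_inject)
    moreover have "{c \<in> sub A. rdvd c t} \<subseteq> pos" "{c \<in> sub A. rdvd c z} \<subseteq> pos" using pos by auto
    ultimately have eq: "{c \<in> sub A. rdvd c t} = {c \<in> sub A. rdvd c z}"
      by (simp add: inj_on_image_eq_iff)
    have "t \<in> {c \<in> sub A. rdvd c t}" "z \<in> {c \<in> sub A. rdvd c z}"
      using t z(2) rdvd_refl by simp_all
    then have "rdvd t z" "rdvd z t" using eq by blast+
    then show "b = ev t" using rdvd_antisym z by blast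
  qed
qed

end

section \<open>The order defined by positivity in the first generator\<close>

context braid
begin

definition G1 :: "nat word set set" where "G1 = generate G (braid_gen n ` {2..n})"

abbreviation s1_positive :: "nat word set \<Rightarrow> bool" where
  "s1_positive \<equiv> gen_positive G (braid_gen n 1) G1"

definition s1_nonneg :: "nat word set \<Rightarrow> bool" where
  "s1_nonneg \<alpha> \<longleftrightarrow> \<alpha> \<in> G1 \<or> s1_positive \<alpha>"

lemma gen_closed: "i \<in> {1..n} \<Longrightarrow> braid_gen n i \<in> carrier G"
  by (rule braid_gen_closed)

lemma s1_closed [simp]: "braid_gen n 1 \<in> carrier G"
  using n by (intro gen_closed) auto

lemma subgroup_G1: "subgroup G1 G"
  unfolding G1_def by (rule generate_is_subgroup) (auto intro!: gen_closed)

lemma G1_carrier [simp]: "a \<in> G1 \<Longrightarrow> a \<in> carrier G"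
  using subgroup.mem_carrier[OF subgroup_G1] .

lemma G1_one: "\<one>\<^bsub>G\<^esub> \<in> G1"
  and G1_mult: "a \<in> G1 \<Longrightarrow> b \<in> G1 \<Longrightarrow> a \<otimes>\<^bsub>G\<^esub> b \<in> G1"
  and G1_inv: "a \<in> G1 \<Longrightarrow> inv\<^bsub>G\<^esub> a \<in> G1"
  using subgroup.one_closed[OF subgroup_G1] subgroup.m_closed[OF subgroup_G1]
    subgroup.m_inv_closed[OF subgroup_G1] by auto

lemma words_mono: "S \<subseteq> S' \<Longrightarrow> w \<in> words S \<Longrightarrow> w \<in> words S'"
  by (induction w) auto

lemma G1_word: "a \<in> G1 \<Longrightarrow> \<exists>w \<in> words {2..n}. a = cl w"
  unfolding G1_def
proof (induction rule: generate.induct)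
  case one
  then show ?case by (intro bexI[of _ "[]"]) (simp_all add: cl_Nil)
next
  case (incl h)
  then obtain i where "i \<in> {2..n}" "h = braid_gen n i" by blast
  then show ?case by (intro bexI[of _ "[(i, True)]"]) (simp_all add: cl_gen)
next
  case (inv h)
  then obtain i where "i \<in> {2..n}" "h = braid_gen n i" by blast
  then show ?case using cl_inverse[of i] by (intro bexI[of _ "[(i, False)]"]) (simp_all add: cl_gen)
next
  case (eng h1 h2)
  then obtain u v where "u \<in> words {2..n}" "h1 = cl u" "v \<in> words {2..n}" "h2 = cl v" by blast
  then show ?case
    using cl_append[of u v] words_mono[of "{2..n}" "{1..n}"] by (intro bexI[of _ "u @ v"]) auto
qed

lemma ev_G1: "supp x \<subseteq> {2..int n} \<Longrightarrow> ev x \<in> G1"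
proof (induction x rule: pb_induct)
  case one
  then show ?case by (simp add: G1_one)
next
  case (gen_mult i x)
  define j where "j = nat i"
  have j: "i = int j" "j \<in> {2..n}" using gen_mult.prems by (auto simp: j_def)
  have "ev (gen i) \<in> G1"
    using ev_gen[of j] j by (auto simp: G1_def intro!: generate.incl)
  moreover have "gen i \<in> pos" "x \<in> pos" "ev x \<in> G1" using gen_mult by force+
  ultimately show ?case by (simp add: ev_mult G1_mult)
qed

lemma list_prod_simps [simp]:
  "list_prod G [] = \<one>\<^bsub>G\<^esub>" "list_prod G (a # as) = a \<otimes>\<^bsub>G\<^esub> list_prod G as"
  by (simp_all add: list_prod_def)

lemma list_prod_closed: "set as \<subseteq> carrier G \<Longrightarrow> list_prod G as \<in> carrier G"
  by (induction as) auto

lemma list_prod_append: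
  "set as \<subseteq> carrier G \<Longrightarrow> set bs \<subseteq> carrier G \<Longrightarrow>
    list_prod G (as @ bs) = list_prod G as \<otimes>\<^bsub>G\<^esub> list_prod G bs"
  by (induction as) (auto simp: list_prod_closed m_assoc)

abbreviation s1_prod :: "nat word set list \<Rightarrow> nat word set" where
  "s1_prod as \<equiv> list_prod G (map (\<lambda>a. braid_gen n 1 \<otimes>\<^bsub>G\<^esub> a) as)"

lemma s1_prod_closed: "set as \<subseteq> G1 \<Longrightarrow> s1_prod as \<in> carrier G"
  by (intro list_prod_closed) (use G1_carrier in auto)

lemma s1_prod_append: "set as \<subseteq> G1 \<Longrightarrow> set bs \<subseteq> G1 \<Longrightarrow> s1_prod (as @ bs) = s1_prod as \<otimes>\<^bsub>G\<^esub> s1_prod bs"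
  unfolding map_append by (intro list_prod_append) (use G1_carrier in auto)

lemma s1_positiveI: "a0 \<in> G1 \<Longrightarrow> set as \<subseteq> G1 \<Longrightarrow> as \<noteq> [] \<Longrightarrow> s1_positive (a0 \<otimes>\<^bsub>G\<^esub> s1_prod as)"
  unfolding gen_positive_def by blast

lemma s1_positiveE:
  assumes "s1_positive \<alpha>"
  obtains a0 as where "a0 \<in> G1" "set as \<subseteq> G1" "as \<noteq> []" "\<alpha> = a0 \<otimes>\<^bsub>G\<^esub> s1_prod as"
  using assms unfolding gen_positive_def by blast

lemma s1_positive_closed: "s1_positive \<alpha> \<Longrightarrow> \<alpha> \<in> carrier G"
  by (elim s1_positiveE) (simp add: s1_prod_closed)

lemma s1_positive_left: "g \<in> G1 \<Longrightarrow> s1_positive \<alpha> \<Longrightarrow> s1_positive (g \<otimes>\<^bsub>G\<^esub> \<alpha>)"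
proof (elim s1_positiveE)
  fix a0 as assume "g \<in> G1" "a0 \<in> G1" "set as \<subseteq> G1" "as \<noteq> []" "\<alpha> = a0 \<otimes>\<^bsub>G\<^esub> s1_prod as"
  then show "s1_positive (g \<otimes>\<^bsub>G\<^esub> \<alpha>)"
    using s1_positiveI[of "g \<otimes>\<^bsub>G\<^esub> a0" as] by (simp add: G1_mult m_assoc s1_prod_closed)
qed

lemma s1_positive_right: "s1_positive \<alpha> \<Longrightarrow> g \<in> G1 \<Longrightarrow> s1_positive (\<alpha> \<otimes>\<^bsub>G\<^esub> g)"
proof (elim s1_positiveE)
  fix a0 as assume *: "g \<in> G1" "a0 \<in> G1" "set as \<subseteq> G1" "as \<noteq> []" "\<alpha> = a0 \<otimes>\<^bsub>G\<^esub> s1_prod as"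
  then obtain bs b where as: "as = bs @ [b]" by (cases as rule: rev_cases) auto
  then have b: "b \<in> G1" "set bs \<subseteq> G1" using * by auto
  have e: "s1_prod (bs @ [c]) = s1_prod bs \<otimes>\<^bsub>G\<^esub> (braid_gen n 1 \<otimes>\<^bsub>G\<^esub> c)" if "c \<in> G1" for c
    using s1_prod_append[of bs "[c]"] that b(2) by simp
  have "\<alpha> \<otimes>\<^bsub>G\<^esub> g = a0 \<otimes>\<^bsub>G\<^esub> s1_prod (bs @ [b \<otimes>\<^bsub>G\<^esub> g])"
    using * b unfolding as by (simp only: e G1_mult) (simp add: m_assoc s1_prod_closed)
  then show "s1_positive (\<alpha> \<otimes>\<^bsub>G\<^esub> g)"
    using s1_positiveI[of a0 "bs @ [b \<otimes>\<^bsub>G\<^esub> g]"] * b by (simp add: G1_mult)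
qed

lemma s1_positive_mult: "s1_positive \<alpha> \<Longrightarrow> s1_positive \<beta> \<Longrightarrow> s1_positive (\<alpha> \<otimes>\<^bsub>G\<^esub> \<beta>)"
proof -
  assume a: "s1_positive \<alpha>" and b: "s1_positive \<beta>"
  obtain b0 bs where bs: "b0 \<in> G1" "set bs \<subseteq> G1" "bs \<noteq> []" "\<beta> = b0 \<otimes>\<^bsub>G\<^esub> s1_prod bs"
    using b by (rule s1_positiveE)
  obtain a0 as where as: "a0 \<in> G1" "set as \<subseteq> G1" "as \<noteq> []" "\<alpha> \<otimes>\<^bsub>G\<^esub> b0 = a0 \<otimes>\<^bsub>G\<^esub> s1_prod as"
    using s1_positive_right[OF a bs(1)] by (rule s1_positiveE)
  have "\<alpha> \<otimes>\<^bsub>G\<^esub> \<beta> = (\<alpha> \<otimes>\<^bsub>G\<^esub> b0) \<otimes>\<^bsub>G\<^esub> s1_prod bs"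
    using bs s1_positive_closed[OF a] by (simp add: m_assoc s1_prod_closed)
  also have "\<dots> = a0 \<otimes>\<^bsub>G\<^esub> s1_prod (as @ bs)"
    unfolding as(4) using as bs by (simp add: m_assoc s1_prod_closed s1_prod_append del: map_append)
  finally show ?thesis using s1_positiveI[of a0 "as @ bs"] as bs by simp
qed

lemma s1_positive_gen: "s1_positive (braid_gen n 1)"
  using s1_positiveI[of "\<one>\<^bsub>G\<^esub>" "[\<one>\<^bsub>G\<^esub>]"] by (simp add: G1_one)

lemma s1_nonneg_mult: "s1_nonneg \<alpha> \<Longrightarrow> s1_nonneg \<beta> \<Longrightarrow> s1_nonneg (\<alpha> \<otimes>\<^bsub>G\<^esub> \<beta>)"
  by (auto simp: s1_nonneg_def G1_mult s1_positive_mult s1_positive_left s1_positive_right)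

lemma s1_nonneg_positive_mult: "s1_nonneg \<alpha> \<Longrightarrow> s1_positive \<beta> \<Longrightarrow> s1_positive (\<alpha> \<otimes>\<^bsub>G\<^esub> \<beta>)"
  and s1_positive_nonneg_mult: "s1_positive \<alpha> \<Longrightarrow> s1_nonneg \<beta> \<Longrightarrow> s1_positive (\<alpha> \<otimes>\<^bsub>G\<^esub> \<beta>)"
  by (auto simp: s1_nonneg_def G1_mult s1_positive_mult s1_positive_left s1_positive_right)

text \<open>Factors in G_1 keep the first coordinate and each s_1 raises it. The claim is made for
  all positive states at once because every factor acts on the state produced by its
  predecessors.\<close>

lemma s1_prod_increases:
  "set as \<subseteq> G1 \<Longrightarrow> as \<noteq> [] \<Longrightarrow> \<exists>w \<in> words {1..n}. s1_prod as = cl w \<and>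
    (\<forall>f. dyn_positive f \<longrightarrow> fst (f 1) < fst (dyn_act w f 1))"
proof (induction as)
  case (Cons a as)
  obtain u where u: "u \<in> words {2..n}" "a = cl u" using G1_word Cons.prems by fastforce
  have uw: "u \<in> words {1..n}" "(1, True) # u \<in> words {1..n}"
    using words_mono[of "{2..n}" "{1..n}"] u(1) n by auto
  have c: "braid_gen n 1 \<otimes>\<^bsub>G\<^esub> a = cl ((1, True) # u)"
    using cl_append[of "[(1, True)]" u] uw u(2) by (simp add: cl_gen)
  have inc: "fst (f 1) < fst (dyn_act ((1, True) # u) f 1)" if "dyn_positive f" for f
    using dyn_gen_increases[OF that] dyn_act_fix[OF u(1)] by simp
  show ?case
  proof (cases "as = []")
    case True
    then show ?thesis using c inc uw cl_closed[OF uw(2)] by (intro bexI[of _ "(1, True) # u"]) simp_all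
  next
    case False
    then obtain w where w: "w \<in> words {1..n}" "s1_prod as = cl w"
        "\<And>f. dyn_positive f \<Longrightarrow> fst (f 1) < fst (dyn_act w f 1)"
      using Cons by auto
    have "s1_prod (a # as) = cl (((1, True) # u) @ w)"
      using c w(1,2) uw by (simp only: cl_append list.map list_prod_simps)
    moreover have "fst (f 1) < fst (dyn_act (((1, True) # u) @ w) f 1)" if "dyn_positive f" for f
      using inc[OF that] w(3)[OF dyn_act_positive[OF that]] order.strict_trans
      by (metis dyn_act_simps(4))
    ultimately show ?thesis using w(1) uw by (intro bexI[of _ "((1, True) # u) @ w"]) auto
  qed
qed simp

theorem not_s1_positive_one: "\<not> s1_positive \<one>\<^bsub>G\<^esub>"
proof
  assume "s1_positive \<one>\<^bsub>G\<^esub>"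
  then obtain a0 as where as: "a0 \<in> G1" "set as \<subseteq> G1" "as \<noteq> []" "\<one>\<^bsub>G\<^esub> = a0 \<otimes>\<^bsub>G\<^esub> s1_prod as"
    by (rule s1_positiveE)
  obtain u where u: "u \<in> words {2..n}" "a0 = cl u" using G1_word as(1) by blast
  obtain w where w: "w \<in> words {1..n}" "s1_prod as = cl w"
      "\<And>f. dyn_positive f \<Longrightarrow> fst (f 1) < fst (dyn_act w f 1)"
    using s1_prod_increases[OF as(2,3)] by blast
  have uw: "u \<in> words {1..n}" using words_mono[of "{2..n}" "{1..n}"] u(1) by auto
  have "cl [] = cl (u @ w)" using as(4) u(2) w(1,2) uw by (simp add: cl_Nil cl_append)
  then have r: "([], u @ w) \<in> pres_rel {1..n} (braid_relations n)"
    using cl_eq_iff[of "[]" "u @ w"] uw w(1) by simp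
  define f :: dyn_state where "f = (\<lambda>_. (1, 1))"
  have f: "dyn_positive f" by (simp add: f_def dyn_positive_def)
  have "f = dyn_act w (dyn_act u f)" using dyn_act_pres_rel[OF r f] by simp
  moreover have "fst (dyn_act u f 1) < fst (dyn_act w (dyn_act u f) 1)"
    using w(3) dyn_act_positive[OF f] by blast
  moreover have "dyn_act u f 1 = f 1" by (rule dyn_act_fix[OF u(1)])
  ultimately show False by simp
qed

lemma not_s1_positive_inverse:
  assumes "s1_positive \<alpha>" "s1_nonneg (inv\<^bsub>G\<^esub> \<alpha>)" shows False
  using s1_positive_nonneg_mult[OF assms] not_s1_positive_one s1_positive_closed[OF assms(1)] by simp

lemma ev_nonneg: "x \<in> pos \<Longrightarrow> s1_nonneg (ev x)"
proof (induction x rule: pb_induct)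
  case one
  then show ?case by (simp add: s1_nonneg_def G1_one)
next
  case (gen_mult i x)
  have i: "i \<in> {1..int n}" "x \<in> pos" using gen_mult.prems by auto
  have "s1_nonneg (ev (gen i))"
  proof (cases "i = 1")
    case True
    then show ?thesis using ev_gen[of 1] n s1_positive_gen by (simp add: s1_nonneg_def)
  next
    case False
    then show ?thesis using i ev_G1[of "gen i"] by (simp add: s1_nonneg_def)
  qed
  then show ?case
    using gen_mult.IH[OF i(2)] ev_mult[of "gen i" x] i by (simp add: s1_nonneg_mult)
qed

lemma ev_T_positive: "1 \<le> k \<Longrightarrow> s1_positive (ev (T ^ k))"
proof -
  assume "1 \<le> k"
  then obtain j where k: "k = Suc j" by (cases k) auto
  obtain y where y: "supp y \<subseteq> {1..int n}" "T = gen 1 * y" using twist_factor[of 1 "int n"] n by auto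
  have p: "gen 1 \<in> pos" "y * T ^ j \<in> pos" using y(1) T_pos(2)[of j] n by auto
  have "ev (T ^ k) = braid_gen n 1 \<otimes>\<^bsub>G\<^esub> ev (y * T ^ j)"
    using ev_mult[OF p] ev_gen[of 1] n y(2) k by (simp add: mult.assoc)
  then show ?thesis using s1_positive_nonneg_mult[OF s1_positive_gen ev_nonneg[OF p(2)]] by simp
qed

text \<open>The order of the points x p_0, expressed on positive braids. Membership in
  \<open>pos\<close> is built in, so a comparison already supplies the support conditions needed to
  evaluate it.\<close>

definition le :: "pbraid \<Rightarrow> pbraid \<Rightarrow> bool" where
  "le x y \<longleftrightarrow> x \<in> pos \<and> y \<in> pos \<and> s1_nonneg (inv\<^bsub>G\<^esub> (ev x) \<otimes>\<^bsub>G\<^esub> ev y)"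

lemma le_mult_iff:
  assumes "w \<in> pos" shows "le (w * x) (w * y) \<longleftrightarrow> le x y"
proof -
  have "inv\<^bsub>G\<^esub> (ev (w * x)) \<otimes>\<^bsub>G\<^esub> ev (w * y) = inv\<^bsub>G\<^esub> (ev x) \<otimes>\<^bsub>G\<^esub> ev y" if "x \<in> pos" "y \<in> pos"
  proof -
    have "inv\<^bsub>G\<^esub> (ev (w * x)) \<otimes>\<^bsub>G\<^esub> ev (w * y) =
        inv\<^bsub>G\<^esub> (ev x) \<otimes>\<^bsub>G\<^esub> (inv\<^bsub>G\<^esub> (ev w) \<otimes>\<^bsub>G\<^esub> (ev w \<otimes>\<^bsub>G\<^esub> ev y))"
      using that assms by (simp add: ev_mult inv_mult_group m_assoc)
    then show ?thesis using that assms by (simp flip: m_assoc)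
  qed
  then show ?thesis using assms by (auto simp: le_def)
qed

sublocale order: star_order "int n" le
proof
  show "le x x" if "supp x \<subseteq> {1..int n}" for x
    using that by (simp add: le_def s1_nonneg_def G1_one)
  show "le x z" if "le x y" "le y z" for x y z
  proof -
    have p: "x \<in> pos" "y \<in> pos" "z \<in> pos" using that by (auto simp: le_def)
    then have "inv\<^bsub>G\<^esub> (ev x) \<otimes>\<^bsub>G\<^esub> ev y \<otimes>\<^bsub>G\<^esub> (inv\<^bsub>G\<^esub> (ev y) \<otimes>\<^bsub>G\<^esub> ev z) =
        inv\<^bsub>G\<^esub> (ev x) \<otimes>\<^bsub>G\<^esub> (ev y \<otimes>\<^bsub>G\<^esub> inv\<^bsub>G\<^esub> (ev y) \<otimes>\<^bsub>G\<^esub> ev z)"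
      by (simp only: m_assoc inv_closed m_closed ev_closed)
    also have "\<dots> = inv\<^bsub>G\<^esub> (ev x) \<otimes>\<^bsub>G\<^esub> ev z" using p by simp
    finally show ?thesis using that s1_nonneg_mult p unfolding le_def by metis
  qed
  show "le (w * x) (w * y)" if "supp w \<subseteq> {1..int n}" "le x y" for w x y
    using that le_mult_iff by simp
  show "le 1 g \<and> le g 1" if "supp g \<subseteq> {2..int n}" for g
  proof -
    have "g \<in> pos" using that by auto
    then show ?thesis using ev_G1[OF that] G1_inv[OF ev_G1[OF that]] by (simp add: le_def s1_nonneg_def)
  qed
  show "le 1 (gen 1)"
    using n ev_gen[of 1] s1_positive_gen by (simp add: le_def s1_nonneg_def)
qed

text \<open>The order is invariant on the left; for powers of T this carries over to the right
  because T is central.\<close>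

lemma le_T_iff: "le (x * T ^ k) (y * T ^ k) \<longleftrightarrow> le x y"
proof (cases "x \<in> pos \<and> y \<in> pos")
  case True
  then have "x * T ^ k = T ^ k * x" "y * T ^ k = T ^ k * y" by (simp_all add: twist_power_central)
  then show ?thesis using le_mult_iff[OF T_pos(2)] by simp
qed (auto simp: le_def)

end

section \<open>Alternating sequences of blocks\<close>

context braid
begin

definition c :: pbraid where "c = dn (int n) 1"

definition pt :: "nat \<Rightarrow> pbraid" where
  "pt i = (if even i then 1 else c) * T ^ (i div 2)"

text \<open>Reflecting indices for odd i puts both kinds of points into one normal form, in which
  the letters 2, \<dots>, n fix the point and the letter 1 does not lower it.\<close>

definition fl :: "nat \<Rightarrow> pbraid \<Rightarrow> pbraid" where
  "fl i x = (if even i then x else flip (int n + 1) x)"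

definition lt :: "nat \<Rightarrow> int set" where
  "lt j = (if even j then {2..int n} else {1..int n - 1})"

lemma flip_pos: "supp (flip (int n + 1) x) \<subseteq> {1..int n} \<longleftrightarrow> supp x \<subseteq> {1..int n}"
  by (auto simp: subset_iff)

lemma fl_simps [simp]:
  "fl i 1 = 1" "fl i (x * y) = fl i x * fl i y" "fl i (fl i x) = x"
  "supp (fl i x) \<subseteq> {1..int n} \<longleftrightarrow> supp x \<subseteq> {1..int n}"
  by (simp_all add: fl_def flip_pos del: flip_simps(4))

lemma fl_Suc: "fl (Suc i) x = fl i (flip (int n + 1) x)" "fl (Suc i) x = flip (int n + 1) (fl i x)"
  by (simp_all add: fl_def)

lemma fl_eq_1_iff [simp]: "fl i x = 1 \<longleftrightarrow> x = 1"
  by (metis fl_simps(1,3))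

lemma c_pos: "c \<in> pos" and pt_pos: "pt i \<in> pos"
  using T_pos(2)[of "i div 2"] by (auto simp: c_def pt_def)

lemma star_order_even: "star_order (int n) (\<lambda>x y. le (x * T ^ k) (y * T ^ k))"
  using order.star_order_axioms by (simp add: le_T_iff)

text \<open>The letters 1, \<dots>, n - 1 cross c to the right as 2, \<dots>, n and fix the base
  point. That gen n does not lower c is the case r = n + 1 of \<open>le_mono_gen\<close>, in which
  the ascending factor is empty.\<close>

lemma star_order_flip: "star_order (int n) (\<lambda>x y. le (flip (int n + 1) x * c) (flip (int n + 1) y * c))"
proof
  let ?f = "flip (int n + 1)"
  show "le (?f x * c) (?f x * c)" if "supp x \<subseteq> {1..int n}" for x
    using that c_pos by (intro order.le_refl) (simp add: flip_pos del: flip_simps(4))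
  show "le (?f x * c) (?f z * c)" if "le (?f x * c) (?f y * c)" "le (?f y * c) (?f z * c)" for x y z
    using that by (rule order.le_trans)
  show "le (?f (w * x) * c) (?f (w * y) * c)" if "supp w \<subseteq> {1..int n}" "le (?f x * c) (?f y * c)" for w x y
    using order.le_left[OF _ that(2), of "?f w"] that(1) by (simp add: flip_pos mult.assoc del: flip_simps(4))
  show "le (?f 1 * c) (?f g * c) \<and> le (?f g * c) (?f 1 * c)" if g: "supp g \<subseteq> {2..int n}" for g
  proof -
    have "supp (?f g) \<subseteq> {1..int n - 1}" using g by auto
    then have e: "?f g * c = c * shift 1 (?f g)" unfolding c_def by (rule dn_shift)
    have "supp (shift 1 (?f g)) \<subseteq> {2..int n}" using g by auto
    then show ?thesis
      unfolding e using order.le_fix_right[of c "shift 1 (?f g)"] order.le_fix_right'[of c "shift 1 (?f g)"] c_pos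
      by simp
  qed
  show "le (?f 1 * c) (?f (gen 1) * c)"
    using order.le_mono_gen[of "int n + 1" "int n" "int n"] n by (simp add: c_def)
qed

lemma star_order_pt: "star_order (int n) (\<lambda>x y. le (fl i x * pt i) (fl i y * pt i))"
proof (cases "even i")
  case True
  then show ?thesis using star_order_even[of "i div 2"] by (simp add: fl_def pt_def)
next
  case False
  have "(\<lambda>x y. le (fl i x * pt i) (fl i y * pt i)) =
      (\<lambda>x y. le (flip (int n + 1) x * c) (flip (int n + 1) y * c))"
    using False by (simp add: fl_def pt_def le_T_iff flip: mult.assoc)
  then show ?thesis using star_order_flip by simp
qed

lemma le_pt: "w \<in> pos \<Longrightarrow> le (pt i) (w * pt i)"
  using star_order.le_extend[OF star_order_pt, of 1 "fl i w" i] by simp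

text \<open>For even i the two sides agree by definition. For odd i the reflection of c is
  \<open>up 1 n\<close>, and by \<open>twist_eq\<close> its product with c differs from T by a right
  factor that fixes the base point.\<close>

lemma pt_Suc: "le (pt (Suc i)) (fl i c * pt i)"
proof (cases "even i")
  case True
  then have "pt (Suc i) = fl i c * pt i" by (simp add: pt_def fl_def)
  then show ?thesis using order.le_refl pt_pos by (metis mem_Collect_eq)
next
  case False
  have e: "fl i c = up 1 (int n)" using False by (simp add: fl_def c_def)
  have T: "T = up 1 (int n) * c * up 2 (int n) ^ nat (int n)"
    unfolding c_def by (rule twist_eq) simp
  have "le T (up 1 (int n) * c)"
    unfolding T by (rule order.le_fix_right') (auto simp: c_def supp_power)
  then have "le (T * T ^ (i div 2)) (up 1 (int n) * c * T ^ (i div 2))" by (simp add: le_T_iff)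
  then show ?thesis using False by (simp add: e pt_def mult.assoc)
qed

lemma T_power_le_pt: "le (T ^ (i div 2)) (pt i)"
  using order.le_refl[of "T ^ (i div 2)"] T_pos le_pt[of c "2 * (i div 2)"] c_pos
  by (auto simp: pt_def)

lemma T_power_mono: "j \<le> k \<Longrightarrow> le (T ^ j) (T ^ k)"
  using order.le_extend[of "T ^ j" "T ^ (k - j)"] T_pos by (simp flip: power_add)

end

text \<open>
  The blocks \<open>t 0, t 1, \<dots>\<close> are the paper's \<open>a\<^sub>1, a\<^sub>2, \<dots>\<close>, and \<open>X j\<close> is the product \<open>a\<^sub>p \<cdots> a\<^sub>j\<^sub>+\<^sub>1\<close>.
\<close>
locale alternating = braid +
  fixes t X :: "nat \<Rightarrow> pbraid" and p :: nat
  assumes X_step: "j < p \<Longrightarrow> X j = X (Suc j) * t j"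
    and X_end: "X p = 1"
    and X_neq: "j < p \<Longrightarrow> X j \<noteq> 1"
    and supp_t: "j < p \<Longrightarrow> supp (t j) \<subseteq> lt j"
    and X_no: "j < p \<Longrightarrow> i \<in> lt j \<Longrightarrow> \<not> rdvd (gen i) (X (Suc j))"
begin

lemma supp_t_pos: "j < p \<Longrightarrow> t j \<in> pos"
  using supp_t[of j] n by (auto simp: lt_def split: if_splits)

lemma X_pos: "j \<le> p \<Longrightarrow> X j \<in> pos"
proof (induction rule: inc_induct)
  case base
  then show ?case using X_end by simp
next
  case (step j)
  then show ?case using X_step[of j] supp_t_pos[of j] by simp
qed

lemma X_only:
  assumes "j < p" shows "only (if even j then 1 else int n) (X (Suc j))"
  unfolding only_def
proof (intro allI impI)
  fix i assume i: "rdvd (gen i) (X (Suc j))"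
  then have "i \<in> {1..int n}" using rdvd_gen_supp[OF i] X_pos[of "Suc j"] assms by auto
  moreover have "i \<notin> lt j" using X_no[OF assms] i by blast
  ultimately show "i = (if even j then 1 else int n)" by (auto simp: lt_def split: if_splits)
qed

lemma fl_X_only:
  assumes "j < p"
  shows "only 1 (fl j (X (Suc j)))" "only (int n) (fl (Suc j) (X (Suc j)))"
  using X_only[OF assms] only_flip[of "int n" "X (Suc j)" "int n + 1"] only_flip[of 1 "X (Suc j)" "int n + 1"]
  by (auto simp: fl_def)

text \<open>A trivial block makes two successive remainders equal, and a generator dividing them
  would have to be both gen 1 and gen n. Block 0 is excluded, having no predecessor that restricts X
  0.\<close>

lemma t_neq: "1 \<le> j \<Longrightarrow> j < p \<Longrightarrow> t j \<noteq> 1"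
proof
  assume j: "1 \<le> j" "j < p" "t j = 1"
  then obtain i where i: "j = Suc i" by (cases j) auto
  have e: "X (Suc j) = X j" using X_step[of j] j by simp
  obtain k where k: "rdvd (gen k) (X j)" using rdvd_gen_exists[OF X_neq[OF j(2)]] .
  have "k = (if even i then 1 else int n)" using X_only[of i] k i j by (auto simp: only_def)
  moreover have "k = (if even j then 1 else int n)" using X_only[of j] k e j by (auto simp: only_def)
  ultimately show False using i n by (auto split: if_splits)
qed

text \<open>Block 0 is left out: it fixes the base point and is put back only at the end of the
  estimate.\<close>

fun Z :: "nat \<Rightarrow> pbraid" where
  "Z 0 = 1"
| "Z (Suc j) = t (Suc j) * Z j"

lemma X_Z: "Suc j \<le> p \<Longrightarrow> X 1 = X (Suc j) * Z j"
proof (induction j)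
  case (Suc j)
  then show ?case using X_step[of "Suc j"] by (simp add: mult.assoc)
qed (simp add: One_nat_def)

lemma fl_supp_t: "1 \<le> j \<Longrightarrow> j < p \<Longrightarrow> supp (fl (j - 1) (t j)) \<subseteq> {1..int n - 1}"
  and fl_supp_t': "j < p \<Longrightarrow> supp (fl j (t j)) \<subseteq> {2..int n}"
proof -
  { assume j: "1 \<le> j" "j < p"
    show "supp (fl (j - 1) (t j)) \<subseteq> {1..int n - 1}"
      using supp_t[OF j(2)] j(1) by (auto simp: fl_def lt_def subset_iff split: if_splits) }
  { assume j: "j < p"
    show "supp (fl j (t j)) \<subseteq> {2..int n}"
      using supp_t[OF j] by (auto simp: fl_def lt_def subset_iff split: if_splits) }
qed

text \<open>\<open>block_step\<close> is iterated, always seen through the reflection that puts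
  block j on the letters 1, \<dots>, n - 1. At the start only gen 1 divides t 1, so
  \<open>le_only\<close> with l = 1 leaves no letters for its free factor, which is therefore
  trivial.\<close>

lemma block_bound:
  assumes "1 \<le> j" "Suc j < p"
    and "1 \<le> J" "J \<le> int n - 1" "run J (int n - 1) (fl (j - 1) (t j))" "supp Y \<subseteq> {J + 1..int n - 1}"
  shows "le (fl (j - 1) (Y * dn (int n - 1) 1) * pt (j - 1)) (Z j)"
  using assms
proof (induction j arbitrary: J Y)
  case (Suc j)
  show ?case
  proof (cases "j = 0")
    case True
    have "only 1 (X 1)" using X_only[of 0] Suc.prems by (simp add: One_nat_def)
    moreover have "rdvd (t 1) (X 1)" using X_step[of 1] Suc.prems by auto
    ultimately have "only 1 (t 1)" by (rule only_rdvd)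
    moreover have "supp (t 1) \<subseteq> {1..int n - 1}" using supp_t[of 1] Suc.prems True by (simp add: lt_def)
    moreover have "run J (int n - 1) (t 1)" using Suc.prems True by (simp add: fl_def One_nat_def)
    ultimately obtain x where "supp x \<subseteq> {1..1 - 1 :: int}" "le (Y * dn (int n - 1) 1) (t 1 * x)"
      using order.le_only[of "int n - 1" "t 1" 1 J Y] Suc.prems True n by (auto simp: fl_def)
    then show ?thesis using True by (simp add: fl_def pt_def One_nat_def)
  next
    case False
    define f where "f = fl (j - 1)"
    have fj: "fl j x = f (flip (int n + 1) x)" "fl j x = flip (int n + 1) (f x)" for x
      using fl_Suc[of "j - 1" x] False by (simp_all add: f_def)
    have ff [simp]: "f (f x) = x" "f (x * y) = f x * f y" for x y by (simp_all add: f_def)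
    have parity: "fl (j - 1) = fl (Suc j)" using False by (auto simp: fl_def fun_eq_iff)
    have "le (f (flip (int n + 1) (Y * dn (int n - 1) 1) * f (pt j))) (f (f (t (Suc j)) * (f (t j) * f (Z (j - 1)))))"
    proof (rule block_step[where le = "\<lambda>x y. le (f x) (f y)" and P = "f (pt (j - 1))" and n = "int n"
          and J = J and w = "f (X (Suc (Suc j)))"])
      show "2 \<le> int n" using n by simp
      show "le (f x) (f z)" if "le (f x) (f y)" "le (f y) (f z)" for x y z
        using that by (rule order.le_trans)
      show "le (f (w * x)) (f (w * y))" if "supp w \<subseteq> {1..int n}" "le (f x) (f y)" for w x y
        using that order.le_left[of "f w"] by (simp add: f_def)
      show "star_order (int n) (\<lambda>x y. le (f (flip (int n + 1) x * f (pt j))) (f (flip (int n + 1) y * f (pt j))))"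
        using star_order_pt[of j] by (simp add: fj)
      show "le (f (f (pt j))) (f (dn (int n) 1 * f (pt (j - 1))))"
        using pt_Suc[of "j - 1"] False by (simp add: f_def c_def)
      show "supp (f (t j)) \<subseteq> {1..int n - 1}"
        using fl_supp_t[of j] False Suc.prems by (simp add: f_def)
      show "supp (f (t (Suc j))) \<subseteq> {2..int n}"
        using fl_supp_t'[of "Suc j"] Suc.prems by (simp add: f_def parity)
      show "f (t (Suc j)) \<noteq> 1" using t_neq[of "Suc j"] Suc.prems by (simp add: f_def)
      show "only 1 (f (X (Suc (Suc j))))"
        using fl_X_only(1)[of "Suc j"] Suc.prems by (simp add: f_def parity)
      show "f (X (Suc (Suc j))) \<noteq> 1" using X_neq[of "Suc (Suc j)"] Suc.prems by (simp add: f_def)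
      have e1: "f (X (Suc (Suc j))) * f (t (Suc j)) = f (X (Suc j))"
        using X_step[of "Suc j"] Suc.prems by simp
      show "only (int n) (f (X (Suc (Suc j))) * f (t (Suc j)))"
        using fl_X_only(2)[of j] Suc.prems unfolding e1 by (simp add: f_def parity)
      have "f (X (Suc (Suc j))) * f (t (Suc j)) * f (t j) = f (X j)"
        unfolding e1 using X_step[of j] Suc.prems by simp
      then show "only 1 (f (X (Suc (Suc j))) * f (t (Suc j)) * f (t j))"
        using fl_X_only(1)[of "j - 1"] Suc.prems False by (simp add: f_def)
      show "le (f (Y' * dn (int n - 1) 1 * f (pt (j - 1)))) (f (f (t j) * f (Z (j - 1))))"
        if "1 \<le> J'" "J' \<le> int n - 1" "run J' (int n - 1) (f (t j))" "supp Y' \<subseteq> {J' + 1..int n - 1}" for J' Y'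
      proof -
        have "Z j = t j * Z (j - 1)" using False by (cases j) simp_all
        then show ?thesis using Suc.IH[of J' Y'] that Suc.prems False by (simp add: f_def)
      qed
      show "1 \<le> J" "J \<le> int n - 1" "supp Y \<subseteq> {J + 1..int n - 1}" using Suc.prems by simp_all
      show "run J (int n - 1) (flip (int n + 1) (f (t (Suc j))))" using Suc.prems by (simp add: fj[symmetric])
    qed
    moreover have "Z j = t j * Z (j - 1)" using False by (cases j) simp_all
    ultimately show ?thesis by (simp add: fj(1))
  qed
qed simp

text \<open>The block before the last is bounded by \<open>block_bound\<close> with Y = 1. The last
  block is nontrivial and, suitably reflected, ends in gen n; this letter completes
  \<open>dn (n - 1) 1\<close> to c and so leads to the next point, which the rest of the block does
  not lower.\<close>

lemma pt_bound:
  assumes "2 \<le> p" shows "le (pt (p - 2)) (X 0)"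
proof -
  have X1: "X 1 = Z (p - 1)" using X_Z[of "p - 1"] X_end assms by simp
  have "le (pt (p - 2)) (Z (p - 1))"
  proof (cases "p = 2")
    case True
    then show ?thesis using order.le_extend[of 1 "t 1"] supp_t_pos[of 1] by (simp add: pt_def One_nat_def numeral_2_eq_2)
  next
    case False
    define j where "j = p - 2"
    have j: "1 \<le> j" "Suc j < p" "Suc (Suc j) = p" using False assms by (auto simp: j_def)
    define f where "f = fl (j - 1)"
    have ff [simp]: "f (f x) = x" "f (x * y) = f x * f y" for x y by (simp_all add: f_def)
    have parity: "fl (j - 1) = fl (Suc j)" using j by (auto simp: fl_def fun_eq_iff)
    obtain J y where J: "1 \<le> J" "J \<le> int n" "run J (int n - 1) (f (t j))" "up J (int n) * f (t j) = y * gen (int n)"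
      using complement_run[of "int n" "f (t j)"] fl_supp_t[of j] j n by (auto simp: f_def)
    have only1: "only 1 (f (X j))" using fl_X_only(1)[of "j - 1"] j by (simp add: f_def)
    have onlyn: "only (int n) (f (X (Suc j)))" using fl_X_only(2)[of j] j by (simp add: f_def parity)
    have "f (X (Suc j)) \<noteq> 1" using X_neq[of "Suc j"] j by (simp add: f_def)
    then obtain q where q: "f (X (Suc j)) = q * gen (int n)" using only_factor[OF onlyn] by blast
    have Xj: "f (X j) = f (X (Suc j)) * f (t j)" using X_step[of j] j by simp
    \<comment> \<open>For J = n the letter gen n at the end of the last block would cross block j
      and divide the reflected X j, which only gen 1 does.\<close>
    have "J \<noteq> int n"
    proof
      assume "J = int n"
      then have "f (X j) = q * y * gen (int n)" using Xj q J(4) by (simp add: mult.assoc)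
      then show False using only1 n by (auto simp: only_def rdvd_def)
    qed
    then have "le (f (1 * dn (int n - 1) 1) * pt (j - 1)) (Z j)"
      using block_bound[OF j(1,2), of J 1] J by (simp add: f_def)
    then have "le (t (Suc j) * (f (dn (int n - 1) 1) * pt (j - 1))) (t (Suc j) * Z j)"
      using supp_t_pos[of "Suc j"] j by (intro order.le_left) simp_all
    moreover have "X (Suc j) = t (Suc j)" using X_step[of "Suc j"] X_end j by simp
    then have "t (Suc j) = f q * f (gen (int n))" using q by (metis ff)
    then have "t (Suc j) * (f (dn (int n - 1) 1) * pt (j - 1)) = f q * (f c * pt (j - 1))"
      using n by (simp add: c_def dn_left[of 1 "int n"] mult.assoc)
    moreover have qp: "supp q \<subseteq> {1..int n}"
      using q X_pos[of "Suc j"] j by (metis Un_subset_iff f_def fl_simps(4) less_imp_le_nat mem_Collect_eq supp_simps(2))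
    have "le (f q * pt j) (f q * (f c * pt (j - 1)))"
      using pt_Suc[of "j - 1"] j qp by (intro order.le_left) (simp_all add: f_def)
    moreover have "le (pt j) (f q * pt j)" using qp by (intro le_pt) (simp add: f_def)
    moreover have "Z (Suc j) = t (Suc j) * Z j" "p - 2 = j" "p - 1 = Suc j" using j by auto
    ultimately show ?thesis using order.le_trans by metis
  qed
  also have "le \<dots> (X 0)"
    using X_step[of 0] X1 assms order.le_fix_right[of "X 1" "t 0"] X_pos[of 1] supp_t[of 0] by (simp add: lt_def One_nat_def)
  finally show ?thesis .
qed

lemma T_power_bound: "Suc k \<le> p div 2 \<Longrightarrow> le (T ^ k) (X 0)"
proof -
  assume k: "Suc k \<le> p div 2"
  have "le (T ^ k) (T ^ ((p - 2) div 2))" using k by (intro T_power_mono) auto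
  also have "le \<dots> (pt (p - 2))" by (rule T_power_le_pt)
  also have "le \<dots> (X 0)" using k by (intro pt_bound) auto
  finally show ?thesis .
qed

text \<open>Split one ascending product \<open>?c\<close> off T. A block on the letters 1, \<dots>,
  n - 1 crosses it as an element of G_1, and \<open>?c\<close> itself begins with s_1; the remaining
  power of \<open>?c\<close> is nonnegative.\<close>

lemma block_negative:
  assumes "odd j" "j < p"
  shows "s1_positive (ev T \<otimes>\<^bsub>G\<^esub> inv\<^bsub>G\<^esub> (ev (t j)))"
proof -
  let ?c = "up 1 (int n)" and ?b = "t j"
  have b: "supp ?b \<subseteq> {1..int n - 1}" using supp_t[OF assms(2)] assms(1) by (simp add: lt_def)
  have sb: "supp (shift 1 ?b) \<subseteq> {2..int n}" using b by auto
  have "shift 1 ?b \<in> pos" using sb by force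
  then have pos: "?c \<in> pos" "?c ^ n \<in> pos" "?b \<in> pos" "shift 1 ?b \<in> pos"
    using supp_t_pos[OF assms(2)] by (simp_all add: supp_power)
  have "ev (shift 1 ?b) \<otimes>\<^bsub>G\<^esub> ev ?c = ev ?c \<otimes>\<^bsub>G\<^esub> ev ?b"
    using up_shift[OF b] pos ev_mult by metis
  then have "ev ?c \<otimes>\<^bsub>G\<^esub> inv\<^bsub>G\<^esub> (ev ?b) = inv\<^bsub>G\<^esub> (ev (shift 1 ?b)) \<otimes>\<^bsub>G\<^esub> ev ?c"
    using pos by (metis ev_closed inv_closed inv_solve_left inv_solve_right m_assoc m_closed)
  moreover have "T = ?c ^ n * ?c" by (simp add: twist_def nat_add_distrib power_commutes)
  ultimately have e: "ev T \<otimes>\<^bsub>G\<^esub> inv\<^bsub>G\<^esub> (ev ?b) = ev (?c ^ n) \<otimes>\<^bsub>G\<^esub> (inv\<^bsub>G\<^esub> (ev (shift 1 ?b)) \<otimes>\<^bsub>G\<^esub> ev ?c)"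
    using pos by (simp add: ev_mult m_assoc)
  have "?c = gen 1 * up 2 (int n)" using up_left[of 1 "int n"] n by simp
  then have "ev ?c = braid_gen n 1 \<otimes>\<^bsub>G\<^esub> ev (up 2 (int n))"
    using ev_mult[of "gen 1" "up 2 (int n)"] ev_gen[of 1] n by simp
  then have "s1_positive (ev ?c)"
    using s1_positive_gen ev_G1[of "up 2 (int n)"] s1_positive_right by simp
  then have "s1_positive (inv\<^bsub>G\<^esub> (ev (shift 1 ?b)) \<otimes>\<^bsub>G\<^esub> ev ?c)"
    using ev_G1[OF sb] G1_inv s1_positive_left by blast
  then show ?thesis unfolding e using ev_nonneg[OF pos(2)] s1_nonneg_positive_mult by blast
qed

text \<open>Downward induction on j: an even block lies in G_1 and needs no factor T, an odd one
  uses up one, and T can be moved to it by centrality. The exponent counts the odd indices from j up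
  to p - 1; positivity is strict as soon as there is one.\<close>

lemma quotient_positive:
  "j \<le> p \<Longrightarrow> s1_nonneg (ev (T ^ (p div 2 - j div 2)) \<otimes>\<^bsub>G\<^esub> inv\<^bsub>G\<^esub> (ev (X j))) \<and>
    (1 \<le> p div 2 - j div 2 \<longrightarrow> s1_positive (ev (T ^ (p div 2 - j div 2)) \<otimes>\<^bsub>G\<^esub> inv\<^bsub>G\<^esub> (ev (X j))))"
proof (induction rule: inc_induct)
  case base
  then show ?case using X_end by (simp add: s1_nonneg_def G1_one)
next
  case (step j)
  define d where "d = p div 2 - Suc j div 2"
  let ?X = "X (Suc j)"
  have pos: "t j \<in> pos" "?X \<in> pos" using supp_t_pos X_pos step.hyps by auto
  have inv: "inv\<^bsub>G\<^esub> (ev (X j)) = inv\<^bsub>G\<^esub> (ev (t j)) \<otimes>\<^bsub>G\<^esub> inv\<^bsub>G\<^esub> (ev ?X)"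
    using X_step[of j] step.hyps pos by (simp add: ev_mult inv_mult_group)
  have "ev (T ^ d) \<otimes>\<^bsub>G\<^esub> ev (t j) = ev (t j) \<otimes>\<^bsub>G\<^esub> ev (T ^ d)"
    using twist_power_central[of "t j" "int n" d] pos T_pos(2)[of d] ev_mult by (metis mem_Collect_eq)
  then have comm: "ev (T ^ d) \<otimes>\<^bsub>G\<^esub> inv\<^bsub>G\<^esub> (ev (t j)) = inv\<^bsub>G\<^esub> (ev (t j)) \<otimes>\<^bsub>G\<^esub> ev (T ^ d)"
    using pos T_pos(2)[of d] by (metis ev_closed inv_closed inv_solve_left inv_solve_right m_assoc m_closed)
  have e: "ev (T ^ d) \<otimes>\<^bsub>G\<^esub> inv\<^bsub>G\<^esub> (ev (X j)) =
      inv\<^bsub>G\<^esub> (ev (t j)) \<otimes>\<^bsub>G\<^esub> (ev (T ^ d) \<otimes>\<^bsub>G\<^esub> inv\<^bsub>G\<^esub> (ev ?X))"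
    unfolding inv using comm pos T_pos(2)[of d] by (simp flip: m_assoc)
  show ?case
  proof (cases "even j")
    case True
    then have "Suc j div 2 = j div 2" "inv\<^bsub>G\<^esub> (ev (t j)) \<in> G1"
      using supp_t[of j] step.hyps by (auto simp: lt_def intro!: G1_inv ev_G1)
    then show ?thesis
      using step.IH e unfolding d_def by (auto simp: s1_nonneg_def G1_mult s1_positive_left)
  next
    case False
    then have "Suc j div 2 = Suc (j div 2)" by (metis even_Suc div_Suc dvd_eq_mod_eq_0)
    moreover have "Suc j div 2 \<le> p div 2" using step.hyps by (intro div_le_mono) simp
    ultimately have d: "p div 2 - j div 2 = Suc d" unfolding d_def by arith
    have "ev (T ^ Suc d) \<otimes>\<^bsub>G\<^esub> inv\<^bsub>G\<^esub> (ev (X j)) =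
        (ev T \<otimes>\<^bsub>G\<^esub> inv\<^bsub>G\<^esub> (ev (t j))) \<otimes>\<^bsub>G\<^esub> (ev (T ^ d) \<otimes>\<^bsub>G\<^esub> inv\<^bsub>G\<^esub> (ev ?X))"
      using e pos T_pos(1) T_pos(2)[of d] X_pos[of j] step.hyps by (simp add: ev_mult m_assoc)
    moreover have "s1_positive (ev T \<otimes>\<^bsub>G\<^esub> inv\<^bsub>G\<^esub> (ev (t j)))"
      using False step.hyps by (intro block_negative) auto
    ultimately have "s1_positive (ev (T ^ Suc d) \<otimes>\<^bsub>G\<^esub> inv\<^bsub>G\<^esub> (ev (X j)))"
      using step.IH s1_positive_nonneg_mult unfolding d_def by simp
    then show ?thesis unfolding d by (simp add: s1_nonneg_def)
  qed
qed

lemma T_power_positive: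
  assumes "1 \<le> k" "p div 2 \<le> k"
  shows "s1_positive (ev (T ^ k) \<otimes>\<^bsub>G\<^esub> inv\<^bsub>G\<^esub> (ev (X 0)))"
proof -
  define d where "d = p div 2"
  have q: "s1_nonneg (ev (T ^ d) \<otimes>\<^bsub>G\<^esub> inv\<^bsub>G\<^esub> (ev (X 0)))"
    "1 \<le> d \<Longrightarrow> s1_positive (ev (T ^ d) \<otimes>\<^bsub>G\<^esub> inv\<^bsub>G\<^esub> (ev (X 0)))"
    using quotient_positive[of 0] by (simp_all add: d_def)
  have "T ^ k = T ^ (k - d) * T ^ d" using assms by (simp add: d_def flip: power_add)
  then have "ev (T ^ k) = ev (T ^ (k - d)) \<otimes>\<^bsub>G\<^esub> ev (T ^ d)"
    using ev_mult[OF T_pos(2) T_pos(2)] by simp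
  then have e: "ev (T ^ k) \<otimes>\<^bsub>G\<^esub> inv\<^bsub>G\<^esub> (ev (X 0)) =
      ev (T ^ (k - d)) \<otimes>\<^bsub>G\<^esub> (ev (T ^ d) \<otimes>\<^bsub>G\<^esub> inv\<^bsub>G\<^esub> (ev (X 0)))"
    using T_pos(2) X_pos[of 0] by (simp add: m_assoc)
  show ?thesis
  proof (cases "1 \<le> d")
    case True
    then show ?thesis unfolding e using q ev_nonneg[OF T_pos(2)] s1_nonneg_positive_mult by blast
  next
    case False
    then have "s1_positive (ev (T ^ (k - d)))" using assms by (intro ev_T_positive) simp
    then show ?thesis unfolding e using q s1_positive_nonneg_mult by blast
  qed
qed

end

section \<open>Depth and the comparison\<close>

lemma map_int_upt: "map int [1..<n + 1] = [1..int n]"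
  by (induction n) (simp_all add: upto_rec2 add.commute)

context braid
begin

text \<open>Such a tail exists by \<open>tail_exists\<close>; once it is chosen, right cancellation
  determines the matching \<open>upper\<close>.\<close>

definition lower :: "nat \<Rightarrow> pbraid \<Rightarrow> pbraid" where
  "lower j a = (SOME t. \<exists>x. a = x * t \<and> supp t \<subseteq> lt j \<and> (\<forall>i\<in>lt j. \<not> rdvd (gen i) x))"

definition upper :: "nat \<Rightarrow> pbraid \<Rightarrow> pbraid" where
  "upper j a = (SOME x. a = x * lower j a)"

lemma lower_upper:
  shows "a = upper j a * lower j a" "supp (lower j a) \<subseteq> lt j" "i \<in> lt j \<Longrightarrow> \<not> rdvd (gen i) (upper j a)"
proof -
  obtain x t where "a = x * t" "supp t \<subseteq> lt j" "\<And>i. i \<in> lt j \<Longrightarrow> \<not> rdvd (gen i) x"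
    using tail_exists[of a "lt j"] by blast
  then have "\<exists>t x. a = x * t \<and> supp t \<subseteq> lt j \<and> (\<forall>i\<in>lt j. \<not> rdvd (gen i) x)" by blast
  from someI_ex[OF this] obtain x where x: "a = x * lower j a" "supp (lower j a) \<subseteq> lt j"
    "\<forall>i\<in>lt j. \<not> rdvd (gen i) x" unfolding lower_def by blast
  have u: "a = upper j a * lower j a" unfolding upper_def by (rule someI[of _ x]) (rule x(1))
  then have "upper j a = x" using x(1) by (metis pbraid_right_cancel)
  then show "a = upper j a * lower j a" "supp (lower j a) \<subseteq> lt j"
    "i \<in> lt j \<Longrightarrow> \<not> rdvd (gen i) (upper j a)" using u x by auto
qed

fun remain :: "pbraid \<Rightarrow> nat \<Rightarrow> pbraid" where
  "remain a 0 = a"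
| "remain a (Suc j) = upper j (remain a j)"

definition block :: "pbraid \<Rightarrow> nat \<Rightarrow> pbraid" where "block a j = lower j (remain a j)"

lemma remain_step: "remain a j = remain a (Suc j) * block a j"
  unfolding block_def remain.simps by (rule lower_upper(1))

lemma remain_one: "remain a j = 1 \<Longrightarrow> j \<le> k \<Longrightarrow> remain a k = 1"
proof (induction k)
  case (Suc k)
  show ?case
  proof (cases "j = Suc k")
    case False
    then show ?thesis using Suc remain_step[of a k] by (metis le_SucE pbraid_mult_eq_1)
  qed (use Suc.prems in simp)
qed simp

lemma block_one: "remain a j = 1 \<Longrightarrow> block a j = 1"
  using remain_step[of a j] by (metis pbraid_mult_eq_1)

lemma remain_no: "i \<in> lt j \<Longrightarrow> \<not> rdvd (gen i) (remain a (Suc j))"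
  using lower_upper(3)[of i j "remain a j"] by simp

lemma remain_pos: "a \<in> pos \<Longrightarrow> remain a j \<in> pos"
proof (induction j)
  case (Suc j)
  then have "remain a j \<in> pos" by simp
  then show ?case by (subst (asm) remain_step) (simp del: remain.simps)
qed simp

text \<open>A generator dividing the remainder after block j is not among the letters of block j,
  hence is among those of the next block, which is therefore nontrivial. The count starts after
  block 0, which may be trivial.\<close>

lemma remain_decreases:
  assumes "a \<in> pos" "remain a (Suc j) \<noteq> 1"
  shows "len (remain a (Suc (Suc j))) < len (remain a (Suc j))"
proof -
  obtain i where i: "rdvd (gen i) (remain a (Suc j))" using rdvd_gen_exists[OF assms(2)] .
  have "i \<in> {1..int n}" using rdvd_gen_supp[OF i] remain_pos[OF assms(1), of "Suc j"] by auto
  moreover have "i \<notin> lt j" using remain_no i by blast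
  ultimately have "i \<in> lt (Suc j)" using n by (auto simp: lt_def split: if_splits)
  then have "block a (Suc j) \<noteq> 1"
    using i remain_no[of i "Suc j" a] remain_step[of a "Suc j"] by (metis mult.right_neutral)
  then show ?thesis
    using arg_cong[OF remain_step[of a "Suc j"], of len] by (simp del: remain.simps) (metis len_eq_0_iff not_gr_zero)
qed

lemma remain_ends:
  assumes "a \<in> pos" shows "\<exists>j. remain a j = 1"
proof (rule ccontr)
  assume "\<not> ?thesis"
  then have "len (remain a (Suc (Suc j))) < len (remain a (Suc j))" for j
    using remain_decreases[OF assms, of j] by blast
  then have "len (remain a (Suc j)) + j \<le> len (remain a (Suc 0))" for j
    by (induction j) (simp_all del: remain.simps, metis Suc_leI add_Suc_right add_le_mono1 le_trans order_less_imp_le add_Suc)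
  from this[of "Suc (len (remain a (Suc 0)))"] show False by simp
qed

definition blocks :: "pbraid \<Rightarrow> nat" where "blocks a = (LEAST j. remain a j = 1)"

lemma alternating_blocks:
  assumes "a \<in> pos" shows "alternating n (block a) (remain a) (blocks a)"
proof
  show "remain a j = remain a (Suc j) * block a j" for j by (rule remain_step)
  show "remain a (blocks a) = 1"
    unfolding blocks_def using remain_ends[OF assms] by (rule LeastI_ex)
  show "remain a j \<noteq> 1" if "j < blocks a" for j
    using not_less_Least that unfolding blocks_def by blast
  show "supp (block a j) \<subseteq> lt j" for j unfolding block_def by (rule lower_upper(2))
  show "\<not> rdvd (gen i) (remain a (Suc j))" if "i \<in> lt j" for i j by (rule remain_no[OF that])
qed

abbreviation N where "N \<equiv> ev ` sub {1..int n - 1}"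
abbreviation M1 where "M1 \<equiv> ev ` sub {2..int n}"

lemma tail_remain:
  assumes "a \<in> pos"
  shows "tail G M (if even j then M1 else N) (ev (remain a j)) = ev (block a j)"
proof -
  have K: "(if even j then M1 else N) = ev ` sub (lt j)" by (simp add: lt_def)
  have e: "ev (remain a j) = ev (remain a (Suc j) * block a j)" by (rule arg_cong[OF remain_step])
  show ?thesis
    unfolding e K
  proof (rule tail_eq)
    show "remain a (Suc j) * block a j \<in> pos"
      using remain_pos[OF assms, of j] by (subst (asm) remain_step)
    show "supp (block a j) \<subseteq> lt j" unfolding block_def by (rule lower_upper(2))
    show "lt j \<subseteq> {1..int n}" by (auto simp: lt_def)
  qed (rule remain_no)
qed

lemma block_pos: "a \<in> pos \<Longrightarrow> block a j \<in> pos"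
proof -
  assume "a \<in> pos"
  then have "remain a j \<in> pos" by (rule remain_pos)
  then show ?thesis by (subst (asm) remain_step) (simp del: remain.simps)
qed

text \<open>Each entry is forced to be the tail of what remains and can then be cancelled on the
  right, so every alternating form follows the computed blocks.\<close>

lemma alternating_form_drop:
  assumes "a \<in> pos" and form: "is_alternating_form G M N M1 (ev a) as"
  shows "j \<le> length as \<Longrightarrow> list_prod G (rev (drop j as)) = ev (remain a j)"
    and "j < length as \<Longrightarrow> as ! j = ev (block a j)"
proof -
  have sub: "set as \<subseteq> M" and a: "ev a = list_prod G (rev as)"
    and nth: "\<And>i. i < length as \<Longrightarrow> as ! i = tail G M (if even i then M1 else N) (list_prod G (rev (drop i as)))"
    using form by (auto simp: is_alternating_form_def)
  have carr: "M \<subseteq> carrier G" by auto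
  show drop: "list_prod G (rev (drop j as)) = ev (remain a j)" if "j \<le> length as" for j
    using that
  proof (induction j)
    case 0
    then show ?case using a by simp
  next
    case (Suc j)
    have IH: "list_prod G (rev (drop j as)) = ev (remain a j)" using Suc by simp
    have b: "as ! j = ev (block a j)" using nth[of j] Suc.prems IH tail_remain[OF assms(1)] by simp
    have d: "drop j as = as ! j # drop (Suc j) as" using Suc.prems by (simp add: Cons_nth_drop_Suc)
    have c: "set (rev (drop (Suc j) as)) \<subseteq> carrier G" using sub carr set_drop_subset[of "Suc j" as] by auto
    have "list_prod G (rev (drop (Suc j) as)) \<otimes>\<^bsub>G\<^esub> ev (block a j) = ev (remain a (Suc j)) \<otimes>\<^bsub>G\<^esub> ev (block a j)"
      using IH list_prod_append[OF c, of "[as ! j]"] b block_pos[OF assms(1), of j] remain_pos[OF assms(1), of "Suc j"]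
        remain_step[of a j] ev_mult[of "remain a (Suc j)" "block a j"] unfolding d
      by (simp del: remain.simps)
    then show ?case
      using right_cancel[OF ev_closed[OF block_pos[OF assms(1), of j]] list_prod_closed[OF c]
          ev_closed[OF remain_pos[OF assms(1), of "Suc j"]]] by blast
  qed
  show "j < length as \<Longrightarrow> as ! j = ev (block a j)"
    using nth[of j] drop[of j] tail_remain[OF assms(1)] by simp
qed

text \<open>A form must run until the remainder is 1, and it cannot go on after that, because its
  last entry would be trivial.\<close>

lemma alternating_form_length:
  assumes "a \<in> pos" and form: "is_alternating_form G M N M1 (ev a) as"
  shows "length as = blocks a"
proof (rule antisym)
  have "ev (remain a (length as)) = ev 1" using alternating_form_drop(1)[OF assms, of "length as"] by simp
  then have "remain a (length as) = 1" using ev_inject[of _ 1] remain_pos[OF assms(1)] by simp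
  then show "blocks a \<le> length as" unfolding blocks_def by (rule Least_le)
  interpret alternating n "block a" "remain a" "blocks a" by (rule alternating_blocks[OF assms(1)])
  show "length as \<le> blocks a"
  proof (rule ccontr)
    assume l: "\<not> ?thesis"
    then have "remain a (length as - 1) = 1" using remain_one[OF X_end] by simp
    then have "as ! (length as - 1) = \<one>\<^bsub>G\<^esub>"
      using alternating_form_drop(2)[OF assms, of "length as - 1"] block_one l by simp
    moreover have "last as \<noteq> \<one>\<^bsub>G\<^esub>" "as \<noteq> []" using form by (auto simp: is_alternating_form_def)
    ultimately show False by (simp add: last_conv_nth)
  qed
qed

lemma alternating_form_exists:
  assumes "a \<in> pos" "a \<noteq> 1"
  shows "is_alternating_form G M N M1 (ev a) (map (\<lambda>j. ev (block a j)) [0..<blocks a])"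
proof -
  interpret alternating n "block a" "remain a" "blocks a" by (rule alternating_blocks[OF assms(1)])
  let ?as = "map (\<lambda>j. ev (block a j)) [0..<blocks a]"
  have p: "blocks a \<noteq> 0" using X_end assms(2) by (cases "blocks a") auto
  have drop: "list_prod G (rev (drop j ?as)) = ev (remain a j)" if "j \<le> blocks a" for j
    using that
  proof (induction rule: inc_induct)
    case base
    then show ?case using X_end by simp
  next
    case (step j)
    have d: "drop j ?as = ev (block a j) # drop (Suc j) ?as"
      using step.hyps by (simp add: Cons_nth_drop_Suc[symmetric])
    have "set (rev (drop (Suc j) ?as)) \<subseteq> carrier G"
      using set_drop_subset[of "Suc j" ?as] block_pos[OF assms(1)] by force
    then have "list_prod G (rev (drop j ?as)) = ev (remain a (Suc j)) \<otimes>\<^bsub>G\<^esub> ev (block a j)"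
      unfolding d using step.IH block_pos[OF assms(1), of j]
      by (simp add: list_prod_append del: remain.simps)
    also have "\<dots> = ev (remain a j)"
      using remain_step[of a j] ev_mult[of "remain a (Suc j)" "block a j"] block_pos[OF assms(1), of j]
        remain_pos[OF assms(1), of "Suc j"] by (simp del: remain.simps)
    finally show ?case .
  qed
  have "remain a (blocks a - 1) = block a (blocks a - 1)"
    using X_step[of "blocks a - 1"] X_end p by simp
  then have "block a (blocks a - 1) \<noteq> 1" using X_neq[of "blocks a - 1"] p by simp
  then have "last ?as \<noteq> \<one>\<^bsub>G\<^esub>"
    using p ev_inject[of "block a (blocks a - 1)" 1] block_pos[OF assms(1)] by (simp add: last_map)
  moreover have "ev a = list_prod G (rev ?as)" using drop[of 0] by simp
  moreover have "?as ! i = tail G M (if even i then M1 else N) (list_prod G (rev (drop i ?as)))"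
    if "i < length ?as" for i
    using that drop[of i] tail_remain[OF assms(1), of i] by simp
  moreover have "set ?as \<subseteq> M" using block_pos[OF assms(1)] by auto
  ultimately show ?thesis using p unfolding is_alternating_form_def by auto
qed

text \<open>Both clauses in the definition of depth amount to p div 2. The unit has breadth 1 by
  convention but no blocks; either number gives depth 0.\<close>

lemma depth_eq:
  assumes "a \<in> pos" shows "depth G M N M1 (ev a) = blocks a div 2"
proof (cases "a = 1")
  case True
  have "blocks 1 = 0" unfolding blocks_def by (rule Least_eq_0) simp
  then show ?thesis using True by (simp add: depth_def breadth_def)
next
  case False
  let ?as = "map (\<lambda>j. ev (block a j)) [0..<blocks a]"
  have "(THE as. is_alternating_form G M N M1 (ev a) as) = ?as"
  proof (rule the_equality)
    show "is_alternating_form G M N M1 (ev a) ?as" by (rule alternating_form_exists[OF assms False])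
    show "as = ?as" if "is_alternating_form G M N M1 (ev a) as" for as
      using alternating_form_length[OF assms that] alternating_form_drop(2)[OF assms that]
      by (intro nth_equalityI) auto
  qed
  moreover have "ev a \<noteq> \<one>\<^bsub>G\<^esub>" using ev_inject[of a 1] assms False by simp
  ultimately have "breadth G M N M1 (ev a) = blocks a" by (simp add: breadth_def)
  then show ?thesis by (simp add: depth_def Let_def) presburger
qed

lemma depth_le:
  assumes "a \<in> pos" "1 \<le> k" "depth G M N M1 (ev a) \<le> k"
  shows "s1_positive (ev (T ^ k) \<otimes>\<^bsub>G\<^esub> inv\<^bsub>G\<^esub> (ev a))"
  using alternating.T_power_positive[OF alternating_blocks[OF assms(1)] assms(2)] assms
  by (simp add: depth_eq)

lemma depth_gt:
  assumes "a \<in> pos" "k < depth G M N M1 (ev a)"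
  shows "le (T ^ k) a"
  using alternating.T_power_bound[OF alternating_blocks[OF assms(1)], of k] assms
  by (simp add: depth_eq)

text \<open>Depth at most k would make T^k T^-k = 1 an s_1-positive element; depth above k + 1 would
  give T^(k+1) \<le> T^k and hence a nonnegative inverse of T.\<close>

lemma depth_T:
  assumes "1 \<le> k" shows "depth G M N M1 (ev (T ^ k)) = k + 1"
proof (rule antisym)
  show "k + 1 \<le> depth G M N M1 (ev (T ^ k))"
  proof (rule ccontr)
    assume "\<not> ?thesis"
    then have "s1_positive (ev (T ^ k) \<otimes>\<^bsub>G\<^esub> inv\<^bsub>G\<^esub> (ev (T ^ k)))"
      using assms by (intro depth_le T_pos) auto
    then show False using not_s1_positive_one T_pos(2)[of k] by simp
  qed
  show "depth G M N M1 (ev (T ^ k)) \<le> k + 1"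
  proof (rule ccontr)
    assume "\<not> ?thesis"
    then have "le (T ^ Suc k) (T ^ k)" by (intro depth_gt T_pos) auto
    then have "le (T * T ^ k) (1 * T ^ k)" by simp
    moreover have "inv\<^bsub>G\<^esub> (ev T) \<in> carrier G" using T_pos(1) by simp
    ultimately have "s1_nonneg (inv\<^bsub>G\<^esub> (ev T))" unfolding le_T_iff by (simp add: le_def)
    then show False using not_s1_positive_inverse[of "ev T"] ev_T_positive[of 1] by simp
  qed
qed

section \<open>The \<Delta>-form and the two inclusions\<close>

lemma T_form:
  "\<exists>b j. x = b * T ^ j \<and> \<not> rdvd T b"
proof (induction "len x" arbitrary: x rule: less_induct)
  case less
  show ?case
  proof (cases "rdvd T x")
    case True
    then obtain y where y: "x = y * T" unfolding rdvd_def by blast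
    have "supp T = {1..int n}" by (simp add: twist_def supp_power)
    then have "supp T \<noteq> {}" using n by simp
    then have "T \<noteq> 1" using supp_empty_iff by blast
    then have "len y < len x" using y by (simp, metis len_eq_0_iff not_gr_zero)
    then obtain b j where "y = b * T ^ j" "\<not> rdvd T b" using less.hyps by blast
    then show ?thesis using y by (intro exI[of _ b] exI[of _ "Suc j"]) (simp add: mult.assoc power_commutes)
  next
    case False
    then show ?thesis by (intro exI[of _ x] exI[of _ 0]) simp
  qed
qed

lemma list_prod_ev: "set is \<subseteq> {1..n} \<Longrightarrow> list_prod G (map (braid_gen n) is) = ev (pb (map int is))"
proof (induction "is")
  case (Cons i "is")
  then have "gen (int i) \<in> pos" "pb (map int is) \<in> pos" by auto
  then show ?case using Cons ev_gen[of i] by (simp add: pb_Cons ev_mult)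
qed simp

lemma garside_element:
  "list_prod G (map (braid_gen n) [1..<n + 1]) [^]\<^bsub>G\<^esub> (n + 1) = ev T"
proof -
  have "list_prod G (map (braid_gen n) [1..<n + 1]) = ev (up 1 (int n))"
  proof -
    have "set [1..<n + 1] \<subseteq> {1..n}" by auto
    from list_prod_ev[OF this] show ?thesis by (simp only: map_int_upt up_def)
  qed
  moreover have "T = up 1 (int n) ^ (n + 1)" unfolding twist_def by (rule arg_cong[of _ _ "(^) _"]) simp
  ultimately show ?thesis using ev_power[of "up 1 (int n)" "n + 1"] by (simp only: supp_up mem_Collect_eq order_refl)
qed

lemma ev_T_int_power: "ev T [^]\<^bsub>G\<^esub> (int k) = ev (T ^ k)"
  using ev_power[OF T_pos(1)] by (simp add: int_pow_int)

lemma ev_T_central: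
  assumes "a \<in> pos"
  shows "ev a \<otimes>\<^bsub>G\<^esub> inv\<^bsub>G\<^esub> (ev (T ^ k)) = inv\<^bsub>G\<^esub> (ev (T ^ k)) \<otimes>\<^bsub>G\<^esub> ev a"
proof -
  have p: "ev a \<in> carrier G" "ev (T ^ k) \<in> carrier G" using assms T_pos(2)[of k] by simp_all
  have "ev (T ^ k) \<otimes>\<^bsub>G\<^esub> ev a = ev a \<otimes>\<^bsub>G\<^esub> ev (T ^ k)"
    using twist_power_central[of a "int n" k] assms T_pos(2)[of k] ev_mult by (metis mem_Collect_eq)
  then have "inv\<^bsub>G\<^esub> (ev (T ^ k)) \<otimes>\<^bsub>G\<^esub> (ev (T ^ k) \<otimes>\<^bsub>G\<^esub> ev a) \<otimes>\<^bsub>G\<^esub> inv\<^bsub>G\<^esub> (ev (T ^ k)) =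
     inv\<^bsub>G\<^esub> (ev (T ^ k)) \<otimes>\<^bsub>G\<^esub> (ev a \<otimes>\<^bsub>G\<^esub> ev (T ^ k)) \<otimes>\<^bsub>G\<^esub> inv\<^bsub>G\<^esub> (ev (T ^ k))" by simp
  moreover have "inv\<^bsub>G\<^esub> (ev (T ^ k)) \<otimes>\<^bsub>G\<^esub> (ev (T ^ k) \<otimes>\<^bsub>G\<^esub> ev a) = ev a"
    using p by (simp flip: m_assoc)
  moreover have "inv\<^bsub>G\<^esub> (ev (T ^ k)) \<otimes>\<^bsub>G\<^esub> (ev a \<otimes>\<^bsub>G\<^esub> ev (T ^ k)) \<otimes>\<^bsub>G\<^esub> inv\<^bsub>G\<^esub> (ev (T ^ k)) =
      inv\<^bsub>G\<^esub> (ev (T ^ k)) \<otimes>\<^bsub>G\<^esub> ev a"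
    using p by (simp add: m_assoc)
  ultimately show ?thesis by simp
qed

theorem HG1_positive_imp_s1_positive:
  assumes "\<alpha> \<in> carrier G" "HG1_positive G M (ev T) N M1 \<alpha>"
  shows "s1_positive \<alpha>"
proof -
  obtain b k where b: "is_Delta_form G M (ev T) (inv\<^bsub>G\<^esub> \<alpha>) b (- k)" "1 \<le> k"
    "depth G M N M1 b < depth G M N M1 (ev T [^]\<^bsub>G\<^esub> k)"
    using assms(2) by (auto simp: HG1_positive_def HG1_negative_def)
  obtain a where a: "a \<in> pos" "b = ev a"
    using b(1) by (auto simp: is_Delta_form_def unmovable_def)
  obtain j where j: "k = int j" "1 \<le> j"
    using b(2) by (metis nonneg_int_cases of_nat_1 of_nat_le_iff order_trans zero_le_one)
  \<comment> \<open>The depth of T^j is j + 1, so the strict inequality is exactly the hypothesis of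
    \<open>depth_le\<close>.\<close>
  have "depth G M N M1 (ev a) \<le> j" using b(3) a(2) j depth_T[OF j(2)] by (simp add: ev_T_int_power)
  then have pos: "s1_positive (ev (T ^ j) \<otimes>\<^bsub>G\<^esub> inv\<^bsub>G\<^esub> (ev a))" using depth_le a(1) j(2) by blast
  have "inv\<^bsub>G\<^esub> \<alpha> = ev a \<otimes>\<^bsub>G\<^esub> inv\<^bsub>G\<^esub> (ev (T ^ j))"
    using b(1) a(2) j(1) T_pos(1) by (simp add: is_Delta_form_def int_pow_neg ev_T_int_power)
  then have "\<alpha> = inv\<^bsub>G\<^esub> (ev a \<otimes>\<^bsub>G\<^esub> inv\<^bsub>G\<^esub> (ev (T ^ j)))" using assms(1) by (metis inv_inv)
  also have "\<dots> = ev (T ^ j) \<otimes>\<^bsub>G\<^esub> inv\<^bsub>G\<^esub> (ev a)"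
    using a(1) T_pos(2)[of j] by (simp add: inv_mult_group)
  finally show ?thesis using pos by simp
qed

theorem s1_positive_imp_HG1_positive:
  assumes "s1_positive \<alpha>"
  shows "HG1_positive G M (ev T) N M1 \<alpha>"
proof -
  let ?\<beta> = "inv\<^bsub>G\<^esub> \<alpha>"
  have \<alpha>: "\<alpha> \<in> carrier G" using s1_positive_closed[OF assms] .
  have neg: "\<not> s1_nonneg ?\<beta>" using not_s1_positive_inverse[OF assms] by blast
  obtain x m where x: "x \<in> pos" "?\<beta> \<otimes>\<^bsub>G\<^esub> ev (T ^ m) = ev x" using carrier_fraction \<alpha> by (metis inv_closed)
  obtain a j where a: "x = a * T ^ j" "\<not> rdvd T a" using T_form by blast
  have ap: "a \<in> pos" using x(1) a(1) by simp
  have \<beta>: "?\<beta> = ev x \<otimes>\<^bsub>G\<^esub> inv\<^bsub>G\<^esub> (ev (T ^ m))"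
    using x \<alpha> T_pos(2)[of m] by (simp add: inv_solve_right)
  \<comment> \<open>If the denominator cancelled completely, the inverse of \<alpha> would be a
    positive braid and thus nonnegative.\<close>
  have jm: "j < m"
  proof (rule ccontr)
    assume "\<not> j < m"
    then have "x = a * T ^ (j - m) * T ^ m" using a(1) by (simp add: mult.assoc flip: power_add)
    moreover have "a * T ^ (j - m) \<in> pos" using ap T_pos(2)[of "j - m"] by simp
    ultimately have "ev x = ev (a * T ^ (j - m)) \<otimes>\<^bsub>G\<^esub> ev (T ^ m)"
      using ev_mult[OF _ T_pos(2)] by metis
    then have "?\<beta> = ev (a * T ^ (j - m))"
      using \<beta> \<open>a * T ^ (j - m) \<in> pos\<close> T_pos(2)[of m] by (simp add: m_assoc)
    then show False using neg ev_nonneg \<open>a * T ^ (j - m) \<in> pos\<close> by metis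
  qed
  define k where "k = m - j"
  have k: "1 \<le> k" "m = k + j" using jm by (auto simp: k_def)
  have "ev x = ev a \<otimes>\<^bsub>G\<^esub> ev (T ^ j)" "ev (T ^ m) = ev (T ^ k) \<otimes>\<^bsub>G\<^esub> ev (T ^ j)"
    using a(1) ap T_pos(2) k(2) by (simp_all add: power_add ev_mult)
  moreover have "ev (T ^ j) \<otimes>\<^bsub>G\<^esub> (inv\<^bsub>G\<^esub> (ev (T ^ j)) \<otimes>\<^bsub>G\<^esub> inv\<^bsub>G\<^esub> (ev (T ^ k))) = inv\<^bsub>G\<^esub> (ev (T ^ k))"
    using T_pos(2)[of j] T_pos(2)[of k] by (simp flip: m_assoc)
  ultimately have \<beta>: "?\<beta> = ev a \<otimes>\<^bsub>G\<^esub> inv\<^bsub>G\<^esub> (ev (T ^ k))"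
    unfolding \<beta> using ap T_pos(2)[of j] T_pos(2)[of k] by (simp add: inv_mult_group m_assoc)
  \<comment> \<open>By centrality of T, the comparison T^k \<le> a says that the inverse of \<alpha>
    is nonnegative.\<close>
  have "\<not> le (T ^ k) a"
    using neg unfolding \<beta> ev_T_central[OF ap] by (simp add: le_def)
  then have "depth G M N M1 (ev a) \<le> k" using depth_gt[OF ap] by (metis not_le)
  then have d: "depth G M N M1 (ev a) < depth G M N M1 (ev T [^]\<^bsub>G\<^esub> int k)"
    using depth_T[OF k(1)] by (simp add: ev_T_int_power)
  have "is_Delta_form G M (ev T) ?\<beta> (ev a) (- int k)"
    unfolding is_Delta_form_def unmovable_def
    using ap le_R_iff[OF T_pos(1) ap] a(2) \<beta> T_pos(1) by (simp add: int_pow_neg ev_T_int_power)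
  then show ?thesis
    unfolding HG1_positive_def HG1_negative_def using d k(1)
    by (intro exI[of _ "ev a"] exI[of _ "int k"]) simp
qed

end

theorem proposition4p4:
  fixes n :: nat
    and G :: "nat word set monoid"
    and s :: "nat \<Rightarrow> nat word set"
    and M G1 M1 N :: "nat word set set"
    and \<Delta> :: "nat word set"
  assumes "n \<ge> 2"
    and "G = braid_group n"
    and "s = braid_gen n"
    and "M = generate_submonoid G (s ` {1..n})"
    and "\<Delta> = list_prod G (map s [1..<n + 1]) [^]\<^bsub>G\<^esub> (n + 1)"
    and "G1 = generate G (s ` {2..n})"
    and "M1 = generate_submonoid G (s ` {2..n})"
    and "N = generate_submonoid G (s ` {1..n - 1})"
  shows "{\<alpha> \<in> carrier G. HG1_positive G M \<Delta> N M1 \<alpha>} =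
    {\<alpha> \<in> carrier G. gen_positive G (s 1) G1 \<alpha>}"
proof -
  interpret B: braid n using assms(1) by unfold_locales
  have i: "int ` {1..n} = {1..int n}" "int ` {2..n} = {2..int n}" "int ` {1..n - 1} = {1..int n - 1}"
    using assms(1) by (simp_all add: image_int_atLeastAtMost of_nat_diff)
  have M: "M = B.ev ` {x. supp x \<subseteq> {1..int n}}" and M1: "M1 = B.ev ` B.sub {2..int n}"
    and N: "N = B.ev ` B.sub {1..int n - 1}"
    using B.generate_submonoid_eq[of "{1..n}"] B.generate_submonoid_eq[of "{2..n}"]
      B.generate_submonoid_eq[of "{1..n - 1}"] assms i by (auto simp: B.sub_def)
  have D: "\<Delta> = B.ev (twist (int n))" using B.garside_element assms by simp
  show ?thesis
    using B.HG1_positive_imp_s1_positive B.s1_positive_imp_HG1_positive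
    unfolding M M1 N D assms(2,3,6) B.G1_def by auto
qed

end
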